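(* For all rational input (discrete probability measures $P_1,\dots,P_N$ on $\mathbb{R}^d$ with rational support points and rational masses, and rational weights $\lambda_1,\dots,\lambda_N>0$ with $\sum_{i=1}^N\lambda_i=1$), a measure can be computed in strongly-polynomial time that is a $2$-approximation of a barycenter of $P_1,\dots,P_N$ and for which there is a non-mass splitting transport to $P_1,\dots,P_N$ realizing this bound. That is, the computed measure $P'$ satisfies $\phi(P')\le2\cdot\phi(\bar P)$ for a barycenter $\bar P$, and there is a non-mass splitting transport from $P'$ to $P_1,\dots,P_N$ of cost at most $2\cdot\phi(\bar P)$.
   Context: A discrete probability measure on $\mathbb{R}^d$ is a probability measure with finite support; $P_i$ is given by the list of its support points $x_{ik}$ ($k=1,\dots,|P_i|$) and their masses $d_{ik}>0$. $W_2$ is the quadratic Wasserstein distance (Euclidean ground norm), $\phi(P)=\sum_{i=1}^N\lambda_iW_2(P,P_i)^2$, and a barycenter $\bar P$ is a minimizer of $\phi$ over all probability measures on $\mathbb{R}^d$ with finite second moments. A transport from a discrete probability measure $P_0$ (support points $x_j$ with masses $d_j$) to $P_1,\dots,P_N$ is a family $y=(y_{ijk})$, $y_{ijk}\ge0$, with $\sum_ky_{ijk}=d_j$ for all $i,j$ and $\sum_jy_{ijk}=d_{ik}$ for all $i,k$. Its cost is $\sum_i\lambda_i\sum_j\sum_k\|x_j-x_{ik}\|^2y_{ijk}$. It is non-mass splitting if for all support points $x_j$ of $P_0$ and all $i$ there is exactly one $k$ with $y_{ijk}=d_j$, while $y_{ijk'}=0$ for all $k'\neq k$. Strongly-polynomial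 time means that the number of elementary arithmetic operations (including comparisons) on rational numbers is bounded by a polynomial in the number of numerical entries of the input (hence in $N$, $d$ and $\sum_i|P_i|$) only, independently of the size (bit length) of these numbers, in contrast to weakly-polynomial time, where the number of operations may also depend polynomially on the bit length of the input numbers. *)

theory Defs
  imports "HOL-Analysis.Analysis" "HOL-Computational_Algebra.Polynomial"
begin

section \<open>Wasserstein barycenters on Euclidean space\<close>

text \<open>
  The dimension is part of the input of the algorithm, so it cannot be a type.  The space of
  dimension \<open>d\<close> consists of the functions on \<open>{..<d}\<close> (extended by \<open>undefined\<close>); its product
  sigma-algebra is the Borel sigma-algebra.
\<close>

definition Rd :: "nat \<Rightarrow> (nat \<Rightarrow> real) measure" where
  "Rd d = PiM {..<d} (\<lambda>_. borel)"

definition edist :: "nat \<Rightarrow> (nat \<Rightarrow> real) \<Rightarrow> (nat \<Rightarrow> real) \<Rightarrow> real" where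
  "edist d x y = L2_set (\<lambda>c. x c - y c) {..<d}"

definition couplings ::
  "nat \<Rightarrow> (nat \<Rightarrow> real) measure \<Rightarrow> (nat \<Rightarrow> real) measure
    \<Rightarrow> ((nat \<Rightarrow> real) \<times> (nat \<Rightarrow> real)) measure set" where
  "couplings d P Q =
    {\<pi>. sets \<pi> = sets (Rd d \<Otimes>\<^sub>M Rd d) \<and> distr \<pi> (Rd d) fst = P \<and> distr \<pi> (Rd d) snd = Q}"

text \<open>
  The infimum is finite whenever both measures have finite second moments, so \<open>enn2real\<close> loses
  nothing in the uses below.
\<close>

definition W2 :: "nat \<Rightarrow> (nat \<Rightarrow> real) measure \<Rightarrow> (nat \<Rightarrow> real) measure \<Rightarrow> real" where
  "W2 d P Q = sqrt (enn2real
    (INF \<pi>\<in>couplings d P Q. \<integral>\<^sup>+ z. ennreal ((edist d (fst z) (snd z))\<^sup>2) \<partial>\<pi>))"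

definition P2 :: "nat \<Rightarrow> (nat \<Rightarrow> real) measure set" where
  "P2 d = {P. sets P = sets (Rd d) \<and> emeasure P (space P) = 1 \<and>
    (\<integral>\<^sup>+ x. ennreal ((L2_set x {..<d})\<^sup>2) \<partial>P) < \<infinity>}"

text \<open>
  A discrete measure is the list of its support points, given by their coordinates, each paired
  with its mass.  Only rational data occur, as input or as output of an algorithm.
\<close>

type_synonym dmeasure = "(rat list \<times> rat) list"

definition supp_pt :: "dmeasure \<Rightarrow> nat \<Rightarrow> rat list" where
  "supp_pt P k = fst (P ! k)"

definition mass :: "dmeasure \<Rightarrow> nat \<Rightarrow> rat" where
  "mass P k = snd (P ! k)"

definition discrete_prob :: "nat \<Rightarrow> dmeasure \<Rightarrow> bool" where
  "discrete_prob d P \<longleftrightarrow>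
    distinct (map fst P) \<and>
    (\<forall>k<length P. length (supp_pt P k) = d \<and> mass P k > 0) \<and>
    (\<Sum>k<length P. mass P k) = 1"

definition pt :: "nat \<Rightarrow> rat list \<Rightarrow> (nat \<Rightarrow> real)" where
  "pt d x = (\<lambda>c\<in>{..<d}. real_of_rat (x ! c))"

definition law :: "nat \<Rightarrow> dmeasure \<Rightarrow> (nat \<Rightarrow> real) measure" where
  "law d P = distr (point_measure {..<length P} (\<lambda>k. ennreal (real_of_rat (mass P k))))
    (Rd d) (\<lambda>k. pt d (supp_pt P k))"

record bary_input =
  space_dim :: nat
  weights :: "rat list"
  measures :: "dmeasure list"

abbreviation num :: "bary_input \<Rightarrow> nat" where
  "num I \<equiv> length (measures I)"

definition valid_input :: "bary_input \<Rightarrow> bool" where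
  "valid_input I \<longleftrightarrow>
    length (weights I) = num I \<and>
    (\<forall>i<num I. weights I ! i > 0) \<and>
    (\<Sum>i<num I. weights I ! i) = 1 \<and>
    (\<forall>i<num I. discrete_prob (space_dim I) (measures I ! i))"

definition phi :: "bary_input \<Rightarrow> (nat \<Rightarrow> real) measure \<Rightarrow> real" where
  "phi I P = (\<Sum>i<num I. real_of_rat (weights I ! i) *
    (W2 (space_dim I) P (law (space_dim I) (measures I ! i)))\<^sup>2)"

definition barycenter :: "bary_input \<Rightarrow> (nat \<Rightarrow> real) measure \<Rightarrow> bool" where
  "barycenter I P \<longleftrightarrow> P \<in> P2 (space_dim I) \<and> (\<forall>Q\<in>P2 (space_dim I). phi I P \<le> phi I Q)"

definition transport :: "bary_input \<Rightarrow> dmeasure \<Rightarrow> (nat \<Rightarrow> nat \<Rightarrow> nat \<Rightarrow> real) \<Rightarrow> bool" where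
  "transport I P0 y \<longleftrightarrow>
    (\<forall>i<num I. \<forall>j<length P0. \<forall>k<length (measures I ! i). y i j k \<ge> 0) \<and>
    (\<forall>i<num I. \<forall>j<length P0.
      (\<Sum>k<length (measures I ! i). y i j k) = real_of_rat (mass P0 j)) \<and>
    (\<forall>i<num I. \<forall>k<length (measures I ! i).
      (\<Sum>j<length P0. y i j k) = real_of_rat (mass (measures I ! i) k))"

definition transport_cost ::
  "bary_input \<Rightarrow> dmeasure \<Rightarrow> (nat \<Rightarrow> nat \<Rightarrow> nat \<Rightarrow> real) \<Rightarrow> real" where
  "transport_cost I P0 y =
    (\<Sum>i<num I. real_of_rat (weights I ! i) *
      (\<Sum>j<length P0. \<Sum>k<length (measures I ! i).
        (edist (space_dim I) (pt (space_dim I) (supp_pt P0 j))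
          (pt (space_dim I) (supp_pt (measures I ! i) k)))\<^sup>2 * y i j k))"

definition non_mass_splitting ::
  "bary_input \<Rightarrow> dmeasure \<Rightarrow> (nat \<Rightarrow> nat \<Rightarrow> nat \<Rightarrow> real) \<Rightarrow> bool" where
  "non_mass_splitting I P0 y \<longleftrightarrow>
    (\<forall>j<length P0. \<forall>i<num I.
      \<exists>!k. k < length (measures I ! i) \<and> y i j k = real_of_rat (mass P0 j) \<and>
        (\<forall>k'<length (measures I ! i). k' \<noteq> k \<longrightarrow> y i j k' = 0))"


section \<open>Strongly polynomial time\<close>

text \<open>
  The machine model is the arithmetic RAM, presented as a while language.  A state consists of
  arrays of natural numbers (sizes, counters and addresses) and arrays of rational numbers
  (numerical data).  Rationals can only be combined by field operations and compared; there is no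
  rounding and no other conversion from rationals to naturals, so the bits of a rational are not
  accessible by indexing.  Each operation, comparison, constant, memory access and assignment
  takes unit time.
\<close>

record state =
  nats :: "nat \<Rightarrow> nat \<Rightarrow> nat"
  rats :: "nat \<Rightarrow> nat \<Rightarrow> rat"

datatype nexp =
    NConst nat
  | NGet nat nexp
  | NAdd nexp nexp
  | NSub nexp nexp
  | NMul nexp nexp

datatype rexp =
    RConst rat
  | RGet nat nexp
  | RAdd rexp rexp
  | RSub rexp rexp
  | RMul rexp rexp
  | RDiv rexp rexp

datatype bexp =
    NLess nexp nexp
  | RLess rexp rexp
  | BNot bexp
  | BAnd bexp bexp

datatype com =
    Skip
  | NSet nat nexp nexp
  | RSet nat nexp rexp
  | Seq com com
  | Cond bexp com com
  | While bexp com

primrec nval :: "state \<Rightarrow> nexp \<Rightarrow> nat" where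
  "nval s (NConst n) = n"
| "nval s (NGet a e) = nats s a (nval s e)"
| "nval s (NAdd e f) = nval s e + nval s f"
| "nval s (NSub e f) = nval s e - nval s f"
| "nval s (NMul e f) = nval s e * nval s f"

primrec ncost :: "nexp \<Rightarrow> nat" where
  "ncost (NConst n) = 1"
| "ncost (NGet a e) = ncost e + 1"
| "ncost (NAdd e f) = ncost e + ncost f + 1"
| "ncost (NSub e f) = ncost e + ncost f + 1"
| "ncost (NMul e f) = ncost e + ncost f + 1"

primrec rval :: "state \<Rightarrow> rexp \<Rightarrow> rat" where
  "rval s (RConst q) = q"
| "rval s (RGet a e) = rats s a (nval s e)"
| "rval s (RAdd e f) = rval s e + rval s f"
| "rval s (RSub e f) = rval s e - rval s f"
| "rval s (RMul e f) = rval s e * rval s f"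
| "rval s (RDiv e f) = rval s e / rval s f"

primrec rcost :: "rexp \<Rightarrow> nat" where
  "rcost (RConst q) = 1"
| "rcost (RGet a e) = ncost e + 1"
| "rcost (RAdd e f) = rcost e + rcost f + 1"
| "rcost (RSub e f) = rcost e + rcost f + 1"
| "rcost (RMul e f) = rcost e + rcost f + 1"
| "rcost (RDiv e f) = rcost e + rcost f + 1"

primrec bval :: "state \<Rightarrow> bexp \<Rightarrow> bool" where
  "bval s (NLess e f) = (nval s e < nval s f)"
| "bval s (RLess e f) = (rval s e < rval s f)"
| "bval s (BNot b) = (\<not> bval s b)"
| "bval s (BAnd b c) = (bval s b \<and> bval s c)"

primrec bcost :: "bexp \<Rightarrow> nat" where
  "bcost (NLess e f) = ncost e + ncost f + 1"
| "bcost (RLess e f) = rcost e + rcost f + 1"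
| "bcost (BNot b) = bcost b + 1"
| "bcost (BAnd b c) = bcost b + bcost c + 1"

definition nset :: "state \<Rightarrow> nat \<Rightarrow> nat \<Rightarrow> nat \<Rightarrow> state" where
  "nset s a i v = s\<lparr>nats := (nats s)(a := (nats s a)(i := v))\<rparr>"

definition rset :: "state \<Rightarrow> nat \<Rightarrow> nat \<Rightarrow> rat \<Rightarrow> state" where
  "rset s a i v = s\<lparr>rats := (rats s)(a := (rats s a)(i := v))\<rparr>"

text \<open>\<open>exec c s t s'\<close>: program \<open>c\<close>, started in \<open>s\<close>, halts in \<open>s'\<close> after \<open>t\<close> unit-time steps.\<close>

inductive exec :: "com \<Rightarrow> state \<Rightarrow> nat \<Rightarrow> state \<Rightarrow> bool" where
  Skip: "exec Skip s 1 s"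
| NSet: "exec (NSet a i e) s (ncost i + ncost e + 1) (nset s a (nval s i) (nval s e))"
| RSet: "exec (RSet a i e) s (ncost i + rcost e + 1) (rset s a (nval s i) (rval s e))"
| Seq: "exec c1 s t1 s' \<Longrightarrow> exec c2 s' t2 s'' \<Longrightarrow> exec (Seq c1 c2) s (t1 + t2) s''"
| CondTrue: "bval s b \<Longrightarrow> exec c1 s t s' \<Longrightarrow> exec (Cond b c1 c2) s (bcost b + t) s'"
| CondFalse: "\<not> bval s b \<Longrightarrow> exec c2 s t s' \<Longrightarrow> exec (Cond b c1 c2) s (bcost b + t) s'"
| WhileFalse: "\<not> bval s b \<Longrightarrow> exec (While b c) s (bcost b) s"
| WhileTrue: "bval s b \<Longrightarrow> exec c s t1 s' \<Longrightarrow> exec (While b c) s' t2 s''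
    \<Longrightarrow> exec (While b c) s (bcost b + t1 + t2) s''"

text \<open>
  Input and output are a list of naturals and a list of rationals, stored in the arrays number 0.
  Cells not occupied by the input are 0.
\<close>

type_synonym data = "nat list \<times> rat list"

definition init_state :: "data \<Rightarrow> state" where
  "init_state x = \<lparr>
    nats = (\<lambda>a i. if a = 0 \<and> i < length (fst x) then fst x ! i else 0),
    rats = (\<lambda>a i. if a = 0 \<and> i < length (snd x) then snd x ! i else 0)\<rparr>"

definition holds_output :: "state \<Rightarrow> data \<Rightarrow> bool" where
  "holds_output s x \<longleftrightarrow>
    (\<forall>i<length (fst x). nats s 0 i = fst x ! i) \<and>
    (\<forall>i<length (snd x). rats s 0 i = snd x ! i)"

definition entries :: "data \<Rightarrow> nat" where
  "entries x = length (fst x) + length (snd x)"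

text \<open>
  One program must serve all valid inputs, and its running time is bounded in terms of the number
  of input entries only, irrespective of their values.
\<close>

definition strongly_poly_computable ::
  "('a \<Rightarrow> bool) \<Rightarrow> ('a \<Rightarrow> data) \<Rightarrow> ('b \<Rightarrow> data) \<Rightarrow> ('a \<Rightarrow> 'b \<Rightarrow> bool) \<Rightarrow> bool" where
  "strongly_poly_computable valid enc_in enc_out R \<longleftrightarrow>
    (\<exists>(c :: com) (p :: nat poly). \<forall>x. valid x \<longrightarrow>
      (\<exists>t s y. exec c (init_state (enc_in x)) t s \<and>
        t \<le> poly p (entries (enc_in x)) \<and>
        holds_output s (enc_out y) \<and> R x y))"

definition flat :: "dmeasure \<Rightarrow> rat list" where
  "flat P = concat (map (\<lambda>(x, m). x @ [m]) P)"

text \<open>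
  The number of support points and the dimension determine how the flat lists of rationals are to
  be cut into points and masses.
\<close>

definition encode_input :: "bary_input \<Rightarrow> data" where
  "encode_input I =
    (num I # space_dim I # map length (measures I), weights I @ concat (map flat (measures I)))"

definition encode_dmeasure :: "dmeasure \<Rightarrow> data" where
  "encode_dmeasure P = ([length P], flat P)"

end

(*
  Let the random variables X_1, ..., X_N, Z be coupled such that each (Z, X_i) is an optimal coupling of
  the barycenter and P_i, and let M be the weighted mean of the X_i.  Then
    sum_i lambda_i phi(P_i) <= sum_{i,j} lambda_i lambda_j E|X_i - X_j|^2
      = 2 sum_i lambda_i E|X_i - M|^2 <= 2 sum_i lambda_i E|X_i - Z|^2,
  so the best one of the measures P_i is a 2-approximation.  It is found by solving all pairwise
  transportation problems with minimum mean cycle cancelling (Goldberg and Tarjan), which is strongly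
  polynomial.  Gluing the optimal transports from the best P_i to all P_j splits the mass of P_i into tuples
  of points of P_1, ..., P_N.  Moving the mass of each tuple from its base point towards the mean of
  the tuple does not increase the cost, and the transport from the new measure does not split mass provided that
  the new points are distinct.  For small movements this only requires distinct means of any two tuples with
  the same base point, which holds if the tuples are formed monotonically with respect to the
  lexicographic order.  A barycenter exists since the problem reduces to a finite linear program: any
  couplings of Q with P_1, ..., P_N have densities with respect to Q, whose products are glued to a coupling
  of P_1, ..., P_N.
*)
theory Submission
  imports Defs
begin

section \<open>Programs with bounded loops\<close>

text \<open>Running times may depend on sizes only, so every loop makes a number of rounds that is
  fixed by the sizes: the number of cancelling steps is prescribed, and steps after optimality are
  idle. That the prescribed number suffices has nothing to do with the magnitude of the costs; it
  comes from entries of the plan that are forced to be 0 for good as soon as the plan is close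
  enough to optimal. The tuples remain few because each of them exhausts the remaining mass of some
  point. They have to receive distinct points, since a discrete measure lists a point once, and two
  tuples at one point would split its mass. This is why points are moved at all: with every tuple
  left at its base point the cost bound holds already. A full move to the mean could let tuples over
  different base points collide, so the step must be small, and its length has to be found by
  rational arithmetic without square roots.\<close>

datatype prog =
    PSkip
  | PNSet nat nexp nexp
  | PRSet nat nexp rexp
  | PSeq prog prog (infixr ";;" 60)
  | PIf bexp prog prog
  | PFor nat nexp prog

abbreviation nvar :: "nat \<Rightarrow> nexp" where
  "nvar v \<equiv> NGet v (NConst 0)"

primrec compile :: "prog \<Rightarrow> com" where
  "compile PSkip = Skip"
| "compile (PNSet a i e) = NSet a i e"
| "compile (PRSet a i e) = RSet a i e"
| "compile (p ;; q) = Seq (compile p) (compile q)"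
| "compile (PIf b p q) = Cond b (compile p) (compile q)"
| "compile (PFor v e p) = Seq (NSet v (NConst 0) (NConst 0))
    (While (NLess (nvar v) e) (Seq (compile p) (NSet v (NConst 0) (NAdd (nvar v) (NConst 1)))))"

text \<open>The bound is evaluated once and the counter is set afresh in every round, whereas the
  compiled loop re-evaluates the bound and increments the counter. The conditions of
  \<open>wf_prog\<close> on loops make the two agree.\<close>

primrec ev :: "prog \<Rightarrow> state \<Rightarrow> state" where
  "ev PSkip s = s"
| "ev (PNSet a i e) s = nset s a (nval s i) (nval s e)"
| "ev (PRSet a i e) s = rset s a (nval s i) (rval s e)"
| "ev (p ;; q) s = ev q (ev p s)"
| "ev (PIf b p q) s = (if bval s b then ev p s else ev q s)"
| "ev (PFor v e p) s =
    nset (fold (\<lambda>k s. ev p (nset s v 0 k)) [0..<nval s e] s) v 0 (nval s e)"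

primrec nwrites :: "prog \<Rightarrow> nat set" where
  "nwrites PSkip = {}"
| "nwrites (PNSet a i e) = {a}"
| "nwrites (PRSet a i e) = {}"
| "nwrites (p ;; q) = nwrites p \<union> nwrites q"
| "nwrites (PIf b p q) = nwrites p \<union> nwrites q"
| "nwrites (PFor v e p) = insert v (nwrites p)"

primrec rwrites :: "prog \<Rightarrow> nat set" where
  "rwrites PSkip = {}"
| "rwrites (PNSet a i e) = {}"
| "rwrites (PRSet a i e) = {a}"
| "rwrites (p ;; q) = rwrites p \<union> rwrites q"
| "rwrites (PIf b p q) = rwrites p \<union> rwrites q"
| "rwrites (PFor v e p) = rwrites p"

primrec nreads :: "nexp \<Rightarrow> nat set" where
  "nreads (NConst n) = {}"
| "nreads (NGet a e) = insert a (nreads e)"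
| "nreads (NAdd e f) = nreads e \<union> nreads f"
| "nreads (NSub e f) = nreads e \<union> nreads f"
| "nreads (NMul e f) = nreads e \<union> nreads f"

text \<open>Loop bounds are polynomials in cells of the read-only array 0, whose addresses may be
  computed.  \<open>bound_poly\<close> bounds them in terms of the largest entry of that array.\<close>

primrec bound_exp :: "nexp \<Rightarrow> bool" where
  "bound_exp (NConst n) = True"
| "bound_exp (NGet a e) = (a = 0)"
| "bound_exp (NAdd e f) = (bound_exp e \<and> bound_exp f)"
| "bound_exp (NSub e f) = bound_exp e"
| "bound_exp (NMul e f) = (bound_exp e \<and> bound_exp f)"

primrec bound_poly :: "nexp \<Rightarrow> nat poly" where
  "bound_poly (NConst n) = [:n:]"
| "bound_poly (NGet a e) = [:0, 1:]"
| "bound_poly (NAdd e f) = bound_poly e + bound_poly f"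
| "bound_poly (NSub e f) = bound_poly e"
| "bound_poly (NMul e f) = bound_poly e * bound_poly f"

primrec wf_prog :: "prog \<Rightarrow> bool" where
  "wf_prog PSkip = True"
| "wf_prog (PNSet a i e) = (a \<noteq> 0)"
| "wf_prog (PRSet a i e) = True"
| "wf_prog (p ;; q) = (wf_prog p \<and> wf_prog q)"
| "wf_prog (PIf b p q) = (wf_prog p \<and> wf_prog q)"
| "wf_prog (PFor v e p) = (wf_prog p \<and> bound_exp e \<and> v \<noteq> 0 \<and>
    insert v (nreads e) \<inter> nwrites p = {} \<and> v \<notin> nreads e)"

text \<open>A round of the compiled loop costs \<open>ncost e + 3\<close> for the test, 6 for the
  increment and the time of the body; the remaining \<open>ncost e + 6\<close> are the
  initialisation of the counter and the last test. For a conditional the sum of both branches stands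
  for their maximum, which need not be a polynomial.\<close>

primrec time_poly :: "prog \<Rightarrow> nat poly" where
  "time_poly PSkip = [:1:]"
| "time_poly (PNSet a i e) = [:ncost i + ncost e + 1:]"
| "time_poly (PRSet a i e) = [:ncost i + rcost e + 1:]"
| "time_poly (p ;; q) = time_poly p + time_poly q"
| "time_poly (PIf b p q) = [:bcost b:] + time_poly p + time_poly q"
| "time_poly (PFor v e p) =
    bound_poly e * ([:ncost e + 9:] + time_poly p) + [:ncost e + 6:]"

section \<open>Correctness and running time of compiled programs\<close>

lemma nats_nset [simp]:
  "nats (nset s a i v) b = (if b = a then (nats s a)(i := v) else nats s b)"
  and rats_nset [simp]: "rats (nset s a i v) = rats s"
  and nats_rset [simp]: "nats (rset s a i q) = nats s"
  and rats_rset [simp]: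
    "rats (rset s a i q) b = (if b = a then (rats s a)(i := q) else rats s b)"
  by (simp_all add: nset_def rset_def)

lemma nset_same: "nats s a i = v \<Longrightarrow> nset s a i v = s"
  by (auto simp: nset_def)

lemma nats_ev: "a \<notin> nwrites p \<Longrightarrow> nats (ev p s) a = nats s a"
proof (induction p arbitrary: s)
  case (PFor v e p)
  have "nats (fold (\<lambda>k s. ev p (nset s v 0 k)) ks s) a = nats s a" for ks s
    using PFor by (induction ks arbitrary: s) auto
  then show ?case using PFor.prems by simp
qed auto

lemma rats_ev: "a \<notin> rwrites p \<Longrightarrow> rats (ev p s) a = rats s a"
proof (induction p arbitrary: s)
  case (PFor v e p)
  have "rats (fold (\<lambda>k s. ev p (nset s v 0 k)) ks s) a = rats s a" for ks s
    using PFor by (induction ks arbitrary: s) auto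
  then show ?case by simp
qed auto

lemma nval_cong:
  "(\<And>a. a \<in> nreads e \<Longrightarrow> nats s a = nats s' a) \<Longrightarrow> nval s e = nval s' e"
  by (induction e) auto

lemma wf_prog_nwrites: "wf_prog p \<Longrightarrow> 0 \<notin> nwrites p"
  by (induction p) auto

lemma nval_bound:
  assumes "bound_exp e" and "\<And>i. nats s 0 i \<le> B"
  shows "nval s e \<le> poly (bound_poly e) B"
  using assms(1)
  by (induction e) (auto intro: assms(2) add_mono mult_mono order_trans[OF diff_le_self])

lemma ev_for_rule:
  assumes "I 0 s"
    and "\<And>k s'. k < nval s e \<Longrightarrow> I k s' \<Longrightarrow> I (Suc k) (ev p (nset s' v 0 k))"
    and "\<And>s'. I (nval s e) s' \<Longrightarrow> Q (nset s' v 0 (nval s e))"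
  shows "Q (ev (PFor v e p) s)"
proof -
  have "n \<le> nval s e \<Longrightarrow> I n (fold (\<lambda>k s. ev p (nset s v 0 k)) [0..<n] s)" for n
    by (induction n) (auto intro: assms)
  then show ?thesis using assms(3) by simp
qed

text \<open>Well-formed programs never write the array of naturals 0, so its bound \<open>B\<close>
  persists throughout the run and every loop bound met on the way is at most its
  \<open>bound_poly\<close> at \<open>B\<close>.\<close>

lemma exec_compile:
  assumes "wf_prog p" and "\<And>i. nats s 0 i \<le> B"
  shows "\<exists>t. exec (compile p) s t (ev p s) \<and> t \<le> poly (time_poly p) B"
  using assms
proof (induction p arbitrary: s)
  case PSkip
  then show ?case by (auto intro: exec.Skip)
next
  case (PNSet a i e)
  then show ?case using exec.NSet[of a i e s] by auto
next
  case (PRSet a i e)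
  then show ?case using exec.RSet[of a i e s] by auto
next
  case (PSeq p q)
  obtain t1 where t1: "exec (compile p) s t1 (ev p s)" "t1 \<le> poly (time_poly p) B"
    using PSeq.IH(1)[of s] PSeq.prems by auto
  have "nats (ev p s) 0 i \<le> B" for i
    using PSeq.prems wf_prog_nwrites[of p] nats_ev[of 0 p s] by auto
  then obtain t2 where t2: "exec (compile q) (ev p s) t2 (ev q (ev p s))"
      "t2 \<le> poly (time_poly q) B"
    using PSeq.IH(2)[of "ev p s"] PSeq.prems by auto
  then show ?case using exec.Seq[OF t1(1) t2(1)] t1 by auto
next
  case (PIf b p q)
  show ?case
  proof (cases "bval s b")
    case True
    then obtain t where "exec (compile p) s t (ev p s)" "t \<le> poly (time_poly p) B"
      using PIf.IH(1)[of s] PIf.prems by auto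
    then show ?thesis using exec.CondTrue[OF True] True by fastforce
  next
    case False
    then obtain t where "exec (compile q) s t (ev q s)" "t \<le> poly (time_poly q) B"
      using PIf.IH(2)[of s] PIf.prems by auto
    then show ?thesis using exec.CondFalse[OF False] False by fastforce
  qed
next
  case (PFor v e p)
  define n where "n = nval s e"
  define f where "f = (\<lambda>k s. ev p (nset s v 0 k))"
  let ?b = "NLess (nvar v) e"
  let ?c = "Seq (compile p) (NSet v (NConst 0) (NAdd (nvar v) (NConst 1)))"
  let ?K = "ncost e + 9 + poly (time_poly p) B"
  have inv: "nats (f k s') a = nats s' a" if "a \<notin> insert v (nwrites p)" for k s' a
    using that nats_ev[of a p "nset s' v 0 k"] by (simp add: f_def)
  have inv_v: "nats (ev p s') v = nats s' v" for s'
    using PFor.prems nats_ev[of v p] by simp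
  have ne: "nval s' e = n" if "\<And>a. a \<in> nreads e \<Longrightarrow> nats s' a = nats s a" for s'
    unfolding n_def by (rule nval_cong) (use that in auto)
  have loop: "\<exists>t. exec (While ?b ?c) s' t (nset (fold f [k..<n] s') v 0 n) \<and>
      t \<le> (n - k) * ?K + ncost e + 3"
    if "k \<le> n" "nats s' v 0 = k" "\<And>a. a \<in> insert 0 (nreads e) \<Longrightarrow> nats s' a = nats s a"
    for k s'
    using that
  proof (induction "n - k" arbitrary: k s')
    case 0
    then have "k = n" by simp
    then have "\<not> bval s' ?b" using 0 ne[of s'] by simp
    then have "exec (While ?b ?c) s' (bcost ?b) s'" by (rule exec.WhileFalse)
    then show ?case using \<open>k = n\<close> 0 nset_same[of s' v 0 n] by (intro exI[of _ "bcost ?b"]) simp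
  next
    case (Suc j)
    then have "k < n" by simp
    have b: "bval s' ?b" using Suc.prems ne[of s'] \<open>k < n\<close> by simp
    have "nats s' 0 i \<le> B" for i using Suc.prems PFor.prems by simp
    then obtain t where t: "exec (compile p) s' t (ev p s')" "t \<le> poly (time_poly p) B"
      using PFor.IH[of s'] PFor.prems by auto
    have same: "ev p s' = f k s'" unfolding f_def by (simp only: nset_same[OF Suc.prems(2)])
    let ?s2 = "nset (ev p s') v 0 (Suc k)"
    have "exec (NSet v (NConst 0) (NAdd (nvar v) (NConst 1))) (ev p s') 6 ?s2"
      using exec.NSet[of v "NConst 0" "NAdd (nvar v) (NConst 1)" "ev p s'"]
      by (simp add: inv_v Suc.prems eval_nat_numeral)
    from exec.Seq[OF t(1) this] have e1: "exec ?c s' (t + 6) ?s2" .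
    have "\<exists>t. exec (While ?b ?c) ?s2 t (nset (fold f [Suc k..<n] ?s2) v 0 n) \<and>
      t \<le> (n - Suc k) * ?K + ncost e + 3"
    proof (rule Suc.hyps(1))
      show "j = n - Suc k" "Suc k \<le> n" using Suc by auto
      fix a assume a: "a \<in> insert 0 (nreads e)"
      then have "a \<notin> insert v (nwrites p)"
        using PFor.prems wf_prog_nwrites[of p] by auto
      then show "nats ?s2 a = nats s a" using inv[of a k s'] same Suc.prems(3)[OF a] by auto
    qed simp
    then obtain t2 where t2: "exec (While ?b ?c) ?s2 t2 (nset (fold f [Suc k..<n] ?s2) v 0 n)"
      "t2 \<le> (n - Suc k) * ?K + ncost e + 3" by blast
    \<comment> \<open>The compiled loop enters the next round with the counter already advanced, the
      fold with the old one. Each round of the fold overwrites the counter, and if no round is left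
      the final \<open>nset\<close> does.\<close>
    have fold_eq: "nset (fold f [Suc k..<n] ?s2) v 0 n = nset (fold f [k..<n] s') v 0 n"
    proof (cases "Suc k < n")
      case True
      have "f (Suc k) ?s2 = f (Suc k) (f k s')"
        unfolding f_def same[unfolded f_def] by (simp add: nset_def)
      then show ?thesis using True \<open>k < n\<close> by (simp add: upt_conv_Cons)
    next
      case False
      then have e: "[Suc k..<n] = []" "[k..<n] = [k]"
        using \<open>k < n\<close> by (auto simp: upt_conv_Cons)
      show ?thesis unfolding e using same by (simp add: nset_def)
    qed
    have "n - k = Suc (n - Suc k)" using \<open>k < n\<close> by simp
    then have "bcost ?b + (t + 6) + t2 \<le> (n - k) * ?K + ncost e + 3"
      using t2(2) t(2) by simp
    then show ?case
      using exec.WhileTrue[OF b e1 t2(1)] fold_eq by auto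
  qed
  let ?s0 = "nset s v 0 0"
  have "\<exists>t. exec (While ?b ?c) ?s0 t (nset (fold f [0..<n] ?s0) v 0 n) \<and>
      t \<le> (n - 0) * ?K + ncost e + 3"
    using PFor.prems by (intro loop) auto
  then obtain t where t: "exec (While ?b ?c) ?s0 t (nset (fold f [0..<n] ?s0) v 0 n)"
    "t \<le> n * ?K + ncost e + 3" by auto
  have fold_eq: "nset (fold f [0..<n] ?s0) v 0 n = nset (fold f [0..<n] s) v 0 n"
  proof (cases "n = 0")
    case True
    then show ?thesis by (simp add: nset_def)
  next
    case False
    have "f 0 ?s0 = f 0 s" unfolding f_def by (simp add: nset_def)
    then show ?thesis using False by (simp add: upt_conv_Cons)
  qed
  have "n \<le> poly (bound_poly e) B"
    unfolding n_def using PFor.prems by (intro nval_bound) auto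
  then have "n * ?K \<le> poly (bound_poly e) B * ?K" by (rule mult_right_mono) simp
  moreover have "exec (NSet v (NConst 0) (NConst 0)) s 3 ?s0"
    using exec.NSet[of v "NConst 0" "NConst 0" s] by (simp add: numeral_3_eq_3)
  from exec.Seq[OF this t(1)]
  have "exec (compile (PFor v e p)) s (3 + t) (ev (PFor v e p) s)"
    using fold_eq by (simp add: f_def n_def)
  moreover have "3 + t \<le> n * ?K + ncost e + 6" using t(2) by simp
  ultimately show ?case by (intro exI[of _ "3 + t"]) (auto intro: order_trans)
qed

section \<open>Cycle cancelling for the transportation problem\<close>

definition plan :: "nat \<Rightarrow> nat \<Rightarrow> (nat \<Rightarrow> 'a::linordered_field) \<Rightarrow> (nat \<Rightarrow> 'a) \<Rightarrow> (nat \<Rightarrow> nat \<Rightarrow> 'a) \<Rightarrow> bool"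
  where "plan n m a b y \<longleftrightarrow> (\<forall>k<n. \<forall>l<m. 0 \<le> y k l) \<and>
    (\<forall>k<n. (\<Sum>l<m. y k l) = a k) \<and> (\<forall>l<m. (\<Sum>k<n. y k l) = b l)"

text \<open>The potentials \<open>p\<close> live on the rows only; the best potential of a column is the least reduced
  cost in it, and complementary slackness is required up to \<open>e\<close>.\<close>

definition eps_opt :: "nat \<Rightarrow> nat \<Rightarrow> (nat \<Rightarrow> nat \<Rightarrow> 'a::linordered_field) \<Rightarrow> 'a \<Rightarrow> (nat \<Rightarrow> 'a)
    \<Rightarrow> (nat \<Rightarrow> nat \<Rightarrow> 'a) \<Rightarrow> bool"
  where "eps_opt n m c e p y \<longleftrightarrow>
    (\<forall>k<n. \<forall>k'<n. \<forall>l<m. 0 < y k' l \<longrightarrow> c k' l + p k' \<le> c k l + p k + e)"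

text \<open>The residual graph of the transportation problem is contracted to its rows: an arc from
  row \<open>u\<close> to row \<open>v\<close> through column \<open>l\<close> raises the entry at
  \<open>(u, l)\<close> and lowers the one at \<open>(v, l)\<close>. \<open>ks\<close> lists the
  rows of a closed walk, \<open>ls i\<close> is the column of its arc number
  \<open>i\<close>.\<close>

definition push :: "nat \<Rightarrow> (nat \<Rightarrow> nat) \<Rightarrow> (nat \<Rightarrow> nat) \<Rightarrow> 'a::linordered_field
    \<Rightarrow> (nat \<Rightarrow> nat \<Rightarrow> 'a) \<Rightarrow> nat \<Rightarrow> nat \<Rightarrow> 'a"
  where "push r ks ls \<delta> y k l = y k l + \<delta> * (\<Sum>i<r. (if ks i = k \<and> ls i = l then 1 else 0))
    - \<delta> * (\<Sum>i<r. (if ks (Suc i) = k \<and> ls i = l then 1 else 0))"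

text \<open>The mean weight of the cancelled cycle, taken per row, is \<open>- e\<close>, and the
  amount pushed is the smallest entry to be lowered. The rows are distinct, but several arcs may
  pass through the same column.\<close>

definition cancels :: "nat \<Rightarrow> nat \<Rightarrow> (nat \<Rightarrow> nat \<Rightarrow> 'a::linordered_field) \<Rightarrow> (nat \<Rightarrow> nat \<Rightarrow> 'a)
    \<Rightarrow> 'a \<Rightarrow> (nat \<Rightarrow> nat \<Rightarrow> 'a) \<Rightarrow> bool"
  where "cancels n m c y e y' \<longleftrightarrow> (\<exists>r ks ls. 0 < r \<and> r \<le> n \<and> (\<forall>i\<le>r. ks i < n) \<and> ks r = ks 0 \<and>
    inj_on ks {..<r} \<and> (\<forall>i<r. ls i < m \<and> 0 < y (ks (Suc i)) (ls i)) \<and>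
    (\<Sum>i<r. c (ks i) (ls i) - c (ks (Suc i)) (ls i)) = - (of_nat r * e) \<and>
    (\<forall>k l. y' k l = push r ks ls (Min ((\<lambda>i. y (ks (Suc i)) (ls i)) ` {..<r})) y k l))"

section \<open>Effect of cancelling one cycle\<close>

lemma sum_cyclic:
  assumes "ks r = ks 0"
  shows "(\<Sum>i<r. f (ks (Suc i))) = (\<Sum>i<r. f (ks i) :: 'a::ab_group_add)"
proof -
  have "(\<Sum>i<r. f (ks (Suc i))) + f (ks 0) = (\<Sum>i<Suc r. f (ks i))"
    by (subst sum.lessThan_Suc_shift) simp
  then show ?thesis using assms by simp
qed

lemma inj_on_cyclic:
  assumes "inj_on ks {..<r}" "ks r = ks (0::nat)"
  shows "inj_on (\<lambda>i. ks (Suc i)) {..<r}"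
proof (rule inj_onI)
  fix i j assume ij: "i \<in> {..<r}" "j \<in> {..<r}" "ks (Suc i) = ks (Suc j)"
  have eq: "x = z" if "ks x = ks z" "x < r" "z < r" for x z
    using assms(1) that by (auto simp: inj_on_def)
  show "i = j"
  proof (cases "Suc i = r \<or> Suc j = r")
    case True
    have "i = j" if "Suc i = r" "i < r" "j < r" "ks (Suc i) = ks (Suc j)" for i j
      using eq[of 0 "Suc j"] that assms(2) by (cases "Suc j = r") auto
    from this[of i j] this[of j i] show ?thesis using True ij by auto
  next
    case False
    then show ?thesis using ij eq[of "Suc i" "Suc j"] by auto
  qed
qed

locale cycle_step =
  fixes n m :: nat and c y y' :: "nat \<Rightarrow> nat \<Rightarrow> 'a::linordered_field" and e :: 'a
    and r :: nat and ks ls :: "nat \<Rightarrow> nat" and \<delta> :: 'a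
  assumes r: "0 < r" "r \<le> n" and ks: "\<And>i. i \<le> r \<Longrightarrow> ks i < n" and closed: "ks r = ks 0"
    and inj: "inj_on ks {..<r}" and ls: "\<And>i. i < r \<Longrightarrow> ls i < m"
    and pos: "\<And>i. i < r \<Longrightarrow> 0 < y (ks (Suc i)) (ls i)"
    and total: "(\<Sum>i<r. c (ks i) (ls i) - c (ks (Suc i)) (ls i)) = - (of_nat r * e)"
    and delta: "\<delta> = Min ((\<lambda>i. y (ks (Suc i)) (ls i)) ` {..<r})"
    and y': "\<And>k l. y' k l = push r ks ls \<delta> y k l"
begin

lemma delta_le: "i < r \<Longrightarrow> \<delta> \<le> y (ks (Suc i)) (ls i)"
  unfolding delta by (intro Min_le) auto

lemma delta_attained: "\<exists>i<r. \<delta> = y (ks (Suc i)) (ls i)"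
proof -
  have "\<delta> \<in> (\<lambda>i. y (ks (Suc i)) (ls i)) ` {..<r}"
    unfolding delta using r by (intro Min_in) auto
  then show ?thesis by auto
qed

lemma delta_pos: "0 < \<delta>"
  using delta_attained pos by auto

text \<open>The potentials telescope around the cycle, so reduced costs have the same total as
  costs.\<close>

lemma reduced_total:
  "(\<Sum>i<r. (c (ks i) (ls i) + p (ks i)) - (c (ks (Suc i)) (ls i) + p (ks (Suc i)))) = - (of_nat r * e)"
proof -
  have "(\<Sum>i<r. (c (ks i) (ls i) + p (ks i)) - (c (ks (Suc i)) (ls i) + p (ks (Suc i)))) =
    (\<Sum>i<r. (c (ks i) (ls i) - c (ks (Suc i)) (ls i)) + (p (ks i) - p (ks (Suc i))))"
    by (intro sum.cong) auto
  also have "\<dots> = - (of_nat r * e)"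
    unfolding sum.distrib total using sum_cyclic[OF closed, of p] by (simp add: sum_subtractf)
  finally show ?thesis .
qed

lemma reduced_ge:
  assumes "eps_opt n m c e' p y" "i < r"
  shows "- e' \<le> (c (ks i) (ls i) + p (ks i)) - (c (ks (Suc i)) (ls i) + p (ks (Suc i)))"
proof -
  have "c (ks (Suc i)) (ls i) + p (ks (Suc i)) \<le> c (ks i) (ls i) + p (ks i) + e'"
    using assms ks[of i] ks[of "Suc i"] ls[of i] pos[of i] unfolding eps_opt_def by auto
  then show ?thesis by (simp add: algebra_simps)
qed

lemma eps_le:
  assumes "eps_opt n m c e' p y"
  shows "e \<le> e'"
proof -
  have "(\<Sum>i<r. - e') \<le> - (of_nat r * e)"
    unfolding reduced_total[of p, symmetric] by (intro sum_mono reduced_ge[OF assms]) auto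
  then show ?thesis using r by simp
qed

text \<open>The rows of the cycle are distinct, so no entry is lowered twice; this is why the
  smallest entry to be lowered can be pushed without making any entry negative.\<close>

lemma dec_count: "(\<Sum>i<r. (if ks (Suc i) = k \<and> ls i = l then 1 else 0) :: 'a) \<in> {0, 1}"
proof (cases "\<exists>i<r. ks (Suc i) = k \<and> ls i = l")
  case True
  then obtain i where i: "i < r" "ks (Suc i) = k" "ls i = l" by blast
  have inj': "inj_on (\<lambda>i. ks (Suc i)) {..<r}" by (rule inj_on_cyclic[OF inj closed])
  have "(if ks (Suc j) = k \<and> ls j = l then 1 else 0) = (if j = i then 1 else 0 :: 'a)"
    if "j < r" for j
  proof (cases "j = i")
    case False
    then have "ks (Suc j) \<noteq> ks (Suc i)"
      using that i by (intro inj_on_contraD[OF inj']) auto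
    then show ?thesis using False i by simp
  qed (simp add: i)
  then have "(\<Sum>j<r. (if ks (Suc j) = k \<and> ls j = l then 1 else 0) :: 'a) = (\<Sum>j<r. if j = i then 1 else 0)"
    by (intro sum.cong) simp_all
  then show ?thesis using i by simp
qed (auto intro: sum.neutral)

lemma inc_nonneg: "0 \<le> (\<Sum>i<r. (if ks i = k \<and> ls i = l then 1 else 0) :: 'a)"
  by (intro sum_nonneg) auto

lemma y'_nonneg:
  assumes "0 \<le> y k l"
  shows "0 \<le> y' k l"
proof (cases "\<exists>i<r. ks (Suc i) = k \<and> ls i = l")
  case True
  then have "\<delta> \<le> y k l" using delta_le by auto
  then show ?thesis
    using dec_count[of k l] mult_nonneg_nonneg[OF less_imp_le[OF delta_pos] inc_nonneg[of k l]]
      delta_pos assms unfolding y' push_def by auto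
next
  case False
  then have "(\<Sum>i<r. (if ks (Suc i) = k \<and> ls i = l then 1 else 0) :: 'a) = 0" by (intro sum.neutral) auto
  then show ?thesis
    using mult_nonneg_nonneg[OF less_imp_le[OF delta_pos] inc_nonneg[of k l]] assms
    unfolding y' push_def by simp
qed

lemma y'_pos:
  assumes "0 < y' k l" "0 \<le> y k l"
  shows "0 < y k l \<or> (\<exists>i<r. ks i = k \<and> ls i = l)"
proof (rule ccontr)
  assume neg: "\<not> ?thesis"
  then have "y k l = 0" "(\<Sum>i<r. (if ks i = k \<and> ls i = l then 1 else 0) :: 'a) = 0"
    using assms by (auto intro: sum.neutral)
  then have "y' k l \<le> 0" unfolding y' push_def using dec_count[of k l] delta_pos by auto
  then show False using assms by simp
qed

text \<open>The entry that determines \<delta> becomes 0 unless the cycle also raises it, which the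
  hypothesis excludes.\<close>

lemma y'_zero:
  assumes "\<And>i j. i < r \<Longrightarrow> j < r \<Longrightarrow> \<not> (ks i = ks (Suc j) \<and> ls i = ls j)"
  shows "\<exists>i<r. y' (ks (Suc i)) (ls i) = 0"
proof -
  obtain i where i: "i < r" "\<delta> = y (ks (Suc i)) (ls i)" using delta_attained by blast
  have "(\<Sum>j<r. (if ks j = ks (Suc i) \<and> ls j = ls i then 1 else 0) :: 'a) = 0"
    using assms i by (intro sum.neutral) auto
  moreover have "(\<Sum>j<r. (if ks (Suc j) = ks (Suc i) \<and> ls j = ls i then 1 else 0) :: 'a) \<noteq> 0"
    using i by (subst sum_nonneg_eq_0_iff) auto
  then have "(\<Sum>j<r. (if ks (Suc j) = ks (Suc i) \<and> ls j = ls i then 1 else 0) :: 'a) = 1"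
    using dec_count[of "ks (Suc i)" "ls i"] by blast
  ultimately have "y' (ks (Suc i)) (ls i) = 0" unfolding y' push_def using i by simp
  then show ?thesis using i by blast
qed

text \<open>Row sums persist because the closed walk leaves each row as often as it enters it,
  column sums because every arc raises and lowers entries of the same column.\<close>

lemma y'_plan:
  assumes "plan n m a b y"
  shows "plan n m a b y'"
proof -
  have "(\<Sum>l<m. y' k l) = a k" if "k < n" for k
  proof -
    have *: "(\<Sum>l<m. \<Sum>i<r. (if f i = k \<and> ls i = l then 1 else 0) :: 'a) = (\<Sum>i<r. (if f i = k then 1 else 0))" for f
    proof -
      have "(\<Sum>l<m. (if f i = k \<and> ls i = l then 1 else 0) :: 'a) = (if f i = k then 1 else 0)" if "i < r" for i
        using ls[OF that] by (cases "f i = k") simp_all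
      then show ?thesis by (subst sum.swap) simp
    qed
    have "(\<Sum>l<m. y' k l) = a k + \<delta> * (\<Sum>i<r. (if ks i = k then 1 else 0)) - \<delta> * (\<Sum>i<r. (if ks (Suc i) = k then 1 else 0))"
      unfolding y' push_def sum.distrib sum_subtractf sum_distrib_left[symmetric]
        *[of ks] *[of "\<lambda>i. ks (Suc i)"] using assms that by (simp add: plan_def)
    then show ?thesis
      unfolding sum_cyclic[OF closed, of "\<lambda>x. (if x = k then 1 else 0) :: 'a"] by simp
  qed
  moreover have "(\<Sum>k<n. y' k l) = b l" if "l < m" for l
  proof -
    have *: "(\<Sum>k<n. \<Sum>i<r. (if f i = k \<and> ls i = l then 1 else 0) :: 'a) = (\<Sum>i<r. (if ls i = l then 1 else 0))"
      if "\<And>i. i < r \<Longrightarrow> f i < n" for f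
    proof -
      have "(\<Sum>k<n. (if f i = k \<and> ls i = l then 1 else 0) :: 'a) = (if ls i = l then 1 else 0)" if "i < r" for i
        using \<open>\<And>i. i < r \<Longrightarrow> f i < n\<close>[OF that] by (cases "ls i = l") simp_all
      then show ?thesis by (subst sum.swap) simp
    qed
    have 1: "(\<Sum>k<n. \<Sum>i<r. (if ks i = k \<and> ls i = l then 1 else 0) :: 'a) = (\<Sum>i<r. (if ls i = l then 1 else 0))"
      by (rule *) (simp add: ks)
    have 2: "(\<Sum>k<n. \<Sum>i<r. (if ks (Suc i) = k \<and> ls i = l then 1 else 0) :: 'a) = (\<Sum>i<r. (if ls i = l then 1 else 0))"
      by (rule *) (simp add: ks)
    show ?thesis
      unfolding y' push_def sum.distrib sum_subtractf sum_distrib_left[symmetric] 1 2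
      using assms that by (simp add: plan_def)
  qed
  ultimately show ?thesis using assms y'_nonneg unfolding plan_def by blast
qed

text \<open>The reduced costs along the cycle are at least \<open>- e\<close> and have mean
  \<open>- e\<close>, so all of them equal it.\<close>

lemma tight:
  assumes "eps_opt n m c e p y" "i < r"
  shows "c (ks (Suc i)) (ls i) + p (ks (Suc i)) = c (ks i) (ls i) + p (ks i) + e"
proof -
  let ?f = "\<lambda>i. (c (ks i) (ls i) + p (ks i)) - (c (ks (Suc i)) (ls i) + p (ks (Suc i))) + e"
  have "sum ?f {..<r} = 0" unfolding sum.distrib reduced_total by simp
  moreover have "0 \<le> ?f i" if "i \<in> {..<r}" for i
    using reduced_ge[OF assms(1), of i] that by (simp add: algebra_simps)
  ultimately have "?f i = 0"
    using assms(2) sum_nonneg_eq_0_iff[of "{..<r}" ?f] by auto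
  then show ?thesis by (simp add: algebra_simps)
qed

lemma y'_eps_optI:
  assumes "eps_opt n m c e' p y" "plan n m a b y"
    and "\<And>i k. i < r \<Longrightarrow> k < n \<Longrightarrow> c (ks i) (ls i) + p (ks i) \<le> c k (ls i) + p k + e'"
  shows "eps_opt n m c e' p y'"
  unfolding eps_opt_def
proof (intro allI impI)
  fix k k' l assume kl: "k < n" "k' < n" "l < m" "0 < y' k' l"
  from y'_pos[OF kl(4)] consider "0 < y k' l" | i where "i < r" "ks i = k'" "ls i = l"
    using assms(2) kl by (auto simp: plan_def)
  then show "c k' l + p k' \<le> c k l + p k + e'"
  proof cases
    case 1
    then show ?thesis using assms(1) kl by (auto simp: eps_opt_def)
  next
    case 2
    then show ?thesis using assms(3)[of i k] kl by auto
  qed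
qed

text \<open>Since the arcs of the cycle are tight, its increased entries have the least reduced cost in
  their column.\<close>

lemma y'_eps_opt:
  assumes "eps_opt n m c e p y" "0 \<le> e" "plan n m a b y"
  shows "eps_opt n m c e p y'"
proof (rule y'_eps_optI[OF assms(1,3)])
  fix i k assume ik: "i < r" "k < n"
  have "c (ks (Suc i)) (ls i) + p (ks (Suc i)) \<le> c k (ls i) + p k + e"
    using assms(1) ik ks[of "Suc i"] ls[of i] pos[of i] unfolding eps_opt_def by auto
  then show "c (ks i) (ls i) + p (ks i) \<le> c k (ls i) + p k + e"
    using tight[OF assms(1) ik(1)] assms(2) by (simp add: algebra_simps)
qed

end

lemma cancelsE:
  assumes "cancels n m c y e y'"
  obtains r ks ls \<delta> where "cycle_step n m c y y' e r ks ls \<delta>"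
  using assms unfolding cancels_def cycle_step_def by blast

text \<open>An entry of the plan whose reduced cost exceeds the minimum of its column by far is zero in
  every plan that is at least as close to optimal: otherwise the difference of the two plans
  would contain a cycle that is too expensive.\<close>

lemma eps_opt_fixed_zero:
  fixes y y' :: "nat \<Rightarrow> nat \<Rightarrow> 'a::linordered_field"
  assumes y: "plan n m a b y" "eps_opt n m c e p y"
    and y': "plan n m a b y'" "eps_opt n m c e' p' y'" "e' \<le> e" "0 \<le> e"
    and kl: "k < n" "k0 < n" "l < m" "c k0 l + p k0 + of_nat (2 * n^2 + 3) * e < c k l + p k"
  shows "y' k l = 0"
proof (rule ccontr)
  assume nz: "y' k l \<noteq> 0"
  have nonneg: "0 \<le> y x z" "0 \<le> y' x z" if "x < n" "z < m" for x z
    using y(1) y'(1) that by (auto simp: plan_def)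
  have "y k l = 0"
  proof (rule ccontr)
    assume "y k l \<noteq> 0"
    then have "c k l + p k \<le> c k0 l + p k0 + 1 * e"
      using y(2) kl nonneg[of k l] unfolding eps_opt_def by auto
    also have "\<dots> \<le> c k0 l + p k0 + of_nat (2 * n^2 + 3) * e"
      using \<open>0 \<le> e\<close> by (intro add_left_mono mult_right_mono) (auto simp: add_increasing)
    finally show False using kl by simp
  qed
  have gt: "y k l < y' k l" using nz \<open>y k l = 0\<close> nonneg(2)[of k l] kl by auto
  \<comment> \<open>An arc of \<open>H\<close> leads from a row that gains to a row that loses in
    the same column when \<open>y\<close> is replaced by \<open>y'\<close>. Slackness of both plans
    lets the difference \<open>q\<close> of the potentials drop by at most \<open>2 * e\<close>
    along it.\<close>
  define q where "q x = p' x - p x" for x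
  define H where "H = {(x, z). x < n \<and> z < n \<and> (\<exists>l<m. y x l < y' x l \<and> y' z l < y z l)}"
  have H_step: "q x \<le> q z + 2 * e" if xz: "(x, z) \<in> H" for x z
  proof -
    obtain l' where l': "l' < m" "y x l' < y' x l'" "y' z l' < y z l'" "x < n" "z < n"
      using xz by (auto simp: H_def)
    have "0 < y' x l'" "0 < y z l'" using l' nonneg[of x l'] nonneg[of z l'] by auto
    then have "c x l' + p' x \<le> c z l' + p' z + e'" "c z l' + p z \<le> c x l' + p x + e"
      using y(2) y'(2) l' unfolding eps_opt_def by auto
    then show ?thesis using \<open>e' \<le> e\<close> unfolding q_def by simp
  qed
  have col: "(\<Sum>x<n. y' x z - y x z) = 0" if "z < m" for z
    using y(1) y'(1) that by (simp add: plan_def sum_subtractf)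
  have row: "(\<Sum>z<m. y' x z - y x z) = 0" if "x < n" for x
    using y(1) y'(1) that by (simp add: plan_def sum_subtractf)
  have "\<exists>k2<n. y' k2 l < y k2 l"
  proof (rule ccontr)
    assume "\<not> ?thesis"
    then have "y x l \<le> y' x l" if "x < n" for x using that by (meson not_less)
    then have "0 < (\<Sum>x<n. y' x l - y x l)"
      using gt kl by (intro sum_pos2[of _ k]) auto
    then show False using col[OF kl(3)] by simp
  qed
  then obtain k2 where k2: "k2 < n" "y' k2 l < y k2 l" by blast
  \<comment> \<open>Otherwise let \<open>S\<close> be the rows reachable from \<open>k2\<close>. In
    every column their net change is at most 0, since a gain inside \<open>S\<close> brings all
    losing rows of that column into \<open>S\<close>; in column \<open>l\<close> it is negative. But
    the net change of each row is 0.\<close>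
  have reach: "(k2, k) \<in> H\<^sup>*"
  proof (rule ccontr)
    assume nr: "(k2, k) \<notin> H\<^sup>*"
    define S where "S = {x. x < n \<and> (k2, x) \<in> H\<^sup>*}"
    have S: "S \<subseteq> {..<n}" "finite S" by (auto simp: S_def)
    have SH: "z \<in> S" if "x \<in> S" "(x, z) \<in> H" for x z
      using that by (auto simp: S_def H_def intro: rtrancl_into_rtrancl)
    have case_split: "(\<exists>x\<in>S. y x z < y' x z) \<Longrightarrow> \<forall>x\<in>{..<n} - S. 0 \<le> y' x z - y x z" if "z < m" for z
      using SH S that by (fastforce simp: H_def not_less[symmetric])
    have split: "(\<Sum>x\<in>S. y' x z - y x z) = - (\<Sum>x\<in>{..<n} - S. y' x z - y x z)" if "z < m" for z
      using col[OF that] sum.subset_diff[OF S(1), of "\<lambda>x. y' x z - y x z"] by simp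
    have le: "(\<Sum>x\<in>S. y' x z - y x z) \<le> 0" if "z < m" for z
    proof (cases "\<exists>x\<in>S. y x z < y' x z")
      case True
      then have "0 \<le> (\<Sum>x\<in>{..<n} - S. y' x z - y x z)"
        using case_split[OF that] by (intro sum_nonneg) auto
      then show ?thesis using split[OF that] by simp
    next
      case False
      then show ?thesis by (intro sum_nonpos) (auto simp: not_less)
    qed
    have lt: "(\<Sum>x\<in>S. y' x l - y x l) < 0"
    proof (cases "\<exists>x\<in>S. y x l < y' x l")
      case True
      have "0 < (\<Sum>x\<in>{..<n} - S. y' x l - y x l)"
        using case_split[OF kl(3) True] gt kl nr by (intro sum_pos2[of _ k]) (auto simp: S_def)
      then show ?thesis using split[OF kl(3)] by simp
    next
      case False
      have "k2 \<in> S" using k2 by (simp add: S_def)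
      then have "(\<Sum>x\<in>S. y' x l - y x l) < (\<Sum>x\<in>S. 0)"
        using False k2 S by (intro sum_strict_mono_ex1) (auto simp: not_less)
      then show ?thesis by simp
    qed
    have "(\<Sum>z<m. \<Sum>x\<in>S. y' x z - y x z) < (\<Sum>z<m. 0)"
      using le lt kl by (intro sum_strict_mono_ex1) auto
    moreover have "(\<Sum>z<m. \<Sum>x\<in>S. y' x z - y x z) = 0"
      unfolding sum.swap[of _ S] by (rule sum.neutral) (use row S in blast)
    ultimately show False by simp
  qed
  have "H \<subseteq> {..<n} \<times> {..<n}" by (auto simp: H_def)
  then have fin: "finite H" and "card H \<le> card ({..<n} \<times> {..<n})"
    using finite_subset[of H] card_mono[of "{..<n} \<times> {..<n}" H] by blast+
  then have card: "card H \<le> n^2" by (simp add: power2_eq_square)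
  \<comment> \<open>Along a path with at most \<open>card H\<close> arcs \<open>q\<close> drops by
    at most \<open>2 * n^2 * e\<close>, and the two comparisons in column \<open>l\<close> below
    account for another \<open>2 * e\<close>; this is the origin of the factor
    \<open>2 * n^2 + 3\<close>.\<close>
  obtain j where j: "j \<le> card H" "(k2, k) \<in> H ^^ j"
    using reach rtrancl_finite_eq_relpow[OF fin] by auto
  have path: "(k2, x) \<in> H ^^ i \<Longrightarrow> q k2 \<le> q x + of_nat (2 * i) * e" for i x
  proof (induction i arbitrary: x)
    case (Suc i)
    then obtain z where "(k2, z) \<in> H ^^ i" "(z, x) \<in> H" by auto
    then have "q k2 \<le> q z + of_nat (2 * i) * e" "q z \<le> q x + 2 * e" using Suc H_step by auto
    then show ?case by (simp add: algebra_simps)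
  qed simp
  have "of_nat (2 * j) * e \<le> of_nat (2 * n^2) * e"
    using j card \<open>0 \<le> e\<close> by (intro mult_right_mono of_nat_mono) auto
  then have up: "q k2 \<le> q k + of_nat (2 * n^2) * e" using path[OF j(2)] by linarith
  have "0 < y k2 l" "0 < y' k l" using k2 gt nonneg[of k2 l] nonneg[of k l] kl by auto
  then have "c k2 l + p k2 \<le> c k0 l + p k0 + e" "c k l + p' k \<le> c k2 l + p' k2 + e'"
    using y(2) y'(2) kl k2 unfolding eps_opt_def by auto
  then have "q k - q k2 + of_nat (2 * n^2 + 3) * e < 2 * e"
    unfolding q_def using kl(4) \<open>e' \<le> e\<close> by linarith
  then show False using up \<open>0 \<le> e\<close> by (simp add: algebra_simps)
qed


section \<open>The sequence of cancelling steps\<close>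

definition cancel_step :: "nat \<Rightarrow> nat \<Rightarrow> (nat \<Rightarrow> nat \<Rightarrow> 'a::linordered_field) \<Rightarrow> (nat \<Rightarrow> nat \<Rightarrow> 'a)
    \<Rightarrow> 'a \<Rightarrow> (nat \<Rightarrow> nat \<Rightarrow> 'a) \<Rightarrow> bool"
  where "cancel_step n m c y e y' \<longleftrightarrow> 0 \<le> e \<and> (\<exists>p. eps_opt n m c e p y) \<and>
    (if e = 0 then y' = y else cancels n m c y e y')"

text \<open>In a \<open>cancel_step\<close>, \<open>- e\<close> is the minimum mean when
  \<open>e > 0\<close>: the cancelled cycle attains it, and \<open>eps_opt\<close> certifies that no
  cycle lies below. With \<open>e = 0\<close> the step is idle, as the program performs a prescribed
  number of steps.\<close>

lemma cancel_step_plan: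
  assumes "cancel_step n m c y e y'" "plan n m a b y"
  shows "plan n m a b y'"
proof (cases "e = 0")
  case False
  then have "cancels n m c y e y'" using assms(1) by (simp add: cancel_step_def)
  then obtain r ks ls \<delta> where "cycle_step n m c y y' e r ks ls \<delta>" by (rule cancelsE)
  then show ?thesis using assms(2) by (rule cycle_step.y'_plan)
qed (use assms in \<open>simp add: cancel_step_def\<close>)

text \<open>The old potentials still certify the new plan up to \<open>e\<close>, so the next cycle
  cannot have a mean below \<open>- e\<close>.\<close>

lemma cancel_step_antimono:
  assumes "cancel_step n m c y e y'" "cancel_step n m c y' e' y''" "plan n m a b y"
  shows "e' \<le> e"
proof -
  obtain p where p: "eps_opt n m c e p y" using assms(1) by (auto simp: cancel_step_def)
  have p': "eps_opt n m c e p y'"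
  proof (cases "e = 0")
    case False
    then have "cancels n m c y e y'" using assms(1) by (simp add: cancel_step_def)
    then obtain r ks ls \<delta> where "cycle_step n m c y y' e r ks ls \<delta>" by (rule cancelsE)
    then show ?thesis
      using cycle_step.y'_eps_opt p assms(1,3) by (auto simp: cancel_step_def)
  qed (use assms p in \<open>simp add: cancel_step_def\<close>)
  show ?thesis
  proof (cases "e' = 0")
    case False
    then have "cancels n m c y' e' y''" using assms(2) by (simp add: cancel_step_def)
    then obtain r ks ls \<delta> where "cycle_step n m c y' y'' e' r ks ls \<delta>" by (rule cancelsE)
    then show ?thesis using p' by (rule cycle_step.eps_le)
  qed (use assms in \<open>simp add: cancel_step_def\<close>)
qed

text \<open>Entries of reduced cost above the threshold \<open>q\<close> get lost one by one as long as every arc of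
  the cancelled cycles leads from below the threshold to above it; and any other cycle has a mean
  that is closer to 0.\<close>

lemma cancel_bad_decreases:
  fixes p :: "nat \<Rightarrow> 'a::linordered_field"
  assumes cyc: "cancels n m c y e' y'" and y: "eps_opt n m c e p y" "plan n m a b y"
    and e': "e * (1 - 1 / of_nat (2 * n)) < e'" and "0 < e" "0 < n"
  defines "v \<equiv> \<lambda>l. Min ((\<lambda>k. c k l + p k) ` {..<n})"
  defines "bad \<equiv> \<lambda>y. {(k, l). k < n \<and> l < m \<and> 0 < y k l \<and> v l + e / 2 < c k l + p k}"
  shows "eps_opt n m c e p y' \<and> card (bad y') < card (bad y)"
proof -
  obtain r ks ls \<delta> where "cycle_step n m c y y' e' r ks ls \<delta>" using cancelsE[OF cyc] .
  then interpret cycle_step n m c y y' e' r ks ls \<delta> .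
  have v_le: "v l \<le> c k l + p k" if "k < n" for k l
    unfolding v_def using that by (intro Min_le) auto
  have le_v: "c k' l + p k' \<le> v l + e" if "k' < n" "l < m" "0 < y k' l" for k' l
  proof -
    have "v l \<in> (\<lambda>k. c k l + p k) ` {..<n}" unfolding v_def using \<open>0 < n\<close> by (intro Min_in) auto
    then show ?thesis using y(1) that by (auto simp: eps_opt_def)
  qed
  \<comment> \<open>If some arc did not cross the middle of the band from \<open>v\<close> to
    \<open>v + e\<close>, its reduced cost would be at least \<open>- (e / 2)\<close>, while all
    others are at least \<open>- e\<close>. The mean would then be at least
    \<open>- e + e / (2 * r)\<close>, against the lower bound on \<open>e'\<close>.\<close>
  have strong: "c (ks i) (ls i) + p (ks i) < v (ls i) + e / 2 \<and>
    v (ls i) + e / 2 < c (ks (Suc i)) (ls i) + p (ks (Suc i))" if i: "i < r" for i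
  proof (rule ccontr)
    assume neg: "\<not> ?thesis"
    let ?f = "\<lambda>i. (c (ks i) (ls i) + p (ks i)) - (c (ks (Suc i)) (ls i) + p (ks (Suc i)))"
    have "v (ls i) \<le> c (ks i) (ls i) + p (ks i)"
      "c (ks (Suc i)) (ls i) + p (ks (Suc i)) \<le> v (ls i) + e"
      using v_le le_v ks[of i] ks[of "Suc i"] ls[of i] pos[of i] i by auto
    then have "- (e / 2) \<le> ?f i" using neg by (auto simp: not_less field_simps)
    moreover have "(\<Sum>j\<in>{..<r} - {i}. - e) \<le> (\<Sum>j\<in>{..<r} - {i}. ?f j)"
      using reduced_ge[OF y(1)] by (intro sum_mono) auto
    moreover have "sum ?f {..<r} = ?f i + (\<Sum>j\<in>{..<r} - {i}. ?f j)"
      using i by (intro sum.remove) auto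
    ultimately have "- (e / 2) - of_nat (r - 1) * e \<le> - (of_nat r * e')"
      unfolding reduced_total using i by (simp add: card_Diff_singleton)
    then have "of_nat r * e' \<le> of_nat r * e - e / 2"
      using r by (simp add: of_nat_diff algebra_simps)
    then have "e' \<le> e - e / (2 * of_nat r)" using r by (simp add: field_simps)
    also have "\<dots> \<le> e - e / (2 * of_nat n)"
      using r \<open>0 < e\<close> by (intro diff_left_mono divide_left_mono) auto
    finally show False using e' by (simp add: algebra_simps)
  qed
  have "eps_opt n m c e p y'"
  proof (rule y'_eps_optI[OF y])
    fix i k assume "i < r" "k < n"
    then show "c (ks i) (ls i) + p (ks i) \<le> c k (ls i) + p k + e"
      using strong[of i] v_le[of k "ls i"] \<open>0 < e\<close> by (auto simp: field_simps)
  qed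
  \<comment> \<open>By \<open>strong\<close> the cycle raises only entries below the threshold and
    lowers only entries above it. So no new bad entry arises, no entry is both raised and lowered,
    and the one that determines \<delta> ceases to be bad.\<close>
  moreover have "card (bad y') < card (bad y)"
  proof (rule psubset_card_mono)
    have "bad y \<subseteq> {..<n} \<times> {..<m}" by (auto simp: bad_def)
    then show "finite (bad y)" by (rule finite_subset) simp
    have "0 < y k l" if "0 < y' k l" "v l + e / 2 < c k l + p k" "k < n" "l < m" for k l
    proof (rule ccontr)
      assume "\<not> 0 < y k l"
      moreover have "0 \<le> y k l" using y(2) that by (simp add: plan_def)
      ultimately obtain i where "i < r" "ks i = k" "ls i = l"
        using y'_pos[of k l] \<open>0 < y' k l\<close> by blast
      then show False using strong[of i] that(2) by auto
    qed
    then have sub: "bad y' \<subseteq> bad y" by (auto simp: bad_def)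
    have "\<not> (ks i = ks (Suc j) \<and> ls i = ls j)" if "i < r" "j < r" for i j
      using strong[of i] strong[of j] that by auto
    from y'_zero[OF this] obtain i where i: "i < r" "y' (ks (Suc i)) (ls i) = 0" by blast
    have "(ks (Suc i), ls i) \<in> bad y - bad y'"
      using strong[of i] i ks[of "Suc i"] ls[of i] pos[of i] by (auto simp: bad_def)
    then show "bad y' \<subset> bad y" using sub by blast
  qed
  ultimately show ?thesis ..
qed

text \<open>A block of \<open>n * m + 1\<close> steps shrinks \<open>e\<close> by the factor
  \<open>1 - 1 / (2 * n)\<close>, and \<open>2 * n * (2 * n^2 + 3)\<close> blocks shrink it by more
  than the factor \<open>2 * n^2 + 3\<close> that \<open>eps_opt_fixed_zero\<close>
  requires.\<close>

definition phase_length :: "nat \<Rightarrow> nat \<Rightarrow> nat" where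
  "phase_length n m = 2 * n * (2 * n^2 + 3) * (n * m + 1)"

text \<open>A phase that starts with positive \<open>e\<close> fixes a further one of the
  \<open>n * m\<close> entries at 0, so \<open>n * m + 1\<close> such phases are one too
  many.\<close>

definition num_steps :: "nat \<Rightarrow> nat \<Rightarrow> nat" where
  "num_steps n m = (n * m + 1) * phase_length n m + 1"

locale cancel_sequence =
  fixes n m T :: nat and c :: "nat \<Rightarrow> nat \<Rightarrow> 'a::linordered_field" and a b :: "nat \<Rightarrow> 'a"
    and ys :: "nat \<Rightarrow> nat \<Rightarrow> nat \<Rightarrow> 'a" and es :: "nat \<Rightarrow> 'a"
  assumes n: "0 < n" and start: "plan n m a b (ys 0)"
    and steps: "\<And>t. t < T \<Longrightarrow> cancel_step n m c (ys t) (es t) (ys (Suc t))"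
begin

lemma plans: "t \<le> T \<Longrightarrow> plan n m a b (ys t)"
  by (induction t) (auto intro: start cancel_step_plan[OF steps])

lemma es_antimono: "t \<le> t' \<Longrightarrow> t' < T \<Longrightarrow> es t' \<le> es t"
proof (induction t' rule: dec_induct)
  case (step t')
  then have "es (Suc t') \<le> es t'"
    using cancel_step_antimono[OF steps steps plans] by auto
  then show ?case using step by auto
qed simp

lemma es_nonneg: "t < T \<Longrightarrow> 0 \<le> es t"
  using steps by (auto simp: cancel_step_def)

text \<open>If \<open>e\<close> stayed larger, each of the \<open>n * m + 1\<close> cancellations at
  the times \<open>t\<close> to \<open>t + n * m\<close> would remove a bad entry with respect to
  the potentials of time \<open>t\<close>; but there are at most \<open>n * m\<close>
  entries.\<close>

lemma es_decrease:
  assumes "t + n * m < T"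
  shows "es (t + n * m) \<le> es t * (1 - 1 / of_nat (2 * n))"
proof (rule ccontr)
  assume neg: "\<not> ?thesis"
  obtain p where p: "eps_opt n m c (es t) p (ys t)"
    using steps[of t] assms by (auto simp: cancel_step_def)
  have "0 \<le> 1 - 1 / (of_nat (2 * n) :: 'a)"
  proof -
    have "(1::'a) \<le> of_nat (2 * n)" using n of_nat_mono[of 1 "2 * n", where 'a = 'a] by simp
    then show ?thesis using divide_left_mono[of 1 "of_nat (2 * n) :: 'a" 1] n by simp
  qed
  then have "0 \<le> es t * (1 - 1 / of_nat (2 * n))"
    using es_nonneg[of t] assms by (intro mult_nonneg_nonneg) auto
  then have "0 < es (t + n * m)" using neg by auto
  then have pos: "0 < es (t + j)" if "j \<le> n * m" for j
    using es_antimono[of "t + j" "t + n * m"] that assms by auto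
  have large: "es t * (1 - 1 / of_nat (2 * n)) < es (t + j)" if "j \<le> n * m" for j
    using neg es_antimono[of "t + j" "t + n * m"] that assms by auto
  define v where "v l = Min ((\<lambda>k. c k l + p k) ` {..<n})" for l
  define bad where "bad y = {(k, l). k < n \<and> l < m \<and> 0 < y k l \<and> v l + es t / 2 < c k l + p k}"
    for y :: "nat \<Rightarrow> nat \<Rightarrow> 'a"
  have "eps_opt n m c (es t) p (ys (t + j)) \<and> card (bad (ys (t + j))) + j \<le> n * m"
    if "j \<le> n * m + 1" for j
    using that
  proof (induction j)
    case 0
    have "bad (ys t) \<subseteq> {..<n} \<times> {..<m}" by (auto simp: bad_def)
    then have "card (bad (ys t)) \<le> card ({..<n} \<times> {..<m})" by (intro card_mono) auto
    then show ?case using p by simp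
  next
    case (Suc j)
    have "cancels n m c (ys (t + j)) (es (t + j)) (ys (t + Suc j))"
      using steps[of "t + j"] pos[of j] Suc.prems assms by (auto simp: cancel_step_def)
    then have "eps_opt n m c (es t) p (ys (t + Suc j)) \<and>
        card (bad (ys (t + Suc j))) < card (bad (ys (t + j)))"
      unfolding bad_def v_def
      by (rule cancel_bad_decreases[where a = a and b = b]) (use Suc large[of j] pos[of 0] n plans assms in auto)
    then show ?case using Suc by auto
  qed
  from this[of "n * m + 1"] show False by simp
qed

text \<open>Instead of powers of \<open>1 - 1 / (2 * n)\<close> the proof uses the linear bound
  \<open>1 + h / (2 * n)\<close> on the gain after \<open>h\<close> blocks, in the manner of
  Bernoulli's inequality.\<close>

lemma es_phase:
  assumes "t + phase_length n m < T"
  shows "of_nat (2 * n^2 + 3) * es (t + phase_length n m) < es t \<or> es t = 0"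
proof -
  let ?N = "of_nat (2 * n) :: 'a" and ?M = "n * m + 1"
  have N: "0 < ?N" using n by simp
  have H: "es (t + h * ?M) * (1 + of_nat h / ?N) \<le> es t" if "t + h * ?M < T" for h
    using that
  proof (induction h)
    case (Suc h)
    let ?e = "es (t + h * ?M)"
    have lt: "t + h * ?M + n * m < T" using Suc.prems by simp
    have "es (t + Suc h * ?M) \<le> es (t + h * ?M + n * m)"
      using Suc.prems by (intro es_antimono) auto
    also have "\<dots> \<le> ?e * (1 - 1 / ?N)" by (rule es_decrease[OF lt])
    finally have "es (t + Suc h * ?M) * (1 + of_nat (Suc h) / ?N) \<le>
        ?e * (1 - 1 / ?N) * (1 + of_nat (Suc h) / ?N)"
      using N by (intro mult_right_mono) auto
    also have "\<dots> = ?e * (1 + of_nat h / ?N - of_nat (Suc h) / (?N * ?N))"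
      using N by (simp add: field_simps)
    also have "\<dots> \<le> ?e * (1 + of_nat h / ?N)"
      using es_nonneg[of "t + h * ?M"] lt by (intro mult_left_mono) auto
    also have "\<dots> \<le> es t" using Suc lt by simp
    finally show ?case .
  qed simp
  let ?h = "2 * n * (2 * n^2 + 3)"
  have "t + ?h * ?M < T" using assms by (simp add: phase_length_def)
  from H[OF this] have "es (t + phase_length n m) * (1 + of_nat (2 * n^2 + 3)) \<le> es t"
    using n by (simp add: phase_length_def)
  moreover have "0 \<le> es (t + phase_length n m)" using es_nonneg assms by simp
  moreover have "0 \<le> es t" using es_nonneg assms by simp
  ultimately show ?thesis
    by (cases "es (t + phase_length n m) = 0") (auto simp: algebra_simps)
qed

text \<open>Measured with the potentials \<open>p\<close> of one phase later, some arc of the cycle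
  cancelled at time \<open>t\<close> has reduced cost at most \<open>- es t\<close>. By then
  \<open>e\<close> is so small that the entry lowered through this arc is forced to be 0.\<close>

lemma new_zero:
  assumes "t + phase_length n m < T" "0 < es t"
  obtains k l where "k < n" "l < m" "0 < ys t k l"
    "\<And>t'. t + phase_length n m \<le> t' \<Longrightarrow> t' < T \<Longrightarrow> ys t' k l = 0"
proof -
  let ?t1 = "t + phase_length n m"
  have "cancels n m c (ys t) (es t) (ys (Suc t))"
    using steps[of t] assms by (auto simp: cancel_step_def)
  then obtain r ks ls \<delta> where "cycle_step n m c (ys t) (ys (Suc t)) (es t) r ks ls \<delta>"
    using cancelsE by blast
  then interpret cycle_step n m c "ys t" "ys (Suc t)" "es t" r ks ls \<delta> .
  obtain p where p: "eps_opt n m c (es ?t1) p (ys ?t1)"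
    using steps[of ?t1] assms by (auto simp: cancel_step_def)
  let ?f = "\<lambda>i. (c (ks i) (ls i) + p (ks i)) - (c (ks (Suc i)) (ls i) + p (ks (Suc i)))"
  have "\<exists>i<r. ?f i \<le> - es t"
  proof (rule ccontr)
    assume "\<not> ?thesis"
    then have "(\<Sum>i<r. - es t) < sum ?f {..<r}"
      using r by (intro sum_strict_mono) (auto simp: not_le)
    then show False unfolding reduced_total by simp
  qed
  then obtain i where i: "i < r" "?f i \<le> - es t" by blast
  have "of_nat (2 * n^2 + 3) * es ?t1 < es t" using es_phase[OF assms(1)] assms(2) by auto
  then have far: "c (ks i) (ls i) + p (ks i) + of_nat (2 * n^2 + 3) * es ?t1 <
      c (ks (Suc i)) (ls i) + p (ks (Suc i))"
    using i(2) by (auto simp: algebra_simps)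
  show ?thesis
  proof (rule that)
    show "ks (Suc i) < n" "ls i < m" "0 < ys t (ks (Suc i)) (ls i)" using i ks ls pos by auto
    fix t' assume t': "?t1 \<le> t'" "t' < T"
    obtain p' where "eps_opt n m c (es t') p' (ys t')"
      using steps[OF t'(2)] by (auto simp: cancel_step_def)
    then show "ys t' (ks (Suc i)) (ls i) = 0"
      using t' i ks[of i] ks[of "Suc i"] ls[of i] far
      by (intro eps_opt_fixed_zero[OF plans p plans _ es_antimono es_nonneg]) auto
  qed
qed

text \<open>\<open>Z t\<close> collects the entries that vanish from time \<open>t\<close> on. It
  grows in every phase that starts with positive \<open>e\<close>, so \<open>e\<close> reaches 0
  before the end; from then on the plan no longer changes.\<close>

lemma optimal_at_end:
  assumes "T = num_steps n m"
  shows "\<exists>p. eps_opt n m c 0 p (ys T)"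
proof -
  let ?P = "phase_length n m"
  have "\<exists>t<T. es t = 0"
  proof (rule ccontr)
    assume "\<not> ?thesis"
    then have pos: "0 < es t" if "t < T" for t using es_nonneg[OF that] that by (metis le_less)
    define Z where "Z t = {(k, l). k < n \<and> l < m \<and> (\<forall>t'. t \<le> t' \<longrightarrow> t' < T \<longrightarrow> ys t' k l = 0)}" for t
    have Z: "finite (Z t)" "card (Z t) \<le> n * m" for t
    proof -
      have "Z t \<subseteq> {..<n} \<times> {..<m}" by (auto simp: Z_def)
      then show "finite (Z t)" "card (Z t) \<le> n * m"
        by (auto intro: finite_subset dest: card_mono[rotated])
    qed
    have "j \<le> card (Z (j * ?P))" if "j \<le> n * m + 1" for j
      using that
    proof (induction j)
      case (Suc j)
      have "Suc j * ?P \<le> (n * m + 1) * ?P" using Suc.prems by (intro mult_right_mono) auto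
      then have lt: "j * ?P + ?P < T" unfolding assms num_steps_def mult_Suc by linarith
      then obtain k l where kl: "k < n" "l < m" "0 < ys (j * ?P) k l"
        "\<And>t'. j * ?P + ?P \<le> t' \<Longrightarrow> t' < T \<Longrightarrow> ys t' k l = 0"
        using new_zero[OF lt pos] by auto
      moreover have "j * ?P < T" using lt by simp
      ultimately have "(k, l) \<in> Z (Suc j * ?P)" "(k, l) \<notin> Z (j * ?P)"
        unfolding Z_def by (auto simp: add.commute)
      moreover have "Z (j * ?P) \<subseteq> Z (Suc j * ?P)" by (auto simp: Z_def)
      ultimately have "card (Z (j * ?P)) < card (Z (Suc j * ?P))"
        using Z by (intro psubset_card_mono) auto
      then show ?case using Suc by simp
    qed simp
    from this[of "n * m + 1"] Z(2)[of "(n * m + 1) * ?P"] show False by simp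
  qed
  then obtain t where t: "t < T" "es t = 0" by blast
  have const: "ys t' = ys t" if "t \<le> t'" "t' \<le> T" for t'
    using that
  proof (induction t' rule: dec_induct)
    case (step t')
    then have "es t' = 0" using es_antimono[of t t'] es_nonneg[of t'] t by auto
    then show ?case using steps[of t'] step by (auto simp: cancel_step_def)
  qed simp
  have "ys T = ys t" by (rule const) (use t(1) in simp_all)
  then show ?thesis using steps[OF t(1)] t(2) by (auto simp: cancel_step_def)
qed

end

text \<open>Weak duality: the column minima \<open>v\<close> and the negated row potentials are dual
  feasible, and slackness with \<open>e = 0\<close> means equality on the entries used by
  \<open>y\<close>.\<close>

lemma eps_opt_0_optimal:
  assumes "eps_opt n m c 0 p y" "plan n m a b y" "plan n m a b y'"
  shows "(\<Sum>k<n. \<Sum>l<m. c k l * y k l) \<le> (\<Sum>k<n. \<Sum>l<m. c k l * y' k l)"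
proof (cases "n = 0")
  case False
  define v where "v l = Min ((\<lambda>k. c k l + p k) ` {..<n})" for l
  have v_le: "v l \<le> c k l + p k" if "k < n" for k l
    unfolding v_def using that by (intro Min_le) auto
  have dual: "(\<Sum>k<n. \<Sum>l<m. v l * z k l - p k * z k l) = (\<Sum>l<m. v l * b l) - (\<Sum>k<n. p k * a k)"
    if "plan n m a b z" for z
  proof -
    have "(\<Sum>k<n. \<Sum>l<m. v l * z k l) = (\<Sum>l<m. v l * b l)"
      using that by (subst sum.swap) (simp add: plan_def sum_distrib_left[symmetric])
    moreover have "(\<Sum>k<n. \<Sum>l<m. p k * z k l) = (\<Sum>k<n. p k * a k)"
      using that by (simp add: plan_def sum_distrib_left[symmetric])
    ultimately show ?thesis by (simp add: sum_subtractf)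
  qed
  have "c k l * y k l = v l * y k l - p k * y k l" if "k < n" "l < m" for k l
  proof (cases "y k l = 0")
    case ne: False
    then have "0 < y k l" using assms(2) that by (auto simp: plan_def order.strict_iff_order)
    have "v l \<in> (\<lambda>k. c k l + p k) ` {..<n}" unfolding v_def using \<open>n \<noteq> 0\<close> by (intro Min_in) auto
    then have "c k l + p k \<le> v l" using assms(1) that \<open>0 < y k l\<close> by (auto simp: eps_opt_def)
    then have "c k l = v l - p k" using v_le[OF that(1), of l] by (simp add: eq_diff_eq)
    then show ?thesis by (simp only: left_diff_distrib)
  qed simp
  then have "(\<Sum>k<n. \<Sum>l<m. c k l * y k l) = (\<Sum>k<n. \<Sum>l<m. v l * y k l - p k * y k l)" by simp
  also have "\<dots> = (\<Sum>k<n. \<Sum>l<m. v l * y' k l - p k * y' k l)"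
    unfolding dual[OF assms(2)] dual[OF assms(3)] ..
  also have "\<dots> \<le> (\<Sum>k<n. \<Sum>l<m. c k l * y' k l)"
  proof (intro sum_mono)
    fix k l assume "k \<in> {..<n}" "l \<in> {..<m}"
    then have "(v l - p k) * y' k l \<le> c k l * y' k l"
      using v_le[of k l] assms(3) by (intro mult_right_mono) (auto simp: plan_def algebra_simps)
    then show "v l * y' k l - p k * y' k l \<le> c k l * y' k l" by (simp add: algebra_simps)
  qed
  finally show ?thesis .
qed simp


section \<open>Closed walks of minimum mean in the graph of rows\<close>

lemma sum_cut:
  assumes "i < j" "j \<le> (r::nat)" "vs i = vs j"
  defines "vs' \<equiv> \<lambda>k. if k \<le> i then vs k else vs (k + (j - i))"
  shows "(\<Sum>k<r. f (vs k) (vs (Suc k))) = (\<Sum>k<r - (j - i). f (vs' k) (vs' (Suc k))) +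
    (\<Sum>k<j - i. f (vs (i + k)) (vs (Suc (i + k))) :: 'a::comm_monoid_add)"
proof -
  let ?g = "\<lambda>k. f (vs k) (vs (Suc k))" and ?h = "\<lambda>k. f (vs' k) (vs' (Suc k))"
  have split: "sum F {..<a + b} = sum F {..<a} + (\<Sum>k<b. F (a + k))" for F :: "nat \<Rightarrow> 'a" and a b
    by (induction b) (auto simp: add.assoc)
  have r: "r - (j - i) = i + (r - j)" using assms(1,2) by simp
  have 1: "sum ?g {..<r} = sum ?g {..<i} + (\<Sum>k<j - i. ?g (i + k)) + (\<Sum>k<r - j. ?g (j + k))"
    using split[of ?g j "r - j"] split[of ?g i "j - i"] assms(1,2) by simp
  have "sum ?h {..<r - (j - i)} = sum ?h {..<i} + (\<Sum>k<r - j. ?h (i + k))"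
    unfolding r split ..
  moreover have "sum ?h {..<i} = sum ?g {..<i}" by (intro sum.cong) (auto simp: vs'_def)
  moreover have "?h (i + k) = ?g (j + k)" for k
    using assms(1,3) by (cases k) (auto simp: vs'_def add.commute)
  ultimately show ?thesis using 1 by (simp add: ac_simps)
qed

text \<open>The complete directed graph on \<open>{..<n}\<close> with arc weights \<open>w\<close>: closed walks of length at most
  \<open>n\<close> suffice to detect negative cycles.\<close>

lemma potentials_exist:
  fixes w :: "nat \<Rightarrow> nat \<Rightarrow> 'a::linordered_field"
  assumes "0 < n" and cyc: "\<And>r vs. 0 < r \<Longrightarrow> r \<le> n \<Longrightarrow> (\<And>i. i \<le> r \<Longrightarrow> vs i < n) \<Longrightarrow> vs r = vs 0 \<Longrightarrow>
    0 \<le> (\<Sum>i<r. w (vs i) (vs (Suc i)))"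
  obtains p where "\<And>u v. u < n \<Longrightarrow> v < n \<Longrightarrow> p v \<le> p u + w u v"
proof -
  define len where "len r vs = (\<Sum>i<r. w (vs i) (vs (Suc i)))" for r and vs :: "nat \<Rightarrow> nat"
  \<comment> \<open>Walks start at vertex 0 and have between 1 and \<open>n\<close> arcs. Fixing the
    values beyond \<open>n\<close> as \<open>undefined\<close> makes the set finite, so that a
    minimum exists.\<close>
  define Wk where "Wk v = {(r, vs). r \<in> {1..n} \<and> vs \<in> PiE {..n} (\<lambda>_. {..<n}) \<and> vs 0 = 0 \<and> vs r = v}" for v
  have fin: "finite (Wk v)" for v
  proof (rule finite_subset)
    show "Wk v \<subseteq> {1..n} \<times> PiE {..n} (\<lambda>_. {..<n})" by (auto simp: Wk_def)
  qed (auto intro!: finite_PiE)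
  define p where "p v = Min ((\<lambda>(r, vs). len r vs) ` Wk v)" for v
  have p_le: "p v \<le> len r vs"
    if "0 < r" "r \<le> n" "\<And>i. i \<le> r \<Longrightarrow> vs i < n" "vs 0 = 0" "vs r = v" for r vs v
  proof -
    let ?vs = "\<lambda>i. if i \<le> r then vs i else if i \<le> n then 0 else undefined"
    have "(r, ?vs) \<in> Wk v" using that \<open>0 < n\<close> by (auto simp: Wk_def split: if_splits)
    moreover have "len r ?vs = len r vs" unfolding len_def by (intro sum.cong) auto
    ultimately show ?thesis unfolding p_def using fin by (intro Min_le) force+
  qed
  have ne: "Wk v \<noteq> {}" if "v < n" for v
  proof -
    have "(1, \<lambda>i. if i = 0 then 0 else if i \<le> n then v else undefined) \<in> Wk v"
      using that by (auto simp: Wk_def split: if_splits)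
    then show ?thesis by blast
  qed
  have "p v \<le> p u + w u v" if uv: "u < n" "v < n" for u v
  proof -
    have "p u \<in> (\<lambda>(r, vs). len r vs) ` Wk u"
      unfolding p_def using fin ne[OF uv(1)] by (intro Min_in) auto
    then obtain r vs where "(r, vs) \<in> Wk u" "p u = len r vs" by auto
    then have vs: "0 < r" "r \<le> n" "\<And>i. i \<le> n \<Longrightarrow> vs i < n" "vs 0 = 0" "vs r = u" "p u = len r vs"
      by (auto simp: Wk_def PiE_def Pi_def)
    let ?vs = "vs(Suc r := v)"
    have "len (Suc r) ?vs = len r ?vs + w u v" using vs by (simp add: len_def)
    also have "len r ?vs = len r vs" unfolding len_def by (intro sum.cong) auto
    finally have len: "len (Suc r) ?vs = p u + w u v" by (simp only: vs(6))
    have range: "?vs i < n" if "i \<le> Suc r" for i using that vs uv by (auto simp: le_Suc_eq)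
    show ?thesis
    proof (cases "r < n")
      case True
      then have "p v \<le> len (Suc r) ?vs" using range vs by (intro p_le) auto
      then show ?thesis using len by simp
    next
      case False
      then have "r = n" using vs by simp
      \<comment> \<open>The additional arc would make \<open>n + 1\<close> arcs in all. But the
        \<open>n + 1\<close> vertices of the walk repeat one, and removing the closed part between
        two visits, of nonnegative weight, brings the length back to at most
        \<open>n\<close>.\<close>
      have "\<not> inj_on vs {..n}"
        using card_inj_on_le[of vs "{..n}" "{..<n}"] vs(3) by (auto simp: image_subset_iff)
      then obtain i0 j0 where ij0: "i0 \<le> n" "j0 \<le> n" "i0 \<noteq> j0" "vs i0 = vs j0"
        by (auto simp: inj_on_def)
      define i j where "i = min i0 j0" and "j = max i0 j0"
      have ij: "i < j" "j \<le> n" "vs i = vs j"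
        using ij0 by (auto simp: i_def j_def min_def max_def)
      define vs' where "vs' k = (if k \<le> i then ?vs k else ?vs (k + (j - i)))" for k
      have "len (Suc n) ?vs = len (Suc n - (j - i)) vs' +
          (\<Sum>k<j - i. w (?vs (i + k)) (?vs (Suc (i + k))))"
        unfolding len_def vs'_def using ij \<open>r = n\<close> by (intro sum_cut) auto
      moreover have "0 \<le> (\<Sum>k<j - i. w (?vs (i + k)) (?vs (Suc (i + k))))"
        using cyc[of "j - i" "\<lambda>k. ?vs (i + k)"] ij \<open>r = n\<close> range by auto
      moreover have "p v \<le> len (Suc n - (j - i)) vs'"
        using ij \<open>r = n\<close> vs range by (intro p_le) (auto simp: vs'_def)
      ultimately show ?thesis using len \<open>r = n\<close> by simp
    qed
  qed
  then show thesis by (rule that)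
qed

text \<open>\<open>L u v\<close> is the cheapest column through which mass can move from row
  \<open>v\<close> to row \<open>u\<close>, so parallel arcs of the residual graph are merged into
  one. Completeness of the graph is no restriction: if all row sums of a plan are positive, each row
  has a positive entry.\<close>

locale row_graph =
  fixes n m :: nat and c y :: "nat \<Rightarrow> nat \<Rightarrow> 'a::linordered_field" and L :: "nat \<Rightarrow> nat \<Rightarrow> nat"
    and w :: "nat \<Rightarrow> nat \<Rightarrow> 'a"
  assumes n: "0 < n"
    and L: "\<And>u v. u < n \<Longrightarrow> v < n \<Longrightarrow> L u v < m \<and> 0 < y v (L u v)"
    and L_min: "\<And>u v l. u < n \<Longrightarrow> v < n \<Longrightarrow> l < m \<Longrightarrow> 0 < y v l \<Longrightarrow>
      c u (L u v) - c v (L u v) \<le> c u l - c v l"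
    and w: "\<And>u v. u < n \<Longrightarrow> v < n \<Longrightarrow> w u v = c u (L u v) - c v (L u v)"
begin

definition closed_walk :: "nat \<Rightarrow> (nat \<Rightarrow> nat) \<Rightarrow> bool" where
  "closed_walk r vs \<longleftrightarrow> 0 < r \<and> r \<le> n \<and> (\<forall>i\<le>r. vs i < n) \<and> vs r = vs 0"

definition walk_weight :: "nat \<Rightarrow> (nat \<Rightarrow> nat) \<Rightarrow> 'a" where
  "walk_weight r vs = (\<Sum>i<r. w (vs i) (vs (Suc i)))"

lemma eps_opt_exists:
  assumes "\<And>r vs. closed_walk r vs \<Longrightarrow> - (of_nat r * e) \<le> walk_weight r vs"
  shows "\<exists>p. eps_opt n m c e p y"
proof -
  obtain p where p: "\<And>u v. u < n \<Longrightarrow> v < n \<Longrightarrow> p v \<le> p u + (w u v + e)"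
  proof (rule potentials_exist[OF n, of "\<lambda>u v. w u v + e"])
    fix r vs assume "0 < r" "r \<le> n" "\<And>i. i \<le> r \<Longrightarrow> vs i < n" "vs r = vs (0::nat)"
    then show "0 \<le> (\<Sum>i<r. w (vs i) (vs (Suc i)) + e)"
      using assms[of r vs] by (simp add: closed_walk_def walk_weight_def sum.distrib)
  qed blast
  have "c k' l + p k' \<le> c k l + p k + e" if "k < n" "k' < n" "l < m" "0 < y k' l" for k k' l
    using p[of k k'] w[of k k'] L_min[of k k' l] that by simp
  then show ?thesis by (auto simp: eps_opt_def)
qed

lemma cancel_step_stop:
  assumes "\<And>r vs. closed_walk r vs \<Longrightarrow> 0 \<le> walk_weight r vs"
  shows "cancel_step n m c y 0 y"
proof -
  have "\<exists>p. eps_opt n m c 0 p y" by (rule eps_opt_exists) (simp add: assms)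
  then show ?thesis by (simp add: cancel_step_def)
qed

text \<open>A shortest one among the closed walks of minimum mean does not visit any row twice: otherwise it
  would split into two shorter closed walks of larger mean.\<close>

lemma cancel_step_push:
  assumes vs: "closed_walk r vs" "walk_weight r vs = - (of_nat r * e)" "0 < e"
    and min: "\<And>r' vs'. closed_walk r' vs' \<Longrightarrow> - (of_nat r' * e) \<le> walk_weight r' vs'"
      "\<And>r' vs'. closed_walk r' vs' \<Longrightarrow> r' < r \<Longrightarrow> - (of_nat r' * e) < walk_weight r' vs'"
  defines "ls \<equiv> \<lambda>i. L (vs i) (vs (Suc i))"
  shows "cancel_step n m c y e (push r vs ls (Min ((\<lambda>i. y (vs (Suc i)) (ls i)) ` {..<r})) y)"
proof -
  have v: "vs i < n" if "i \<le> r" for i using vs that by (simp add: closed_walk_def)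
  have no_repeat: "vs i \<noteq> vs j" if "i < j" "j < r" for i j
  proof
    assume eq: "vs i = vs j"
    define vs' where "vs' k = (if k \<le> i then vs k else vs (k + (j - i)))" for k
    have "walk_weight r vs = walk_weight (r - (j - i)) vs' + walk_weight (j - i) (\<lambda>k. vs (i + k))"
      unfolding walk_weight_def vs'_def using sum_cut[OF that(1) less_imp_le[OF that(2)] eq, of w]
      by simp
    moreover have "closed_walk (r - (j - i)) vs'" "closed_walk (j - i) (\<lambda>k. vs (i + k))"
      using vs(1) that eq by (auto simp: closed_walk_def vs'_def)
    moreover from this have "- (of_nat (r - (j - i)) * e) < walk_weight (r - (j - i)) vs'"
      "- (of_nat (j - i) * e) < walk_weight (j - i) (\<lambda>k. vs (i + k))"
      using min(2)[of "r - (j - i)" vs'] min(2)[of "j - i" "\<lambda>k. vs (i + k)"] that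
      by (auto simp del: of_nat_diff)
    moreover have "of_nat r * e = of_nat (r - (j - i)) * e + of_nat (j - i) * e"
      using that unfolding distrib_right[symmetric] of_nat_add[symmetric] by simp
    ultimately show False using vs(2) by simp
  qed
  have "inj_on vs {..<r}"
    using no_repeat by (intro linorder_inj_onI') auto
  moreover have "(\<Sum>i<r. c (vs i) (ls i) - c (vs (Suc i)) (ls i)) = walk_weight r vs"
    unfolding walk_weight_def ls_def using w v by (intro sum.cong) auto
  moreover have "ls i < m \<and> 0 < y (vs (Suc i)) (ls i)" if "i < r" for i
    using L v that by (simp add: ls_def)
  ultimately have "cancels n m c y e (push r vs ls (Min ((\<lambda>i. y (vs (Suc i)) (ls i)) ` {..<r})) y)"
    unfolding cancels_def
    by (intro exI[of _ r] exI[of _ vs] exI[of _ ls]) (use vs in \<open>simp add: closed_walk_def\<close>)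
  then show ?thesis using eps_opt_exists[OF min(1)] vs(3) by (simp add: cancel_step_def)
qed

end

section \<open>Wasserstein barycenters of finitely supported laws\<close>

lemma space_Rd: "space (Rd d) = PiE {..<d} (\<lambda>_. UNIV)"
  by (simp add: Rd_def space_PiM)

lemma edist_sq: "(edist d x y)\<^sup>2 = (\<Sum>c<d. (x c - y c)\<^sup>2)"
  by (simp add: edist_def L2_set_def sum_nonneg)

lemma measurable_edist_pair [measurable]:
  "(\<lambda>z. (edist d (fst z) (snd z))\<^sup>2) \<in> borel_measurable (Rd d \<Otimes>\<^sub>M Rd d)"
  unfolding edist_sq Rd_def by measurable

lemma measurable_edist_fixed [measurable]:
  "(\<lambda>x. (edist d x y)\<^sup>2) \<in> borel_measurable (Rd d)"
  unfolding edist_sq Rd_def by measurable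

lemma singleton_Rd [measurable]:
  assumes "x \<in> space (Rd d)"
  shows "{x} \<in> sets (Rd d)"
proof -
  have "{x} = PiE {..<d} (\<lambda>c. {x c})"
    using assms by (simp add: space_Rd PiE_singleton PiE_iff)
  also have "\<dots> \<in> sets (Rd d)" unfolding Rd_def by (rule sets_PiM_I_finite) auto
  finally show ?thesis .
qed

text \<open>The points \<open>f a\<close> need not be distinct, so one weighted index set can carry
  several laws at once and thereby couple them.\<close>

definition fin_law :: "nat \<Rightarrow> 'a set \<Rightarrow> ('a \<Rightarrow> real) \<Rightarrow> ('a \<Rightarrow> nat \<Rightarrow> real) \<Rightarrow> (nat \<Rightarrow> real) measure" where
  "fin_law d A w f = distr (point_measure A (\<lambda>a. ennreal (w a))) (Rd d) f"

lemma sets_fin_law [simp]: "sets (fin_law d A w f) = sets (Rd d)"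
  and space_fin_law [simp]: "space (fin_law d A w f) = space (Rd d)"
  by (simp_all add: fin_law_def)

lemma emeasure_fin_law:
  assumes "finite A" "f \<in> A \<rightarrow> space (Rd d)" "\<And>a. a \<in> A \<Longrightarrow> 0 \<le> w a" "B \<in> sets (Rd d)"
  shows "emeasure (fin_law d A w f) B = ennreal (\<Sum>a\<in>{a\<in>A. f a \<in> B}. w a)"
proof -
  have "f -` B \<inter> A = {a\<in>A. f a \<in> B}" by auto
  then show ?thesis
    using assms unfolding fin_law_def
    by (subst emeasure_distr) (auto simp: space_point_measure emeasure_point_measure_finite intro!: sum_ennreal)
qed

lemma nn_integral_fin_law:
  assumes "finite A" "f \<in> A \<rightarrow> space (Rd d)" "h \<in> borel_measurable (Rd d)"
  shows "(\<integral>\<^sup>+ x. h x \<partial>fin_law d A w f) = (\<Sum>a\<in>A. ennreal (w a) * h (f a))"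
  using assms unfolding fin_law_def
  by (subst nn_integral_distr) (auto simp: nn_integral_point_measure_finite)

lemma fin_law_push:
  assumes fin: "finite A" "finite K" and h: "h \<in> A \<rightarrow> K" and g: "g \<in> K \<rightarrow> space (Rd d)"
    and w: "\<And>a. a \<in> A \<Longrightarrow> 0 \<le> w a" and v: "\<And>k. k \<in> K \<Longrightarrow> (\<Sum>a\<in>{a\<in>A. h a = k}. w a) = v k"
  shows "fin_law d A w (\<lambda>a. g (h a)) = fin_law d K v g"
proof (rule measure_eqI)
  have v0: "0 \<le> v k" if "k \<in> K" for k
    unfolding v[OF that, symmetric] using w by (intro sum_nonneg) auto
  fix B assume "B \<in> sets (fin_law d A w (\<lambda>a. g (h a)))"
  then have B: "B \<in> sets (Rd d)" by simp
  have "(\<Sum>k\<in>{k\<in>K. g k \<in> B}. v k) = (\<Sum>k\<in>{k\<in>K. g k \<in> B}. \<Sum>a\<in>{a\<in>{a\<in>A. g (h a) \<in> B}. h a = k}. w a)"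
  proof (intro sum.cong refl)
    fix k assume k: "k \<in> {k\<in>K. g k \<in> B}"
    then have "{a\<in>{a\<in>A. g (h a) \<in> B}. h a = k} = {a\<in>A. h a = k}" by auto
    then show "v k = (\<Sum>a\<in>{a\<in>{a\<in>A. g (h a) \<in> B}. h a = k}. w a)" using v k by simp
  qed
  also have "\<dots> = (\<Sum>a\<in>{a\<in>A. g (h a) \<in> B}. w a)"
    using fin h by (intro sum.group) auto
  finally show "emeasure (fin_law d A w (\<lambda>a. g (h a))) B = emeasure (fin_law d K v g) B"
    using fin h g w v0 B by (subst (1 2) emeasure_fin_law) auto
qed simp

lemma W2_sq: "(W2 d P Q)\<^sup>2 = enn2real
    (INF \<pi>\<in>couplings d P Q. \<integral>\<^sup>+ z. ennreal ((edist d (fst z) (snd z))\<^sup>2) \<partial>\<pi>)"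
  by (simp add: W2_def)

text \<open>Both laws are images of the same weights, so the image under the pair of maps is a
  coupling.\<close>

lemma W2_fin_law_le:
  assumes fin: "finite A" and f: "f \<in> A \<rightarrow> space (Rd d)" and g: "g \<in> A \<rightarrow> space (Rd d)"
    and w: "\<And>a. a \<in> A \<Longrightarrow> 0 \<le> w a"
  shows "(W2 d (fin_law d A w f) (fin_law d A w g))\<^sup>2 \<le> (\<Sum>a\<in>A. w a * (edist d (f a) (g a))\<^sup>2)"
proof -
  let ?M = "point_measure A (\<lambda>a. ennreal (w a))"
  define \<pi> where "\<pi> = distr ?M (Rd d \<Otimes>\<^sub>M Rd d) (\<lambda>a. (f a, g a))"
  have meas: "(\<lambda>a. (f a, g a)) \<in> ?M \<rightarrow>\<^sub>M Rd d \<Otimes>\<^sub>M Rd d"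
    using f g by (auto simp: space_pair_measure)
  have "\<pi> \<in> couplings d (fin_law d A w f) (fin_law d A w g)"
    unfolding couplings_def \<pi>_def fin_law_def using meas
    by (auto simp: distr_distr o_def)
  moreover have "(\<integral>\<^sup>+ z. ennreal ((edist d (fst z) (snd z))\<^sup>2) \<partial>\<pi>) =
      ennreal (\<Sum>a\<in>A. w a * (edist d (f a) (g a))\<^sup>2)"
    unfolding \<pi>_def using meas fin w
    by (subst nn_integral_distr)
      (auto simp: nn_integral_point_measure_finite ennreal_mult'[symmetric] intro!: sum_ennreal)
  ultimately have "(INF \<pi>\<in>couplings d (fin_law d A w f) (fin_law d A w g).
      \<integral>\<^sup>+ z. ennreal ((edist d (fst z) (snd z))\<^sup>2) \<partial>\<pi>) \<le> ennreal (\<Sum>a\<in>A. w a * (edist d (f a) (g a))\<^sup>2)"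
    by (intro INF_lower2[of \<pi>]) simp_all
  then show ?thesis unfolding W2_sq
    using w by (intro enn2real_leI) (auto intro!: sum_nonneg)
qed

text \<open>The factor \<open>F\<close> is absorbed into the weights of index \<open>i0\<close>,
  after which the sum of products factors. Semirings are general enough for both applications, real
  masses and densities in \<open>ennreal\<close>.\<close>

lemma sum_PiE_marginal:
  fixes g :: "'i \<Rightarrow> 'k \<Rightarrow> 'a::comm_semiring_1"
  assumes "finite I" "\<And>i. i \<in> I \<Longrightarrow> finite (A i)" "i0 \<in> I"
    and "\<And>i. i \<in> I \<Longrightarrow> (\<Sum>k\<in>A i. g i k) = 1"
  shows "(\<Sum>t\<in>PiE I A. (\<Prod>i\<in>I. g i (t i)) * F (t i0)) = (\<Sum>k\<in>A i0. g i0 k * F k)"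
proof -
  define h where "h i k = (if i = i0 then g i0 k * F k else g i k)" for i k
  have "(\<Prod>i\<in>I. g i (t i)) * F (t i0) = (\<Prod>i\<in>I. h i (t i))" for t
    unfolding prod.remove[OF assms(1,3)] h_def by (simp add: mult_ac)
  then have "(\<Sum>t\<in>PiE I A. (\<Prod>i\<in>I. g i (t i)) * F (t i0)) = (\<Prod>i\<in>I. \<Sum>k\<in>A i. h i k)"
    using prod_sum_PiE[of I A h] assms by simp
  also have "\<dots> = (\<Sum>k\<in>A i0. h i0 k)"
    unfolding prod.remove[OF assms(1,3)] using assms(4) by (simp add: h_def)
  finally show ?thesis by (simp add: h_def)
qed

section \<open>Multi-marginal plans and their costs\<close>

locale bary_data =
  fixes d N :: nat and lam :: "nat \<Rightarrow> real" and len :: "nat \<Rightarrow> nat"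
    and X :: "nat \<Rightarrow> nat \<Rightarrow> nat \<Rightarrow> real" and D :: "nat \<Rightarrow> nat \<Rightarrow> real"
  assumes lam: "\<And>i. i < N \<Longrightarrow> 0 < lam i" "(\<Sum>i<N. lam i) = 1"
    and X: "\<And>i k. i < N \<Longrightarrow> k < len i \<Longrightarrow> X i k \<in> space (Rd d)"
    and X_inj: "\<And>i. i < N \<Longrightarrow> inj_on (X i) {..<len i}"
    and D: "\<And>i k. i < N \<Longrightarrow> k < len i \<Longrightarrow> 0 < D i k" "\<And>i. i < N \<Longrightarrow> (\<Sum>k<len i. D i k) = 1"
begin

definition P :: "nat \<Rightarrow> (nat \<Rightarrow> real) measure" where
  "P i = fin_law d {..<len i} (D i) (X i)"

definition objective :: "(nat \<Rightarrow> real) measure \<Rightarrow> real" where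
  "objective Q = (\<Sum>i<N. lam i * (W2 d Q (P i))\<^sup>2)"

definition tuples :: "(nat \<Rightarrow> nat) set" where
  "tuples = PiE {..<N} (\<lambda>i. {..<len i})"

definition mean :: "(nat \<Rightarrow> nat) \<Rightarrow> nat \<Rightarrow> real" where
  "mean t = (\<lambda>c\<in>{..<d}. \<Sum>i<N. lam i * X i (t i) c)"

definition tuple_cost :: "(nat \<Rightarrow> nat) \<Rightarrow> (nat \<Rightarrow> real) \<Rightarrow> real" where
  "tuple_cost t x = (\<Sum>i<N. lam i * (edist d x (X i (t i)))\<^sup>2)"

definition multi_plan :: "((nat \<Rightarrow> nat) \<Rightarrow> real) \<Rightarrow> bool" where
  "multi_plan w \<longleftrightarrow> (\<forall>t\<in>tuples. 0 \<le> w t) \<and>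
    (\<forall>i<N. \<forall>k<len i. (\<Sum>t\<in>{t\<in>tuples. t i = k}. w t) = D i k)"

definition multi_cost :: "((nat \<Rightarrow> nat) \<Rightarrow> real) \<Rightarrow> real" where
  "multi_cost w = (\<Sum>t\<in>tuples. w t * tuple_cost t (mean t))"

lemma finite_tuples [simp]: "finite tuples"
  unfolding tuples_def by (intro finite_PiE) auto

lemma mean_space: "mean t \<in> space (Rd d)"
  by (simp add: space_Rd mean_def)

lemma tuple_lt: "t \<in> tuples \<Longrightarrow> i < N \<Longrightarrow> t i < len i"
  by (auto simp: tuples_def)

lemma N_pos: "0 < N"
  using lam(2) by (cases N) auto

lemma multi_plan_total:
  assumes "multi_plan w"
  shows "(\<Sum>t\<in>tuples. w t) = 1"
proof -
  have "(\<Sum>t\<in>tuples. w t) = (\<Sum>k<len 0. \<Sum>t\<in>{t\<in>tuples. t 0 = k}. w t)"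
    by (rule sum.group[symmetric]) (use tuple_lt N_pos in auto)
  also have "\<dots> = 1" using assms N_pos D(2)[of 0] by (simp add: multi_plan_def)
  finally show ?thesis .
qed

text \<open>Steiner's identity, coordinate by coordinate: the mixed term vanishes because the
  weights sum to 1 and \<open>mean t\<close> is the weighted mean.\<close>

lemma tuple_cost_variance:
  "tuple_cost t x = tuple_cost t (mean t) + (edist d x (mean t))\<^sup>2"
proof -
  have "(\<Sum>i<N. lam i * (x c - X i (t i) c)\<^sup>2) =
      (\<Sum>i<N. lam i * (mean t c - X i (t i) c)\<^sup>2) + (x c - mean t c)\<^sup>2" if "c < d" for c
  proof -
    have m: "(\<Sum>i<N. lam i * X i (t i) c) = mean t c" using that by (simp add: mean_def)
    have "(\<Sum>i<N. lam i * (x c - X i (t i) c)\<^sup>2) - (\<Sum>i<N. lam i * (mean t c - X i (t i) c)\<^sup>2) =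
        (\<Sum>i<N. (x c ^ 2 - mean t c ^ 2) * lam i - 2 * (x c - mean t c) * (lam i * X i (t i) c))"
      unfolding sum_subtractf[symmetric] by (intro sum.cong) (auto simp: power2_eq_square algebra_simps)
    also have "\<dots> = (x c ^ 2 - mean t c ^ 2) - 2 * (x c - mean t c) * mean t c"
      unfolding sum_subtractf sum_distrib_left[symmetric] m lam(2) by simp
    finally show ?thesis by (simp add: power2_eq_square algebra_simps)
  qed
  then show ?thesis
    unfolding tuple_cost_def edist_sq sum_distrib_left
    by (subst (1 2) sum.swap) (simp add: sum.distrib)
qed

lemma multi_plan_exists: "multi_plan (\<lambda>t. \<Prod>i<N. D i (t i))"
proof -
  have "(\<Sum>t\<in>{t\<in>tuples. t i = k}. \<Prod>i<N. D i (t i)) = D i k" if ik: "i < N" "k < len i" for i k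
  proof -
    have "(\<Sum>t\<in>{t\<in>tuples. t i = k}. \<Prod>i<N. D i (t i)) =
        (\<Sum>t\<in>tuples. (\<Prod>i<N. D i (t i)) * (if t i = k then 1 else 0))"
      unfolding sum.inter_filter[OF finite_tuples] by (intro sum.cong) auto
    also have "\<dots> = (\<Sum>k'<len i. D i k' * (if k' = k then 1 else 0))"
      unfolding tuples_def using ik D(2) by (intro sum_PiE_marginal) auto
    also have "\<dots> = D i k" using ik by (simp add: if_distrib[of "(*) _"] cong: if_cong)
    finally show ?thesis .
  qed
  moreover have "0 \<le> (\<Prod>i<N. D i (t i))" if "t \<in> tuples" for t
    using D(1) tuple_lt[OF that] by (intro prod_nonneg) (auto intro: less_imp_le)
  ultimately show ?thesis by (simp add: multi_plan_def)
qed

text \<open>On functions that vanish outside \<open>tuples\<close> the constraints cut out a closed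
  subset of a product of unit intervals, which is compact by Tychonoff's theorem; the cost depends
  continuously on finitely many coordinates.\<close>

lemma multi_plan_minimizer:
  obtains w where "multi_plan w" "\<And>w'. multi_plan w' \<Longrightarrow> multi_cost w \<le> multi_cost w'"
proof -
  define K where "K = {w. multi_plan w \<and> (\<forall>t. t \<notin> tuples \<longrightarrow> w t = 0)}"
  have restrict: "(\<lambda>t. if t \<in> tuples then w t else 0) \<in> K" if "multi_plan w" for w
    using that by (simp add: K_def multi_plan_def)
  have "K \<subseteq> PiE UNIV (\<lambda>_. {0..1})"
  proof
    fix w assume w: "w \<in> K"
    have "w t \<le> 1" "0 \<le> w t" if "t \<in> tuples" for t
      using member_le_sum[OF that, of w] multi_plan_total[of w] w by (auto simp: K_def multi_plan_def that)
    moreover have "w t = 0" if "t \<notin> tuples" for t using w that by (simp add: K_def)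
    ultimately show "w \<in> PiE UNIV (\<lambda>_. {0..1})" by (auto simp: PiE_UNIV_domain) (metis zero_le_one order_refl)+
  qed
  moreover have "compact (PiE UNIV (\<lambda>_::nat \<Rightarrow> nat. {0..1::real}))"
    using compactin_PiE[of "\<lambda>_. euclidean" UNIV "\<lambda>_::nat \<Rightarrow> nat. {0..1::real}"]
    by (simp add: euclidean_product_topology compactin_euclidean_iff)
  moreover have "closed K"
  proof -
    have "K = (\<Inter>t\<in>tuples. {w. 0 \<le> w t}) \<inter>
        (\<Inter>i\<in>{..<N}. \<Inter>k\<in>{..<len i}. {w. (\<Sum>t\<in>{t\<in>tuples. t i = k}. w t) = D i k}) \<inter>
        (\<Inter>t\<in>-tuples. {w. w t = 0})"
      by (auto simp: K_def multi_plan_def)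
    also have "closed \<dots>"
      by (intro closed_Int closed_INT ballI closed_Collect_le closed_Collect_eq
          continuous_on_const continuous_on_sum continuous_on_product_coordinates)
    finally show ?thesis .
  qed
  ultimately have "compact K" by (metis compact_Int_closed inf.absorb2)
  moreover have "K \<noteq> {}" using restrict[OF multi_plan_exists] by blast
  moreover have "continuous_on K multi_cost"
    unfolding multi_cost_def
    by (intro continuous_on_sum continuous_on_mult continuous_on_const
        continuous_on_subset[OF continuous_on_product_coordinates]) auto
  ultimately obtain w where w: "w \<in> K" "\<And>w'. w' \<in> K \<Longrightarrow> multi_cost w \<le> multi_cost w'"
    using continuous_attains_inf[of K multi_cost] by auto
  show thesis
  proof (rule that)
    show "multi_plan w" using w by (simp add: K_def)
    fix w' assume "multi_plan w'"
    from w(2)[OF restrict[OF this]] show "multi_cost w \<le> multi_cost w'"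
      by (simp add: multi_cost_def)
  qed
qed

lemma fin_law_marginal:
  assumes "multi_plan w" "i < N"
  shows "fin_law d tuples w (\<lambda>t. X i (t i)) = P i"
  unfolding P_def
  by (rule fin_law_push) (use assms X tuple_lt in \<open>auto simp: multi_plan_def\<close>)

lemma objective_mean_le:
  assumes "multi_plan w"
  shows "objective (fin_law d tuples w mean) \<le> multi_cost w"
proof -
  have "objective (fin_law d tuples w mean) \<le>
      (\<Sum>i<N. lam i * (\<Sum>t\<in>tuples. w t * (edist d (mean t) (X i (t i)))\<^sup>2))"
    unfolding objective_def
  proof (intro sum_mono mult_left_mono)
    fix i assume i: "i \<in> {..<N}"
    show "(W2 d (fin_law d tuples w mean) (P i))\<^sup>2 \<le> (\<Sum>t\<in>tuples. w t * (edist d (mean t) (X i (t i)))\<^sup>2)"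
      unfolding fin_law_marginal[OF assms, of i, symmetric, OF i[unfolded lessThan_iff]]
      by (rule W2_fin_law_le) (use assms i X tuple_lt mean_space in \<open>auto simp: multi_plan_def\<close>)
  qed (use lam in \<open>auto intro: less_imp_le\<close>)
  also have "\<dots> = multi_cost w"
    unfolding multi_cost_def tuple_cost_def sum_distrib_left
    by (subst sum.swap) (simp add: mult_ac)
  finally show ?thesis .
qed

lemma tuple_cost_nonneg: "0 \<le> tuple_cost t x"
  unfolding tuple_cost_def using lam(1) by (intro sum_nonneg mult_nonneg_nonneg) (auto intro: less_imp_le)

section \<open>From couplings of an arbitrary measure to multi-marginal plans\<close>

lemma emeasure_P_singleton:
  assumes "i < N" "k < len i"
  shows "emeasure (P i) {X i k} = ennreal (D i k)"
proof -
  have "{k' \<in> {..<len i}. X i k' \<in> {X i k}} = {k}"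
    using assms X_inj[of i] by (auto simp: inj_on_def)
  then show ?thesis
    unfolding P_def using assms X D(1) singleton_Rd
    by (subst emeasure_fin_law) (auto intro: less_imp_le)
qed

text \<open>\<open>P i\<close> has finitely many atoms, so no general disintegration is called for:
  the conditional probability of atom \<open>k\<close> is the Radon-Nikodym derivative with respect
  to \<open>Q\<close> of the part of \<pi> lying over that atom.\<close>

lemma coupling_densities:
  assumes Q: "sets Q = sets (Rd d)" "emeasure Q (space Q) = 1"
    and \<pi>: "\<pi> \<in> couplings d Q (P i)" and i: "i < N"
  obtains g where "\<And>k. g k \<in> borel_measurable (Rd d)"
    and "\<And>f. f \<in> borel_measurable (Rd d \<Otimes>\<^sub>M Rd d) \<Longrightarrow>
      (\<integral>\<^sup>+ z. f z \<partial>\<pi>) = (\<integral>\<^sup>+ x. (\<Sum>k<len i. g k x * f (x, X i k)) \<partial>Q)"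
proof -
  interpret Q: finite_measure Q using Q(2) by (intro finite_measureI) simp
  have sets_\<pi>[measurable_cong]: "sets \<pi> = sets (Rd d \<Otimes>\<^sub>M Rd d)"
    and fst_\<pi>: "distr \<pi> (Rd d) fst = Q" and snd_\<pi>: "distr \<pi> (Rd d) snd = P i"
    using \<pi> by (auto simp: couplings_def)
  note Q(1)[measurable_cong]
  have Xk[measurable]: "{X i k} \<in> sets (Rd d)" if "k < len i" for k
    using X i that by (intro singleton_Rd) auto
  define B where "B k = (if k < len i then {X i k} else {})" for k
  have B[measurable]: "B k \<in> sets (Rd d)" for k by (simp add: B_def)
  define \<nu> where "\<nu> k = distr (density \<pi> (\<lambda>z. indicator (B k) (snd z))) (Rd d) fst" for k
  have "\<exists>g\<in>borel_measurable Q. density Q g = \<nu> k" for k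
  proof (rule Q.Radon_Nikodym)
    show "sets (\<nu> k) = sets Q" by (simp add: \<nu>_def Q(1))
    show "absolutely_continuous Q (\<nu> k)"
      unfolding absolutely_continuous_def
    proof
      fix A assume A: "A \<in> null_sets Q"
      then have [measurable]: "A \<in> sets (Rd d)" using Q(1) by auto
      have "emeasure (distr \<pi> (Rd d) fst) A = 0" unfolding fst_\<pi> using A by auto
      then have "emeasure \<pi> (fst -` A \<inter> space \<pi>) = 0" by (subst (asm) emeasure_distr) auto
      then have "AE z in \<pi>. z \<notin> fst -` A \<inter> space \<pi>"
        by (intro AE_not_in null_setsI) auto
      then have "(\<integral>\<^sup>+ z. indicator (B k) (snd z) * indicator (fst -` A \<inter> space \<pi>) z \<partial>\<pi>) = 0"
        by (subst nn_integral_0_iff_AE) (auto simp: indicator_def)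
      then have "emeasure (\<nu> k) A = 0"
        unfolding \<nu>_def by (subst emeasure_distr) (auto simp: emeasure_density)
      then show "A \<in> null_sets (\<nu> k)" by (auto simp: \<nu>_def)
    qed
  qed
  then obtain g where g: "\<And>k. g k \<in> borel_measurable Q" "\<And>k. density Q (g k) = \<nu> k" by metis
  then have [measurable]: "g k \<in> borel_measurable (Rd d)" for k
    using measurable_cong_sets[OF Q(1) refl] by blast
  have int_g: "(\<integral>\<^sup>+ x. g k x * h x \<partial>Q) = (\<integral>\<^sup>+ z. indicator (B k) (snd z) * h (fst z) \<partial>\<pi>)"
    if [measurable]: "h \<in> borel_measurable (Rd d)" for h k
  proof -
    have "(\<integral>\<^sup>+ x. g k x * h x \<partial>Q) = (\<integral>\<^sup>+ x. h x \<partial>\<nu> k)"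
      unfolding g(2)[symmetric] by (subst nn_integral_density) auto
    also have "\<dots> = (\<integral>\<^sup>+ z. indicator (B k) (snd z) * h (fst z) \<partial>\<pi>)"
      unfolding \<nu>_def by (subst nn_integral_distr) (auto simp: nn_integral_density)
    finally show ?thesis .
  qed
  \<comment> \<open>The second marginal lives on the atoms, so the parts over the atoms together
    make up all of \<pi>.\<close>
  have in_supp: "AE z in \<pi>. \<exists>k<len i. snd z = X i k"
  proof -
    let ?S = "space (Rd d) - X i ` {..<len i}"
    have S: "?S \<in> sets (Rd d)"
    proof -
      have "X i ` {..<len i} = (\<Union>k<len i. {X i k})" by auto
      also have "\<dots> \<in> sets (Rd d)" by auto
      finally show ?thesis by auto
    qed
    have none: "{k. k < len i \<and> X i k \<in> ?S} = {}" by auto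
    have "emeasure (P i) ?S = 0"
      unfolding P_def using S i X D(1)
      by (subst emeasure_fin_law) (auto intro: less_imp_le simp: none simp del: Diff_iff)
    then have "emeasure \<pi> (snd -` ?S \<inter> space \<pi>) = 0"
      unfolding snd_\<pi>[symmetric] using S by (subst (asm) emeasure_distr) auto
    then have "AE z in \<pi>. z \<notin> snd -` ?S \<inter> space \<pi>"
      using S by (intro AE_not_in null_setsI) auto
    with AE_space have ae: "AE z in \<pi>. z \<in> space \<pi> \<and> z \<notin> snd -` ?S \<inter> space \<pi>"
      by eventually_elim simp
    have sp: "space \<pi> = space (Rd d) \<times> space (Rd d)"
      using sets_eq_imp_space_eq[OF sets_\<pi>] by (simp add: space_pair_measure)
    show ?thesis using ae by eventually_elim (auto simp: sp)
  qed
  show thesis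
  proof (rule that)
    show "g k \<in> borel_measurable (Rd d)" for k by measurable
    fix f :: "(nat \<Rightarrow> real) \<times> (nat \<Rightarrow> real) \<Rightarrow> ennreal"
    assume [measurable]: "f \<in> borel_measurable (Rd d \<Otimes>\<^sub>M Rd d)"
    have [measurable]: "(\<lambda>x. f (x, X i k)) \<in> borel_measurable (Rd d)" if "k < len i" for k
      using X[OF i that] by measurable
    have "(\<integral>\<^sup>+ x. (\<Sum>k<len i. g k x * f (x, X i k)) \<partial>Q) =
        (\<Sum>k<len i. \<integral>\<^sup>+ x. g k x * f (x, X i k) \<partial>Q)"
      by (rule nn_integral_sum) auto
    also have "\<dots> = (\<Sum>k<len i. \<integral>\<^sup>+ z. indicator (B k) (snd z) * f (fst z, X i k) \<partial>\<pi>)"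
      by (intro sum.cong refl int_g) auto
    also have "\<dots> = (\<integral>\<^sup>+ z. (\<Sum>k<len i. indicator (B k) (snd z) * f (fst z, X i k)) \<partial>\<pi>)"
      by (rule nn_integral_sum[symmetric]) auto
    also have "\<dots> = (\<integral>\<^sup>+ z. f z \<partial>\<pi>)"
    proof (intro nn_integral_cong_AE, use in_supp in eventually_elim)
      fix z :: "(nat \<Rightarrow> real) \<times> (nat \<Rightarrow> real)"
      assume "\<exists>k<len i. snd z = X i k"
      then obtain k where k: "k < len i" "snd z = X i k" by blast
      have "(\<Sum>k'<len i. indicator (B k') (snd z) * f (fst z, X i k')) =
          (\<Sum>k'<len i. if k' = k then f z else 0)"
        using k X_inj[OF i] by (intro sum.cong) (auto simp: B_def indicator_def inj_on_def k(2)[symmetric])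
      then show "(\<Sum>k<len i. indicator (B k) (snd z) * f (fst z, X i k)) = f z" using k by simp
    qed
    finally show "(\<integral>\<^sup>+ z. f z \<partial>\<pi>) = (\<integral>\<^sup>+ x. (\<Sum>k<len i. g k x * f (x, X i k)) \<partial>Q)" ..
  qed
qed

text \<open>Given a point of \<open>Q\<close>, choose the indices in all measures independently with
  the conditional probabilities \<open>g i k\<close>; \<open>w\<close> is the law of the resulting
  tuple. Replacing the point of \<open>Q\<close> by the mean of the tuple does not raise the
  cost.\<close>

lemma couplings_multi_plan:
  assumes Q: "sets Q = sets (Rd d)" "emeasure Q (space Q) = 1"
    and \<pi>: "\<And>i. i < N \<Longrightarrow> \<pi> i \<in> couplings d Q (P i)"
  obtains w where "multi_plan w" "ennreal (multi_cost w) \<le>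
    (\<Sum>i<N. ennreal (lam i) * (\<integral>\<^sup>+ z. ennreal ((edist d (fst z) (snd z))\<^sup>2) \<partial>\<pi> i))"
proof -
  interpret Q: finite_measure Q using Q(2) by (intro finite_measureI) simp
  note Q(1)[measurable_cong]
  have "\<forall>i. \<exists>g. i < N \<longrightarrow> (\<forall>k. g k \<in> borel_measurable (Rd d)) \<and>
    (\<forall>f \<in> borel_measurable (Rd d \<Otimes>\<^sub>M Rd d).
      (\<integral>\<^sup>+ z. f z \<partial>\<pi> i) = (\<integral>\<^sup>+ x. (\<Sum>k<len i. g k x * f (x, X i k)) \<partial>Q))"
  proof
    fix i
    show "\<exists>g. i < N \<longrightarrow> (\<forall>k. g k \<in> borel_measurable (Rd d)) \<and>
      (\<forall>f \<in> borel_measurable (Rd d \<Otimes>\<^sub>M Rd d).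
        (\<integral>\<^sup>+ z. f z \<partial>\<pi> i) = (\<integral>\<^sup>+ x. (\<Sum>k<len i. g k x * f (x, X i k)) \<partial>Q))"
    proof (cases "i < N")
      case True
      show ?thesis by (rule coupling_densities[OF Q \<pi>[OF True] True]) blast
    qed blast
  qed
  from choice[OF this] obtain g where g_all: "\<forall>i. i < N \<longrightarrow> (\<forall>k. g i k \<in> borel_measurable (Rd d)) \<and>
    (\<forall>f \<in> borel_measurable (Rd d \<Otimes>\<^sub>M Rd d).
      (\<integral>\<^sup>+ z. f z \<partial>\<pi> i) = (\<integral>\<^sup>+ x. (\<Sum>k<len i. g i k x * f (x, X i k)) \<partial>Q))" ..
  then have g[measurable]: "\<And>i k. i < N \<Longrightarrow> g i k \<in> borel_measurable (Rd d)"
    and int_g: "\<And>i f. i < N \<Longrightarrow> f \<in> borel_measurable (Rd d \<Otimes>\<^sub>M Rd d) \<Longrightarrow>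
      (\<integral>\<^sup>+ z. f z \<partial>\<pi> i) = (\<integral>\<^sup>+ x. (\<Sum>k<len i. g i k x * f (x, X i k)) \<partial>Q)" by blast+
  have \<pi>': "sets (\<pi> i) = sets (Rd d \<Otimes>\<^sub>M Rd d)" "distr (\<pi> i) (Rd d) fst = Q" "distr (\<pi> i) (Rd d) snd = P i"
    if "i < N" for i using \<pi>[OF that] by (auto simp: couplings_def)
  have sum_g: "AE x in Q. (\<Sum>k<len i. g i k x) = 1" if i: "i < N" for i
  proof (rule Q.density_unique_finite_measure)
    fix A assume A: "A \<in> sets Q"
    then have [measurable]: "A \<in> sets (Rd d)" using Q(1) by simp
    have "(\<integral>\<^sup>+ x. (\<Sum>k<len i. g i k x) * indicator A x \<partial>Q) = (\<integral>\<^sup>+ z. indicator A (fst z) \<partial>\<pi> i)"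
      by (subst int_g[OF i]) (auto simp: sum_distrib_right)
    also have "\<dots> = (\<integral>\<^sup>+ x. indicator A x \<partial>distr (\<pi> i) (Rd d) fst)"
      by (subst nn_integral_distr) (auto simp: measurable_cong_sets[OF \<pi>'(1)[OF i] refl])
    also have "\<dots> = (\<integral>\<^sup>+ x. 1 * indicator A x \<partial>Q)" by (simp add: \<pi>'(2)[OF i])
    finally show "(\<integral>\<^sup>+ x. (\<Sum>k<len i. g i k x) * indicator A x \<partial>Q) = (\<integral>\<^sup>+ x. 1 * indicator A x \<partial>Q)" .
  qed (use i in auto)
  have int_gk: "(\<integral>\<^sup>+ x. g i k x \<partial>Q) = ennreal (D i k)" if ik: "i < N" "k < len i" for i k
  proof -
    have [measurable]: "{X i k} \<in> sets (Rd d)" using ik X by (intro singleton_Rd) auto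
    have "ennreal (D i k) = (\<integral>\<^sup>+ y. indicator {X i k} y \<partial>distr (\<pi> i) (Rd d) snd)"
      unfolding \<pi>'(3)[OF ik(1)] emeasure_P_singleton[OF ik, symmetric]
      by (intro nn_integral_indicator[symmetric]) (simp add: P_def)
    also have "\<dots> = (\<integral>\<^sup>+ z. indicator {X i k} (snd z) \<partial>\<pi> i)"
      by (subst nn_integral_distr) (auto simp: measurable_cong_sets[OF \<pi>'(1)[OF ik(1)] refl])
    also have "\<dots> = (\<integral>\<^sup>+ x. (\<Sum>k'<len i. g i k' x * indicator {X i k} (X i k')) \<partial>Q)"
      by (subst int_g[OF ik(1)]) auto
    also have "\<dots> = (\<integral>\<^sup>+ x. g i k x \<partial>Q)"
    proof (rule nn_integral_cong)
      fix x
      have "(\<Sum>k'<len i. g i k' x * indicator {X i k} (X i k')) = (\<Sum>k'<len i. if k' = k then g i k x else 0)"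
        using ik X_inj[OF ik(1)] by (intro sum.cong) (auto simp: indicator_def inj_on_def)
      then show "(\<Sum>k'<len i. g i k' x * indicator {X i k} (X i k')) = g i k x" using ik by simp
    qed
    finally show ?thesis ..
  qed
  define G where "G t x = (\<Prod>i<N. g i (t i) x)" for t x
  have G[measurable]: "G t \<in> borel_measurable (Rd d)" for t
    unfolding G_def by (intro borel_measurable_prod_ennreal) auto
  have marg: "AE x in Q. \<forall>i<N. (\<Sum>k<len i. g i k x) = 1"
    using sum_g by (simp add: AE_all_countable)
  \<comment> \<open>\<open>F\<close> is quantified inside the almost-everywhere statement because
    the costs inserted for it depend on \<open>x\<close>.\<close>
  have G_sum: "AE x in Q. \<forall>i<N. \<forall>F. (\<Sum>t\<in>tuples. G t x * F (t i)) = (\<Sum>k<len i. g i k x * F k)"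
    using marg
  proof eventually_elim
    case (elim x)
    show ?case
      unfolding G_def tuples_def using elim by (intro allI impI sum_PiE_marginal) auto
  qed
  define w where "w t = enn2real (\<integral>\<^sup>+ x. G t x \<partial>Q)" for t
  have marginal: "(\<Sum>t\<in>{t\<in>tuples. t i = k}. \<integral>\<^sup>+ x. G t x \<partial>Q) = ennreal (D i k)"
    if ik: "i < N" "k < len i" for i k
  proof -
    have "(\<Sum>t\<in>{t\<in>tuples. t i = k}. \<integral>\<^sup>+ x. G t x \<partial>Q) = (\<integral>\<^sup>+ x. (\<Sum>t\<in>{t\<in>tuples. t i = k}. G t x) \<partial>Q)"
      by (rule nn_integral_sum[symmetric]) auto
    also have "\<dots> = (\<integral>\<^sup>+ x. g i k x \<partial>Q)"
    proof (intro nn_integral_cong_AE, use G_sum in eventually_elim)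
      case (elim x)
      have "(\<Sum>t\<in>{t\<in>tuples. t i = k}. G t x) = (\<Sum>t\<in>tuples. G t x * (if t i = k then 1 else 0))"
        unfolding sum.inter_filter[OF finite_tuples] by (intro sum.cong) auto
      also have "\<dots> = (\<Sum>k'<len i. g i k' x * (if k' = k then 1 else 0))"
        by (rule elim[rule_format, OF ik(1)])
      also have "\<dots> = g i k x" using ik by (simp add: if_distrib[of "(*) _"] cong: if_cong)
      finally show ?case .
    qed
    finally show ?thesis using int_gk[OF ik] by simp
  qed
  \<comment> \<open>The integral is one summand of a marginal, hence finite, and
    \<open>enn2real\<close> loses nothing.\<close>
  have w: "ennreal (w t) = (\<integral>\<^sup>+ x. G t x \<partial>Q)" if t: "t \<in> tuples" for t
  proof -
    have "(\<integral>\<^sup>+ x. G t x \<partial>Q) \<le> (\<Sum>t'\<in>{t'\<in>tuples. t' 0 = t 0}. \<integral>\<^sup>+ x. G t' x \<partial>Q)"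
      using t by (intro member_le_sum) auto
    also have "\<dots> < \<infinity>" using marginal[of 0 "t 0"] N_pos tuple_lt[OF t] by simp
    finally show ?thesis unfolding w_def by (simp add: less_top)
  qed
  show thesis
  proof (rule that)
    show "multi_plan w"
      unfolding multi_plan_def
    proof (intro conjI ballI allI impI)
      fix i k assume ik: "i < N" "k < len i"
      have "ennreal (\<Sum>t\<in>{t\<in>tuples. t i = k}. w t) = (\<Sum>t\<in>{t\<in>tuples. t i = k}. ennreal (w t))"
        by (intro sum_ennreal[symmetric]) (simp add: w_def)
      also have "\<dots> = ennreal (D i k)" using marginal[OF ik] w by simp
      finally show "(\<Sum>t\<in>{t\<in>tuples. t i = k}. w t) = D i k"
        using D(1)[OF ik] by (subst (asm) ennreal_inj) (auto intro: sum_nonneg simp: w_def)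
    qed (simp add: w_def)
    define F where "F i x k = ennreal ((edist d x (X i k))\<^sup>2)" for i x k
    have F[measurable]: "(\<lambda>x. F i x k) \<in> borel_measurable (Rd d)" for i k unfolding F_def by measurable
    have "ennreal (multi_cost w) = (\<Sum>t\<in>tuples. ennreal (w t) * ennreal (tuple_cost t (mean t)))"
      unfolding multi_cost_def
      by (subst sum_ennreal[symmetric]) (auto simp: ennreal_mult' w_def tuple_cost_nonneg)
    also have "\<dots> = (\<Sum>t\<in>tuples. \<integral>\<^sup>+ x. G t x * ennreal (tuple_cost t (mean t)) \<partial>Q)"
      using w by (intro sum.cong refl) (auto simp: nn_integral_multc)
    also have "\<dots> \<le> (\<Sum>t\<in>tuples. \<integral>\<^sup>+ x. G t x * (\<Sum>i<N. ennreal (lam i) * F i x (t i)) \<partial>Q)"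
    proof (intro sum_mono nn_integral_mono mult_left_mono)
      fix t x
      have "ennreal (tuple_cost t (mean t)) \<le> ennreal (tuple_cost t x)"
        unfolding tuple_cost_variance[of t x] by (intro ennreal_leI) simp
      also have "\<dots> = (\<Sum>i<N. ennreal (lam i) * F i x (t i))"
        unfolding tuple_cost_def F_def using lam(1)
        by (subst sum_ennreal[symmetric]) (auto simp: ennreal_mult' less_imp_le intro!: mult_nonneg_nonneg)
      finally show "ennreal (tuple_cost t (mean t)) \<le> (\<Sum>i<N. ennreal (lam i) * F i x (t i))" .
    qed simp
    also have "\<dots> = (\<integral>\<^sup>+ x. (\<Sum>t\<in>tuples. G t x * (\<Sum>i<N. ennreal (lam i) * F i x (t i))) \<partial>Q)"
      by (rule nn_integral_sum[symmetric]) auto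
    also have "\<dots> = (\<integral>\<^sup>+ x. (\<Sum>i<N. ennreal (lam i) * (\<Sum>k<len i. g i k x * F i x k)) \<partial>Q)"
    proof (intro nn_integral_cong_AE, use G_sum in eventually_elim)
      case (elim x)
      have "(\<Sum>t\<in>tuples. G t x * (\<Sum>i<N. ennreal (lam i) * F i x (t i))) =
          (\<Sum>i<N. ennreal (lam i) * (\<Sum>t\<in>tuples. G t x * F i x (t i)))"
        unfolding sum_distrib_left by (subst sum.swap) (simp add: mult_ac)
      also have "\<dots> = (\<Sum>i<N. ennreal (lam i) * (\<Sum>k<len i. g i k x * F i x k))"
        using elim[rule_format, of _ "F _ x"] by (intro sum.cong refl arg_cong2[where f = "(*)"]) auto
      finally show ?case .
    qed
    also have "\<dots> = (\<Sum>i<N. ennreal (lam i) * (\<integral>\<^sup>+ x. (\<Sum>k<len i. g i k x * F i x k) \<partial>Q))"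
      by (subst nn_integral_sum) (auto simp: nn_integral_cmult intro!: sum.cong)
    also have "\<dots> = (\<Sum>i<N. ennreal (lam i) * (\<integral>\<^sup>+ z. ennreal ((edist d (fst z) (snd z))\<^sup>2) \<partial>\<pi> i))"
      by (intro sum.cong refl, subst int_g) (auto simp: F_def)
    finally show "ennreal (multi_cost w) \<le>
      (\<Sum>i<N. ennreal (lam i) * (\<integral>\<^sup>+ z. ennreal ((edist d (fst z) (snd z))\<^sup>2) \<partial>\<pi> i))" .
  qed
qed


lemma product_coupling:
  assumes Q: "sets Q = sets (Rd d)" "emeasure Q (space Q) = 1" and i: "i < N"
  shows "Q \<Otimes>\<^sub>M P i \<in> couplings d Q (P i)"
proof -
  have P: "sets (P i) = sets (Rd d)" "emeasure (P i) (space (P i)) = 1"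
  proof -
    have "{k \<in> {..<len i}. X i k \<in> space (Rd d)} = {..<len i}" using X i by auto
    then show "emeasure (P i) (space (P i)) = 1"
      using i X D unfolding P_def
      by (simp, subst emeasure_fin_law) (auto intro: less_imp_le)
  qed (simp add: P_def)
  interpret Q: finite_measure Q using Q(2) by (intro finite_measureI) simp
  interpret Pi: finite_measure "P i" using P(2) by (intro finite_measureI) simp
  note Q(1)[measurable_cong] P(1)[measurable_cong]
  have sp: "space Q = space (Rd d)" "space (P i) = space (Rd d)"
    using Q(1) P(1) by (auto dest: sets_eq_imp_space_eq)
  have sets: "sets (Q \<Otimes>\<^sub>M P i) = sets (Rd d \<Otimes>\<^sub>M Rd d)"
    using Q(1) P(1) by (rule sets_pair_measure_cong)
  have "distr (Q \<Otimes>\<^sub>M P i) (Rd d) fst = Q"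
  proof (rule measure_eqI)
    fix A assume "A \<in> sets (distr (Q \<Otimes>\<^sub>M P i) (Rd d) fst)"
    then have A: "A \<in> sets Q" "A \<in> sets (Rd d)" using Q by auto
    have "fst -` A \<inter> space (Q \<Otimes>\<^sub>M P i) = A \<times> space (P i)"
      using sets.sets_into_space[OF A(1)] by (auto simp: space_pair_measure)
    then have "emeasure (distr (Q \<Otimes>\<^sub>M P i) (Rd d) fst) A = emeasure (Q \<Otimes>\<^sub>M P i) (A \<times> space (P i))"
      using A by (subst emeasure_distr) auto
    then show "emeasure (distr (Q \<Otimes>\<^sub>M P i) (Rd d) fst) A = emeasure Q A"
      using Pi.emeasure_pair_measure_Times[OF A(1) sets.top[of "P i"]] P(2) by simp
  qed (use Q in simp)
  moreover have "distr (Q \<Otimes>\<^sub>M P i) (Rd d) snd = P i"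
  proof (rule measure_eqI)
    fix A assume "A \<in> sets (distr (Q \<Otimes>\<^sub>M P i) (Rd d) snd)"
    then have A: "A \<in> sets (P i)" "A \<in> sets (Rd d)" using P by auto
    have "snd -` A \<inter> space (Q \<Otimes>\<^sub>M P i) = space Q \<times> A"
      using sets.sets_into_space[OF A(1)] by (auto simp: space_pair_measure)
    then have "emeasure (distr (Q \<Otimes>\<^sub>M P i) (Rd d) snd) A = emeasure (Q \<Otimes>\<^sub>M P i) (space Q \<times> A)"
      using A by (subst emeasure_distr) auto
    then show "emeasure (distr (Q \<Otimes>\<^sub>M P i) (Rd d) snd) A = emeasure (P i) A"
      by (simp only: Pi.emeasure_pair_measure_Times[OF sets.top A(1)] Q(2) mult_1_left)
  qed (use P in simp)
  ultimately show ?thesis using sets by (simp add: couplings_def)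
qed

lemma measurable_L2_set [measurable]: "(\<lambda>x. (L2_set x {..<d})\<^sup>2) \<in> borel_measurable (Rd d)"
  unfolding L2_set_def Rd_def by measurable

lemma second_moment_fin_law:
  assumes "finite A" "f \<in> A \<rightarrow> space (Rd d)"
  shows "(\<integral>\<^sup>+ x. ennreal ((L2_set x {..<d})\<^sup>2) \<partial>fin_law d A w f) < \<infinity>"
  using assms by (subst nn_integral_fin_law) (auto simp: ennreal_mult_less_top)

text \<open>The second moments bound the cost of the independent coupling. Thus
  \<open>enn2real\<close> in \<open>W2\<close> never turns an infinite value into 0.\<close>

lemma transport_value_finite:
  assumes Q: "Q \<in> P2 d" and i: "i < N"
  shows "(INF \<pi>\<in>couplings d Q (P i). \<integral>\<^sup>+ z. ennreal ((edist d (fst z) (snd z))\<^sup>2) \<partial>\<pi>) < \<infinity>"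
proof -
  define \<pi> where "\<pi> = Q \<Otimes>\<^sub>M P i"
  have \<pi>: "\<pi> \<in> couplings d Q (P i)"
    unfolding \<pi>_def by (rule product_coupling) (use Q i in \<open>auto simp: P2_def\<close>)
  then have sets_\<pi>[measurable_cong]: "sets \<pi> = sets (Rd d \<Otimes>\<^sub>M Rd d)"
    and fst_\<pi>: "distr \<pi> (Rd d) fst = Q" and snd_\<pi>: "distr \<pi> (Rd d) snd = P i"
    by (auto simp: couplings_def)
  have le: "(edist d x y)\<^sup>2 \<le> 2 * (L2_set x {..<d})\<^sup>2 + 2 * (L2_set y {..<d})\<^sup>2" for x y
  proof -
    have "(x c - y c)\<^sup>2 \<le> 2 * (x c)\<^sup>2 + 2 * (y c)\<^sup>2" for c
      using sum_squares_ge_zero[of "x c + y c" 0] by (simp add: power2_eq_square algebra_simps)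
    then have "(\<Sum>c<d. (x c - y c)\<^sup>2) \<le> (\<Sum>c<d. 2 * (x c)\<^sup>2 + 2 * (y c)\<^sup>2)" by (intro sum_mono)
    then show ?thesis
      by (simp add: edist_sq L2_set_def sum_nonneg sum.distrib sum_distrib_left)
  qed
  have "(\<integral>\<^sup>+ z. ennreal ((edist d (fst z) (snd z))\<^sup>2) \<partial>\<pi>) \<le>
      (\<integral>\<^sup>+ z. 2 * ennreal ((L2_set (fst z) {..<d})\<^sup>2) + 2 * ennreal ((L2_set (snd z) {..<d})\<^sup>2) \<partial>\<pi>)"
  proof (intro nn_integral_mono)
    fix z
    show "ennreal ((edist d (fst z) (snd z))\<^sup>2) \<le>
      2 * ennreal ((L2_set (fst z) {..<d})\<^sup>2) + 2 * ennreal ((L2_set (snd z) {..<d})\<^sup>2)"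
      using ennreal_leI[OF le[of "fst z" "snd z"]] by (simp add: ennreal_mult')
  qed
  also have "\<dots> = 2 * (\<integral>\<^sup>+ z. ennreal ((L2_set (fst z) {..<d})\<^sup>2) \<partial>\<pi>) +
      2 * (\<integral>\<^sup>+ z. ennreal ((L2_set (snd z) {..<d})\<^sup>2) \<partial>\<pi>)"
    by (subst nn_integral_add) (auto simp: nn_integral_cmult)
  also have "(\<integral>\<^sup>+ z. ennreal ((L2_set (fst z) {..<d})\<^sup>2) \<partial>\<pi>) = (\<integral>\<^sup>+ x. ennreal ((L2_set x {..<d})\<^sup>2) \<partial>Q)"
    unfolding fst_\<pi>[symmetric] by (subst nn_integral_distr) auto
  also have "(\<integral>\<^sup>+ z. ennreal ((L2_set (snd z) {..<d})\<^sup>2) \<partial>\<pi>) = (\<integral>\<^sup>+ x. ennreal ((L2_set x {..<d})\<^sup>2) \<partial>P i)"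
    unfolding snd_\<pi>[symmetric] by (subst nn_integral_distr) auto
  also have "2 * (\<integral>\<^sup>+ x. ennreal ((L2_set x {..<d})\<^sup>2) \<partial>Q) +
      2 * (\<integral>\<^sup>+ x. ennreal ((L2_set x {..<d})\<^sup>2) \<partial>P i) < \<infinity>"
    using Q X i second_moment_fin_law[of "{..<len i}" "X i" "D i"]
    by (auto simp: P2_def P_def ennreal_mult_less_top)
  finally show ?thesis using INF_lower[OF \<pi>] by (rule le_less_trans[rotated])
qed

text \<open>Nearly optimal couplings are taken, so existence of optimal ones is not an issue. The
  slack \<eta> is the same for all measures and survives averaging because the weights sum to
  1.\<close>

lemma objective_lower:
  assumes Q: "Q \<in> P2 d" and "0 < \<eta>"
  obtains w where "multi_plan w" "multi_cost w \<le> objective Q + \<eta>"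
proof -
  define cost where "cost \<pi> = (\<integral>\<^sup>+ z. ennreal ((edist d (fst z) (snd z))\<^sup>2) \<partial>\<pi>)" for \<pi>
  have "\<exists>\<pi>\<in>couplings d Q (P i). cost \<pi> \<le> ennreal ((W2 d Q (P i))\<^sup>2 + \<eta>)" if "i < N" for i
  proof -
    let ?v = "INF \<pi>\<in>couplings d Q (P i). cost \<pi>"
    have fin: "?v < \<infinity>" using transport_value_finite[OF Q that] by (simp add: cost_def)
    have "ennreal ((W2 d Q (P i))\<^sup>2) = ?v"
      unfolding W2_sq cost_def[symmetric] using fin by (simp add: less_top)
    moreover have "v < v + ennreal \<eta>" if "v < \<infinity>" for v
      using that \<open>0 < \<eta>\<close>
      by (cases v) (auto simp: ennreal_plus[symmetric] ennreal_less_iff simp del: ennreal_plus)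
    from this[OF fin] obtain \<pi> where "\<pi> \<in> couplings d Q (P i)" "cost \<pi> < ?v + ennreal \<eta>"
      unfolding INF_less_iff by blast
    ultimately show ?thesis using \<open>0 < \<eta>\<close> by (auto intro!: bexI[of _ \<pi>] simp: ennreal_plus)
  qed
  then obtain \<pi> where \<pi>: "\<And>i. i < N \<Longrightarrow> \<pi> i \<in> couplings d Q (P i)"
    "\<And>i. i < N \<Longrightarrow> cost (\<pi> i) \<le> ennreal ((W2 d Q (P i))\<^sup>2 + \<eta>)" by metis
  obtain w where w: "multi_plan w" "ennreal (multi_cost w) \<le> (\<Sum>i<N. ennreal (lam i) * cost (\<pi> i))"
    unfolding cost_def by (rule couplings_multi_plan[of Q \<pi>]) (use Q \<pi>(1) in \<open>auto simp: P2_def\<close>)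
  note w(2)
  also have "(\<Sum>i<N. ennreal (lam i) * cost (\<pi> i)) \<le> (\<Sum>i<N. ennreal (lam i) * ennreal ((W2 d Q (P i))\<^sup>2 + \<eta>))"
    using \<pi>(2) by (intro sum_mono mult_left_mono) auto
  also have "\<dots> = (\<Sum>i<N. ennreal (lam i * ((W2 d Q (P i))\<^sup>2 + \<eta>)))"
    using lam(1) by (intro sum.cong refl ennreal_mult'[symmetric]) (auto intro: less_imp_le)
  also have "\<dots> = ennreal (\<Sum>i<N. lam i * ((W2 d Q (P i))\<^sup>2 + \<eta>))"
    using lam(1) \<open>0 < \<eta>\<close> by (intro sum_ennreal mult_nonneg_nonneg add_nonneg_nonneg) (auto intro: less_imp_le)
  also have "(\<Sum>i<N. lam i * ((W2 d Q (P i))\<^sup>2 + \<eta>)) = objective Q + \<eta>"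
    unfolding objective_def distrib_left sum.distrib sum_distrib_right[symmetric] lam(2) by simp
  finally have "multi_cost w \<le> objective Q + \<eta>"
  proof (rule ennreal_le_iff[THEN iffD1, rotated])
    show "0 \<le> objective Q + \<eta>"
      unfolding objective_def using lam(1) \<open>0 < \<eta>\<close>
      by (intro add_nonneg_nonneg sum_nonneg mult_nonneg_nonneg) (auto intro: less_imp_le)
  qed
  with w(1) show thesis by (rule that)
qed

text \<open>The minimizer is the law of the means under an optimal multi-marginal plan: its
  objective is at most the cost of the plan, and by \<open>objective_lower\<close> with vanishing
  slack no measure is cheaper than the plan.\<close>

theorem barycenter_exists:
  obtains Q w where "Q \<in> P2 d" "\<And>Q'. Q' \<in> P2 d \<Longrightarrow> objective Q \<le> objective Q'"
    "multi_plan w" "multi_cost w \<le> objective Q"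
proof -
  obtain w where w: "multi_plan w" "\<And>w'. multi_plan w' \<Longrightarrow> multi_cost w \<le> multi_cost w'"
    using multi_plan_minimizer by blast
  have low: "multi_cost w \<le> objective Q'" if Q': "Q' \<in> P2 d" for Q'
  proof (rule field_le_epsilon)
    fix \<eta> :: real assume "0 < \<eta>"
    then obtain w' where "multi_plan w'" "multi_cost w' \<le> objective Q' + \<eta>"
      using objective_lower[OF Q'] by blast
    then show "multi_cost w \<le> objective Q' + \<eta>" using w(2)[of w'] by simp
  qed
  let ?Q = "fin_law d tuples w mean"
  have "?Q \<in> P2 d"
  proof -
    have "{t \<in> tuples. mean t \<in> space (Rd d)} = tuples" using mean_space by auto
    then have "emeasure ?Q (space ?Q) = 1"
      using mean_space w(1) multi_plan_total[OF w(1)]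
      by (simp, subst emeasure_fin_law) (auto simp: multi_plan_def)
    then show ?thesis
      using second_moment_fin_law[of tuples mean w] mean_space by (simp add: P2_def)
  qed
  then show thesis
    using that[of ?Q w] low objective_mean_le[OF w(1)] w(1) by (meson order_trans)
qed

section \<open>The factor 2 and the move towards the means\<close>

lemma edist_commute: "edist d x y = edist d y x"
  by (simp add: edist_def power2_commute L2_set_def)

text \<open>Steiner's identity is averaged over the points of the tuple itself; both of its summands
  then yield the cost at the mean.\<close>

lemma tuple_pairs:
  "(\<Sum>i<N. \<Sum>j<N. lam i * lam j * (edist d (X i (t i)) (X j (t j)))\<^sup>2) = 2 * tuple_cost t (mean t)"
proof -
  have "(\<Sum>i<N. \<Sum>j<N. lam i * lam j * (edist d (X i (t i)) (X j (t j)))\<^sup>2) =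
      (\<Sum>i<N. lam i * tuple_cost t (X i (t i)))"
    by (simp add: tuple_cost_def sum_distrib_left mult_ac)
  also have "\<dots> = (\<Sum>i<N. lam i * tuple_cost t (mean t)) + (\<Sum>i<N. lam i * (edist d (mean t) (X i (t i)))\<^sup>2)"
    unfolding tuple_cost_variance[of t "X _ (t _)"] distrib_left sum.distrib by (simp add: edist_commute)
  also have "\<dots> = 2 * tuple_cost t (mean t)"
    unfolding sum_distrib_right[symmetric] lam(2) by (simp add: tuple_cost_def)
  finally show ?thesis .
qed

text \<open>The two-dimensional marginals of a multi-marginal plan are transport plans, so their
  costs dominate \<open>C i j\<close>; the double sum is then evaluated tuple by tuple.\<close>

lemma multi_plan_pairs:
  assumes w: "multi_plan w"
    and opt: "\<And>i j y. i < N \<Longrightarrow> j < N \<Longrightarrow> plan (len i) (len j) (D i) (D j) y \<Longrightarrow>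
      C i j \<le> (\<Sum>k<len i. \<Sum>l<len j. (edist d (X i k) (X j l))\<^sup>2 * y k l)"
  shows "(\<Sum>i<N. \<Sum>j<N. lam i * lam j * C i j) \<le> 2 * multi_cost w"
proof -
  have le: "C i j \<le> (\<Sum>t\<in>tuples. w t * (edist d (X i (t i)) (X j (t j)))\<^sup>2)" if ij: "i < N" "j < N" for i j
  proof -
    define y where "y k l = (\<Sum>t\<in>{t\<in>tuples. t i = k \<and> t j = l}. w t)" for k l
    have row: "(\<Sum>l<len j. \<Sum>t\<in>{t\<in>{t\<in>tuples. t i = k}. t j = l}. F t) = (\<Sum>t\<in>{t\<in>tuples. t i = k}. F t)"
      for k and F :: "(nat \<Rightarrow> nat) \<Rightarrow> real"
      by (rule sum.group) (use tuple_lt ij in auto)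
    have col: "(\<Sum>k<len i. \<Sum>t\<in>{t\<in>{t\<in>tuples. t j = l}. t i = k}. F t) = (\<Sum>t\<in>{t\<in>tuples. t j = l}. F t)"
      for l and F :: "(nat \<Rightarrow> nat) \<Rightarrow> real"
      by (rule sum.group) (use tuple_lt ij in auto)
    have all: "(\<Sum>k<len i. \<Sum>t\<in>{t\<in>tuples. t i = k}. F t) = (\<Sum>t\<in>tuples. F t)"
      for F :: "(nat \<Rightarrow> nat) \<Rightarrow> real"
      by (rule sum.group) (use tuple_lt ij in auto)
    have e1: "{t\<in>tuples. t i = k \<and> t j = l} = {t\<in>{t\<in>tuples. t i = k}. t j = l}"
      and e2: "{t\<in>tuples. t i = k \<and> t j = l} = {t\<in>{t\<in>tuples. t j = l}. t i = k}" for k l by auto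
    have "plan (len i) (len j) (D i) (D j) y"
      unfolding plan_def
    proof (intro conjI allI impI)
      fix k l
      show "0 \<le> y k l" using w by (auto simp: y_def multi_plan_def intro!: sum_nonneg)
      show "k < len i \<Longrightarrow> (\<Sum>l<len j. y k l) = D i k"
        unfolding y_def e1 row using w ij by (simp add: multi_plan_def)
      show "l < len j \<Longrightarrow> (\<Sum>k<len i. y k l) = D j l"
        unfolding y_def e2 col using w ij by (simp add: multi_plan_def)
    qed
    from opt[OF ij this]
    have "C i j \<le> (\<Sum>k<len i. \<Sum>l<len j. (edist d (X i k) (X j l))\<^sup>2 * y k l)" .
    also have "\<dots> = (\<Sum>k<len i. \<Sum>l<len j. \<Sum>t\<in>{t\<in>{t\<in>tuples. t i = k}. t j = l}.
        w t * (edist d (X i (t i)) (X j (t j)))\<^sup>2)"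
      unfolding y_def e1 sum_distrib_left by (intro sum.cong refl) auto
    also have "\<dots> = (\<Sum>t\<in>tuples. w t * (edist d (X i (t i)) (X j (t j)))\<^sup>2)"
      unfolding row all ..
    finally show ?thesis .
  qed
  have "(\<Sum>i<N. \<Sum>j<N. lam i * lam j * C i j) \<le>
      (\<Sum>i<N. \<Sum>j<N. lam i * lam j * (\<Sum>t\<in>tuples. w t * (edist d (X i (t i)) (X j (t j)))\<^sup>2))"
    using le lam(1) by (intro sum_mono mult_left_mono) (auto intro!: mult_nonneg_nonneg less_imp_le)
  also have "\<dots> = (\<Sum>i<N. \<Sum>j<N. \<Sum>t\<in>tuples. w t * (lam i * lam j * (edist d (X i (t i)) (X j (t j)))\<^sup>2))"
    by (simp add: sum_distrib_left mult_ac)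
  also have "\<dots> = (\<Sum>i<N. \<Sum>t\<in>tuples. \<Sum>j<N. w t * (lam i * lam j * (edist d (X i (t i)) (X j (t j)))\<^sup>2))"
    by (intro sum.cong refl sum.swap)
  also have "\<dots> = (\<Sum>t\<in>tuples. \<Sum>i<N. \<Sum>j<N. w t * (lam i * lam j * (edist d (X i (t i)) (X j (t j)))\<^sup>2))"
    by (rule sum.swap)
  also have "\<dots> = (\<Sum>t\<in>tuples. w t * (2 * tuple_cost t (mean t)))"
    unfolding tuple_pairs[symmetric] by (simp add: sum_distrib_left)
  also have "\<dots> = 2 * multi_cost w" by (simp add: multi_cost_def sum_distrib_left mult_ac)
  finally show ?thesis .
qed

text \<open>By Steiner's identity only the squared distance to the mean varies with the point, and
  it is multiplied by \<open>(1 - s)\<^sup>2\<close>.\<close>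

lemma tuple_cost_towards_mean:
  assumes "0 \<le> s" "s \<le> 1"
  shows "tuple_cost t (\<lambda>c\<in>{..<d}. x c + s * (mean t c - x c)) \<le> tuple_cost t x"
proof -
  have "(edist d (\<lambda>c\<in>{..<d}. x c + s * (mean t c - x c)) (mean t))\<^sup>2 = (1 - s)\<^sup>2 * (edist d x (mean t))\<^sup>2"
    unfolding edist_sq sum_distrib_left
    by (intro sum.cong) (auto simp: power2_eq_square algebra_simps)
  also have "\<dots> \<le> 1 * (edist d x (mean t))\<^sup>2"
    using assms by (intro mult_right_mono) (auto simp: power_le_one)
  finally show ?thesis unfolding tuple_cost_variance[of t x]
    by (subst tuple_cost_variance) simp
qed

end

section \<open>Addresses of pairs and recurring loop patterns\<close>

definition enc :: "nat \<Rightarrow> nat \<Rightarrow> nat" where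
  "enc a b = (a + b) * (a + b) + a"

text \<open>Address expressions have no division, so a sparser pairing takes the place of Cantor's.
  Adding \<open>a\<close> to the square of \<open>a + b\<close> never reaches the next square, hence
  the sum and then both components can be recovered.\<close>

lemma enc_eq_iff [simp]: "enc a b = enc c d \<longleftrightarrow> a = c \<and> b = d"
proof
  have lt: "enc a b < enc c d" if "a + b < c + d" for a b c d
  proof -
    have "enc a b < (a + b + 1) * (a + b + 1)" by (simp add: enc_def)
    also have "\<dots> \<le> (c + d) * (c + d)" using that by (intro mult_mono) auto
    finally show ?thesis by (simp add: enc_def)
  qed
  assume e: "enc a b = enc c d"
  then have "a + b = c + d" using lt[of a b c d] lt[of c d a b] by linarith
  moreover from this have "a = c" using e by (simp add: enc_def)
  ultimately show "a = c \<and> b = d" by simp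
qed simp

definition encE :: "nexp \<Rightarrow> nexp \<Rightarrow> nexp" where
  "encE e f = NAdd (NMul (NAdd e f) (NAdd e f)) e"

lemma nval_encE [simp]: "nval s (encE e f) = enc (nval s e) (nval s f)"
  by (simp add: encE_def enc_def)

lemma nset_nset [simp]: "nset (nset s a i x) a i y = nset s a i y"
  and rset_rset [simp]: "rset (rset s a i p) a i q = rset s a i q"
  and rset_nset: "rset (nset s b j x) a i p = nset (rset s a i p) b j x"
  by (simp_all add: nset_def rset_def)

lemma nset_commute: "a \<noteq> b \<Longrightarrow> nset (nset s a i x) b j y = nset (nset s b j y) a i x"
  by (simp add: nset_def fun_upd_twist)

lemma ev_for_frame:
  assumes "P 0 s"
    and "\<And>k s'. k < nval s e \<Longrightarrow> (\<And>a. a \<noteq> v \<Longrightarrow> a \<notin> nwrites p \<Longrightarrow> nats s' a = nats s a) \<Longrightarrow>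
      (\<And>a. a \<notin> rwrites p \<Longrightarrow> rats s' a = rats s a) \<Longrightarrow> P k s' \<Longrightarrow> P (Suc k) (ev p (nset s' v 0 k))"
    and "\<And>s'. (\<And>a. a \<noteq> v \<Longrightarrow> a \<notin> nwrites p \<Longrightarrow> nats s' a = nats s a) \<Longrightarrow>
      (\<And>a. a \<notin> rwrites p \<Longrightarrow> rats s' a = rats s a) \<Longrightarrow> P (nval s e) s' \<Longrightarrow> Q (nset s' v 0 (nval s e))"
  shows "Q (ev (PFor v e p) s)"
proof (rule ev_for_rule[where I = "\<lambda>k s'. (\<forall>a. a \<noteq> v \<longrightarrow> a \<notin> nwrites p \<longrightarrow> nats s' a = nats s a) \<and>
    (\<forall>a. a \<notin> rwrites p \<longrightarrow> rats s' a = rats s a) \<and> P k s'"], goal_cases)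
  case (2 k s')
  then show ?case using assms(2)[of k s'] nats_ev[of _ p "nset s' v 0 k"] rats_ev[of _ p "nset s' v 0 k"]
    by simp
qed (use assms(1,3) in auto)

text \<open>States are compared only after the counter has been set, as this is the one cell in
  which they may differ during the loop.\<close>

lemma ev_for_rat_cell:
  assumes "\<And>x q. x < nval s e \<Longrightarrow> ev p (nset (rset s a i q) v 0 x) = nset (rset s a i (F x q)) v 0 x"
  shows "ev (PFor v e p) s = nset (rset s a i (fold F [0..<nval s e] (rats s a i))) v 0 (nval s e)"
proof (rule ev_for_rule[where I = "\<lambda>k s'. \<forall>x. nset s' v 0 x = nset (rset s a i (fold F [0..<k] (rats s a i))) v 0 x"],
    goal_cases)
  case 1
  then show ?case by (simp add: rset_def)
next
  case (2 k s')
  then show ?case using assms[of k] by simp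
next
  case (3 s')
  then show ?case by simp
qed

lemma ev_for_argmin:
  assumes "v \<noteq> a" and "\<And>x c. x < nval s e \<Longrightarrow> nval (nset (nset s a i c) v 0 x) ie = i"
    and "\<And>x c. x < nval s e \<Longrightarrow> bval (nset (nset s a i c) v 0 x) b = R x c"
  shows "ev (PFor v e (PIf b (PNSet a ie (nvar v)) PSkip)) s =
    nset (nset s a i (fold (\<lambda>x c. if R x c then x else c) [0..<nval s e] (nats s a i))) v 0 (nval s e)"
proof (rule ev_for_rule[where I = "\<lambda>k s'. \<forall>x. nset s' v 0 x =
    nset (nset s a i (fold (\<lambda>x c. if R x c then x else c) [0..<k] (nats s a i))) v 0 x"], goal_cases)
  case 1
  then show ?case by (simp add: nset_same)
next
  case (2 k s')
  then show ?case using assms by (simp add: nset_commute[of v a])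
next
  case (3 s')
  then show ?case by simp
qed

text \<open>The start value 0 may violate \<open>ok\<close>, so the first admissible index replaces
  it unconditionally. Since \<open>less\<close> need not be total, the result is minimal rather than
  least.\<close>

lemma fold_argmin:
  fixes less :: "nat \<Rightarrow> nat \<Rightarrow> bool"
  assumes irrefl: "\<And>x. \<not> less x x" and trans: "\<And>x y z. less x y \<Longrightarrow> less y z \<Longrightarrow> less x z"
    and "r = fold (\<lambda>x c. if ok x \<and> (ok c \<longrightarrow> less x c) then x else c) [0..<n] 0" "0 < n"
  shows "r < n" and "\<And>x. x < n \<Longrightarrow> ok x \<Longrightarrow> ok r \<and> \<not> less x r"
proof -
  define f where "f k = fold (\<lambda>x c. if ok x \<and> (ok c \<longrightarrow> less x c) then x else c) [0..<k] 0" for k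
  have "(f k = 0 \<or> f k < k) \<and> (\<forall>x<k. ok x \<longrightarrow> ok (f k) \<and> \<not> less x (f k))" for k
  proof (induction k)
    case (Suc k)
    have f: "f (Suc k) = (if ok k \<and> (ok (f k) \<longrightarrow> less k (f k)) then k else f k)" by (auto simp: f_def)
    show ?case
    proof (cases "ok k \<and> (ok (f k) \<longrightarrow> less k (f k))")
      case True
      have "\<not> less x k" if "x < Suc k" "ok x" for x
        using that Suc True irrefl trans by (metis less_Suc_eq)
      then show ?thesis using f True by simp
    next
      case False
      then show ?thesis using f Suc by (auto simp: less_Suc_eq)
    qed
  qed (simp add: f_def)
  from this[of n] assms(3,4) show "r < n" and "\<And>x. x < n \<Longrightarrow> ok x \<Longrightarrow> ok r \<and> \<not> less x r"
    by (auto simp: f_def)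
qed

abbreviation numE :: nexp where "numE \<equiv> NGet 0 (NConst 0)"
abbreviation dimE :: nexp where "dimE \<equiv> NGet 0 (NConst 1)"
abbreviation lenE :: "nexp \<Rightarrow> nexp" where "lenE e \<equiv> NGet 0 (NAdd e (NConst 2))"

abbreviation get2 :: "nat \<Rightarrow> nexp \<Rightarrow> nexp \<Rightarrow> rexp" where "get2 a e f \<equiv> RGet a (encE e f)"
abbreviation nget2 :: "nat \<Rightarrow> nexp \<Rightarrow> nexp \<Rightarrow> nexp" where "nget2 a e f \<equiv> NGet a (encE e f)"
abbreviation get3 :: "nat \<Rightarrow> nexp \<Rightarrow> nexp \<Rightarrow> nexp \<Rightarrow> rexp" where "get3 a e f g \<equiv> RGet a (encE e (encE f g))"
abbreviation nget3 :: "nat \<Rightarrow> nexp \<Rightarrow> nexp \<Rightarrow> nexp \<Rightarrow> nexp" where "nget3 a e f g \<equiv> NGet a (encE e (encE f g))"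

section \<open>A cycle-cancelling step as a program\<close>

text \<open>
  The arrays of rationals 1, 2 and 3 hold the costs, the current plan and the minimum weights
  of walks with a given number of arcs (minus 1) and given ends; 4, 5 and 6 hold the least mean
  found, a counter and the amount to be pushed.  The arrays of naturals 2 and 3 hold the indices of
  the two measures, 12 the optimal columns of the arcs, 13 the last but one vertices of optimal walks,
  14 and 15 the length (minus 1) and end of the best closed walk, 16 its vertices.
\<close>

abbreviation rowsE :: nexp where "rowsE \<equiv> lenE (nvar 2)"
abbreviation colsE :: nexp where "colsE \<equiv> lenE (nvar 3)"

text \<open>The test is that of \<open>fold_argmin\<close>: the new column is admissible and, if the
  current one is admissible too, cheaper. The implication is expressed by \<open>BNot\<close> and
  \<open>BAnd\<close>.\<close>

definition arc_col :: prog where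
  "arc_col = PFor 5 colsE
    (PIf (BAnd (RLess (RConst 0) (get2 2 (nvar 9) (nvar 5)))
      (BNot (BAnd (RLess (RConst 0) (get2 2 (nvar 9) (nget2 12 (nvar 8) (nvar 9))))
        (BNot (RLess (RSub (get2 1 (nvar 8) (nvar 5)) (get2 1 (nvar 9) (nvar 5)))
          (RSub (get2 1 (nvar 8) (nget2 12 (nvar 8) (nvar 9)))
            (get2 1 (nvar 9) (nget2 12 (nvar 8) (nvar 9)))))))))
      (PNSet 12 (encE (nvar 8) (nvar 9)) (nvar 5)) PSkip)"

definition arc_weight :: prog where
  "arc_weight = PNSet 12 (encE (nvar 8) (nvar 9)) (NConst 0) ;; arc_col ;;
   PNSet 13 (encE (NConst 0) (encE (nvar 8) (nvar 9))) (nvar 8) ;;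
   PRSet 3 (encE (NConst 0) (encE (nvar 8) (nvar 9)))
     (RSub (get2 1 (nvar 8) (nget2 12 (nvar 8) (nvar 9)))
       (get2 1 (nvar 9) (nget2 12 (nvar 8) (nvar 9))))"

definition arc_weights :: prog where
  "arc_weights = PFor 8 rowsE (PFor 9 rowsE arc_weight)"

lemma writes_arc_col [simp]: "nwrites arc_col = {5, 12}" "rwrites arc_col = {}"
  by (auto simp: arc_col_def)

lemma writes_arc_weight [simp]: "nwrites arc_weight = {5, 12, 13}" "rwrites arc_weight = {3}"
  by (auto simp: arc_weight_def)

definition arc_ok :: "state \<Rightarrow> state \<Rightarrow> nat \<Rightarrow> nat \<Rightarrow> nat \<Rightarrow> bool" where
  "arc_ok s s' m u v \<longleftrightarrow> (let l0 = nats s' 12 (enc u v); y = \<lambda>k l. rats s 2 (enc k l); c = \<lambda>k l. rats s 1 (enc k l) in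
    l0 < m \<and> 0 < y v l0 \<and> (\<forall>l<m. 0 < y v l \<longrightarrow> c u l0 - c v l0 \<le> c u l - c v l) \<and>
    rats s' 3 (enc 0 (enc u v)) = c u l0 - c v l0 \<and> nats s' 13 (enc 0 (enc u v)) = u)"

lemma arc_weights_body:
  fixes s
  defines "m \<equiv> nval s colsE" and "u \<equiv> nats s 8 0" and "v \<equiv> nats s 9 0"
  defines "s' \<equiv> ev arc_weight s"
  assumes pos: "\<exists>l<m. 0 < rats s 2 (enc v l)"
  shows "arc_ok s s' m u v \<and>
    (\<forall>x z. (x, z) \<noteq> (u, v) \<longrightarrow> nats s' 12 (enc x z) = nats s 12 (enc x z) \<and>
      rats s' 3 (enc 0 (enc x z)) = rats s 3 (enc 0 (enc x z)) \<and>
      nats s' 13 (enc 0 (enc x z)) = nats s 13 (enc 0 (enc x z)))"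
proof -
  define y where "y l = rats s 2 (enc v l)" for l
  define key where "key l = rats s 1 (enc u l) - rats s 1 (enc v l)" for l
  define r where "r = fold (\<lambda>x c. if 0 < y x \<and> (0 < y c \<longrightarrow> key x < key c) then x else c) [0..<m] 0"
  let ?s0 = "nset s 12 (enc u v) 0"
  have "ev arc_col ?s0 = nset (nset ?s0 12 (enc u v) (fold (\<lambda>x c. if 0 < y x \<and> (0 < y c \<longrightarrow> key x < key c) then x else c)
      [0..<nval ?s0 colsE] (nats ?s0 12 (enc u v)))) 5 0 (nval ?s0 colsE)"
    unfolding arc_col_def by (rule ev_for_argmin) (auto simp: y_def key_def u_def v_def)
  then have e: "ev arc_col ?s0 = nset (nset s 12 (enc u v) r) 5 0 m" by (simp add: r_def m_def)
  have "0 < m" using pos by auto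
  note am = fold_argmin[of "\<lambda>x z. key x < key z" r "\<lambda>x. 0 < y x" m, OF _ _ r_def \<open>0 < m\<close>]
  have "r < m" "0 < y r" "\<And>l. l < m \<Longrightarrow> 0 < y l \<Longrightarrow> key r \<le> key l"
    using am pos by (auto simp: y_def not_less)
  then show ?thesis
    unfolding s'_def arc_weight_def arc_ok_def using e by (auto simp: u_def v_def y_def key_def Let_def)
qed

lemma arc_weights:
  assumes n: "nval s rowsE = n" and m: "nval s colsE = m"
    and pos: "\<And>v. v < n \<Longrightarrow> \<exists>l<m. 0 < rats s 2 (enc v l)"
  shows "\<forall>u<n. \<forall>v<n. arc_ok s (ev arc_weights s) m u v"
  unfolding arc_weights_def
proof (rule ev_for_frame[where P = "\<lambda>k s'. \<forall>u<k. \<forall>v<n. arc_ok s s' m u v"], goal_cases)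
  case (2 k s')
  have f: "nats s' a = nats s a" if "a \<notin> {5, 8, 9, 12, 13}" for a using 2(2)[of a] that by simp
  have g: "rats s' a = rats s a" if "a \<noteq> 3" for a using 2(3)[of a] that by simp
  have n': "nval s' rowsE = n" using f n by simp
  show ?case
  proof (rule ev_for_frame[where P = "\<lambda>j s'. (\<forall>u<k. \<forall>v<n. arc_ok s s' m u v) \<and> (\<forall>v<j. arc_ok s s' m k v) \<and> nats s' 8 0 = k"],
      goal_cases)
    case 1
    then show ?case using 2 by (simp add: arc_ok_def)
  next
    case (2 j t)
    have f': "nats t a = nats s a" if "a \<notin> {5, 8, 9, 12, 13}" for a using 2(2)[of a] f[of a] that by simp
    have g': "rats t a = rats s a" if "a \<noteq> 3" for a using 2(3)[of a] g[of a] that by simp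
    let ?t = "nset t 9 0 j"
    have t: "nval ?t colsE = m" "nats ?t 8 0 = k" "nats ?t 9 0 = j" using f' m 2(4) by auto
    have j: "j < n" using 2(1) n' by simp
    have "\<exists>l<nval ?t colsE. 0 < rats ?t 2 (enc (nats ?t 9 0) l)"
      unfolding t using pos[OF j] g' by simp
    from arc_weights_body[OF this] show ?case
      unfolding t using 2(4) j g' nats_ev[of 8 arc_weight ?t] by (auto simp: arc_ok_def Let_def less_Suc_eq)
  next
    case (3 t)
    then show ?case using n' by (auto simp: arc_ok_def less_Suc_eq)
  qed
qed (use n in \<open>simp_all add: arc_ok_def\<close>)


section \<open>Minimum weights of walks with a given number of arcs\<close>

lemma writes_arc_weights [simp]: "nwrites arc_weights = {5, 8, 9, 12, 13}" "rwrites arc_weights = {3}"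
  by (auto simp: arc_weights_def)

definition extend_col :: prog where
  "extend_col = PFor 10 rowsE
    (PIf (RLess (RAdd (get3 3 (nvar 11) (nvar 8) (nvar 10)) (get3 3 (NConst 0) (nvar 10) (nvar 9)))
        (RAdd (get3 3 (nvar 11) (nvar 8) (nget3 13 (NAdd (nvar 11) (NConst 1)) (nvar 8) (nvar 9)))
          (get3 3 (NConst 0) (nget3 13 (NAdd (nvar 11) (NConst 1)) (nvar 8) (nvar 9)) (nvar 9))))
      (PNSet 13 (encE (NAdd (nvar 11) (NConst 1)) (encE (nvar 8) (nvar 9))) (nvar 10)) PSkip)"

definition extend_walk :: prog where
  "extend_walk = PNSet 13 (encE (NAdd (nvar 11) (NConst 1)) (encE (nvar 8) (nvar 9))) (NConst 0) ;;
    extend_col ;;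
    PRSet 3 (encE (NAdd (nvar 11) (NConst 1)) (encE (nvar 8) (nvar 9)))
      (RAdd (get3 3 (nvar 11) (nvar 8) (nget3 13 (NAdd (nvar 11) (NConst 1)) (nvar 8) (nvar 9)))
        (get3 3 (NConst 0) (nget3 13 (NAdd (nvar 11) (NConst 1)) (nvar 8) (nvar 9)) (nvar 9)))"

definition extend_walks :: prog where
  "extend_walks = PFor 11 rowsE (PFor 8 rowsE (PFor 9 rowsE extend_walk))"

lemma writes_extend_col [simp]: "nwrites extend_col = {10, 13}" "rwrites extend_col = {}"
  and writes_extend_walk [simp]: "nwrites extend_walk = {10, 13}" "rwrites extend_walk = {3}"
  and writes_extend_walks [simp]: "nwrites extend_walks = {8, 9, 10, 11, 13}" "rwrites extend_walks = {3}"
  by (auto simp: extend_col_def extend_walk_def extend_walks_def)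

definition walk_ok :: "nat \<Rightarrow> state \<Rightarrow> nat \<Rightarrow> nat \<Rightarrow> nat \<Rightarrow> bool" where
  "walk_ok n s r u v \<longleftrightarrow> (let D = \<lambda>r u v. rats s 3 (enc r (enc u v)); p = nats s 13 (enc (Suc r) (enc u v)) in
    p < n \<and> D (Suc r) u v = D r u p + D 0 p v \<and> (\<forall>x<n. D (Suc r) u v \<le> D r u x + D 0 x v))"

text \<open>Besides its own entry at level \<open>Suc r\<close>, the recursion at level
  \<open>r\<close> reads only the levels \<open>r\<close> and 0. So writing an entry of level
  \<open>Suc k\<close> spoils no other equation of level at most \<open>k\<close>.\<close>

lemma walk_ok_cong:
  assumes "walk_ok n s r u v" "r \<le> k"
    and "\<And>q x z. (q, x, z) \<noteq> (Suc k, a, b) \<Longrightarrow> rats t 3 (enc q (enc x z)) = rats s 3 (enc q (enc x z))"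
    and "nats t 13 (enc (Suc r) (enc u v)) = nats s 13 (enc (Suc r) (enc u v))"
    and "(r, u, v) \<noteq> (k, a, b)"
  shows "walk_ok n t r u v"
proof -
  have "rats t 3 (enc (Suc r) (enc u v)) = rats s 3 (enc (Suc r) (enc u v))"
    and "\<And>x z. rats t 3 (enc r (enc x z)) = rats s 3 (enc r (enc x z))"
    and "\<And>x z. rats t 3 (enc 0 (enc x z)) = rats s 3 (enc 0 (enc x z))"
    using assms(2,5) by (auto intro!: assms(3))
  then show ?thesis using assms(1,4) unfolding walk_ok_def Let_def by auto
qed

lemma extend_walk:
  fixes s
  defines "n \<equiv> nval s rowsE" and "r \<equiv> nats s 11 0" and "u \<equiv> nats s 8 0" and "v \<equiv> nats s 9 0"
  defines "s' \<equiv> ev extend_walk s"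
  assumes "0 < n"
  shows "walk_ok n s' r u v"
    and "\<And>q x z. (q, x, z) \<noteq> (Suc r, u, v) \<Longrightarrow>
      rats s' 3 (enc q (enc x z)) = rats s 3 (enc q (enc x z)) \<and>
      nats s' 13 (enc q (enc x z)) = nats s 13 (enc q (enc x z))"
proof -
  define key where "key x = rats s 3 (enc r (enc u x)) + rats s 3 (enc 0 (enc x v))" for x
  define b where "b = fold (\<lambda>x c. if True \<and> (True \<longrightarrow> key x < key c) then x else c) [0..<n] 0"
  let ?i = "enc (Suc r) (enc u v)"
  let ?s0 = "nset s 13 ?i 0"
  have "ev extend_col ?s0 = nset (nset ?s0 13 ?i (fold (\<lambda>x c. if True \<and> (True \<longrightarrow> key x < key c) then x else c)
      [0..<nval ?s0 rowsE] (nats ?s0 13 ?i))) 10 0 (nval ?s0 rowsE)"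
    unfolding extend_col_def by (rule ev_for_argmin) (auto simp: key_def r_def u_def v_def)
  then have e: "ev extend_col ?s0 = nset (nset s 13 ?i b) 10 0 n" by (simp add: b_def n_def)
  note am = fold_argmin[of "\<lambda>x z. key x < key z" b "\<lambda>_. True" n, OF _ _ b_def \<open>0 < n\<close>]
  have "b < n" "\<And>x. x < n \<Longrightarrow> key b \<le> key x" using am by (auto simp: not_less)
  then show "walk_ok n s' r u v"
    unfolding s'_def walk_ok_def extend_walk_def using e
    by (auto simp: r_def[symmetric] u_def[symmetric] v_def[symmetric] key_def Let_def)
  show "rats s' 3 (enc q (enc x z)) = rats s 3 (enc q (enc x z)) \<and>
      nats s' 13 (enc q (enc x z)) = nats s 13 (enc q (enc x z))"
    if "(q, x, z) \<noteq> (Suc r, u, v)" for q x z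
    using that e unfolding s'_def extend_walk_def
    by (auto simp: r_def[symmetric] u_def[symmetric] v_def[symmetric])
qed

lemma walk_ok_nset [simp]: "a \<noteq> 13 \<Longrightarrow> walk_ok n (nset s a i x) r u v = walk_ok n s r u v"
  by (simp add: walk_ok_def)

lemma extend_walks:
  assumes n: "nval s rowsE = n" "0 < n"
  defines "s' \<equiv> ev extend_walks s"
  shows "(\<forall>r<n. \<forall>u<n. \<forall>v<n. walk_ok n s' r u v) \<and>
    (\<forall>u v. rats s' 3 (enc 0 (enc u v)) = rats s 3 (enc 0 (enc u v)) \<and>
      nats s' 13 (enc 0 (enc u v)) = nats s 13 (enc 0 (enc u v)))"
proof -
  define base where "base t \<longleftrightarrow> (\<forall>u v. rats t 3 (enc 0 (enc u v)) = rats s 3 (enc 0 (enc u v)) \<and>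
      nats t 13 (enc 0 (enc u v)) = nats s 13 (enc 0 (enc u v)))" for t :: state
  have base_nset [simp]: "base (nset t a i x) = base t" if "a \<noteq> 13" for t a i x
    using that by (simp add: base_def)
  have "(\<forall>r<n. \<forall>u<n. \<forall>v<n. walk_ok n s' r u v) \<and> base s'"
    unfolding s'_def extend_walks_def
  proof (rule ev_for_frame[where P = "\<lambda>r t. (\<forall>q<r. \<forall>u<n. \<forall>v<n. walk_ok n t q u v) \<and> base t"], goal_cases)
    case 1
    then show ?case by (simp add: base_def)
  next
    case (2 r t)
    have f: "nats t a = nats s a" if "a \<notin> {8, 9, 10, 11, 13}" for a using 2(2)[of a] that by simp
    show ?case
    proof (rule ev_for_frame[where P = "\<lambda>u t. (\<forall>q<r. \<forall>u<n. \<forall>v<n. walk_ok n t q u v) \<and> base t \<and>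
        (\<forall>x<u. \<forall>v<n. walk_ok n t r x v)"], goal_cases)
      case 1
      then show ?case using 2 by simp
    next
      case (2 u t')
      have f': "nats t' a = nats s a" if "a \<notin> {8, 9, 10, 11, 13}" "nats t' 11 0 = r" for a
        using 2(2)[of a] f[of a] that by simp
      have r: "nats t' 11 0 = r" using 2(2)[of 11] by simp
      show ?case
      proof (rule ev_for_frame[where P = "\<lambda>v t. (\<forall>q<r. \<forall>u<n. \<forall>v<n. walk_ok n t q u v) \<and> base t \<and>
          (\<forall>x<u. \<forall>v<n. walk_ok n t r x v) \<and> (\<forall>z<v. walk_ok n t r u z)"], goal_cases)
        case 1
        then show ?case using 2 by simp
      next
        case (2 v t2)
        have f2: "nats t2 a = nats s a" if "a \<notin> {8, 9, 10, 11, 13}" for a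
          using 2(2)[of a] f'[of a] r that by simp
        let ?t = "nset t2 9 0 v"
        have t: "nval ?t rowsE = n" "nats ?t 11 0 = r" "nats ?t 8 0 = u" "nats ?t 9 0 = v"
          using f2 n r 2(2)[of 11] 2(2)[of 8] by auto
        note ew = extend_walk[of ?t, unfolded t, OF n(2)]
        have keep: "walk_ok n (ev extend_walk ?t) q x z"
          if "walk_ok n ?t q x z" "q \<le> r" "(q, x, z) \<noteq> (r, u, v)" for q x z
          by (rule walk_ok_cong[OF that(1,2) _ _ that(3)]) (use ew(2) that in auto)
        have "base (ev extend_walk ?t)"
          using 2(4) ew(2) unfolding base_def by simp
        moreover have "walk_ok n t2 q x z \<Longrightarrow> q \<le> r \<Longrightarrow> (q, x, z) \<noteq> (r, u, v) \<Longrightarrow>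
            walk_ok n (ev extend_walk ?t) q x z" for q x z
          using keep[of q x z] by simp
        ultimately show ?case using 2(4) ew(1) by (auto simp: less_Suc_eq)
      next
        case (3 t2)
        have "nval t' rowsE = n" using f' r n by simp
        then show ?case using 3(3) by (auto simp: less_Suc_eq)
      qed
    next
      case (3 t')
      have "nval (nset t 11 0 r) rowsE = n" using f n by simp
      then show ?case using 3(3) by (auto simp: less_Suc_eq)
    qed
  qed (use n in auto)
  then show ?thesis by (simp add: base_def)
qed


section \<open>The best cycle and the push along it\<close>

definition best_start :: prog where
  "best_start = PFor 8 rowsE
    (PIf (RLess (RDiv (get3 3 (nvar 11) (nvar 8) (nvar 8)) (RGet 5 (NConst 0))) (RGet 4 (NConst 0)))
      (PRSet 4 (NConst 0) (RDiv (get3 3 (nvar 11) (nvar 8) (nvar 8)) (RGet 5 (NConst 0))) ;;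
       PNSet 14 (NConst 0) (nvar 11) ;; PNSet 15 (NConst 0) (nvar 8))
      PSkip)"

text \<open>Naturals cannot be converted to rationals, so the number of arcs, by which the weight is
  divided, is counted once more in the array of rationals 5. The best mean starts at 0: only
  negative cycles are recorded.\<close>

definition best_cycle :: prog where
  "best_cycle = PRSet 4 (NConst 0) (RConst 0) ;; PRSet 5 (NConst 0) (RConst 0) ;;
    PFor 11 rowsE (PRSet 5 (NConst 0) (RAdd (RGet 5 (NConst 0)) (RConst 1)) ;; best_start)"

lemma writes_best_start [simp]: "nwrites best_start = {8, 14, 15}" "rwrites best_start = {4}"
  and writes_best_cycle [simp]: "nwrites best_cycle = {8, 11, 14, 15}" "rwrites best_cycle = {4, 5}"
  by (auto simp: best_start_def best_cycle_def)

text \<open>\<open>(r0, u0)\<close> is the position the search has reached. As lengths increase and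
  the comparison is strict, the recorded cycle is a shortest one among those of least mean, which
  keeps its rows distinct.\<close>

definition best_ok :: "nat \<Rightarrow> state \<Rightarrow> nat \<Rightarrow> nat \<Rightarrow> bool" where
  "best_ok n s r0 u0 \<longleftrightarrow> (let M = rats s 4 0; mean = \<lambda>r u. rats s 3 (enc r (enc u u)) / of_nat (Suc r) in
    (\<forall>r<n. \<forall>u<n. r < r0 \<or> (r = r0 \<and> u < u0) \<longrightarrow> M \<le> mean r u) \<and>
    (M < 0 \<longrightarrow> nats s 14 0 < n \<and> nats s 15 0 < n \<and> mean (nats s 14 0) (nats s 15 0) = M \<and>
      nats s 14 0 \<le> r0 \<and> (\<forall>r<nats s 14 0. \<forall>u<n. M < mean r u)) \<and> M \<le> 0)"

lemma best_ok_nset [simp]: "a \<notin> {14, 15} \<Longrightarrow> best_ok n (nset s a i x) r u = best_ok n s r u"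
  and best_ok_rset [simp]: "a \<notin> {3, 4} \<Longrightarrow> best_ok n (rset s a i q) r u = best_ok n s r u"
  by (simp_all add: best_ok_def)

lemma best_ok_Suc: "best_ok n s r n \<Longrightarrow> best_ok n s (Suc r) 0"
  unfolding best_ok_def Let_def by (auto simp: less_Suc_eq)

lemma best_start:
  assumes n: "nval s rowsE = n" and r: "nats s 11 0 < n" "rats s 5 0 = of_nat (Suc (nats s 11 0))"
    and ok: "best_ok n s (nats s 11 0) 0"
  shows "best_ok n (ev best_start s) (nats s 11 0) n"
  unfolding best_start_def
proof (rule ev_for_frame[where P = "\<lambda>u t. best_ok n t (nats s 11 0) u"], goal_cases)
  case (2 u t)
  let ?r = "nats s 11 0"
  let ?mean = "\<lambda>r u. rats s 3 (enc r (enc u u)) / of_nat (Suc r)"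
  have t: "rats t 3 = rats s 3" "rats t 5 0 = of_nat (Suc ?r)" "nats t 11 0 = ?r"
    using 2(2)[of 11] 2(3)[of 3] 2(3)[of 5] r by auto
  have u: "u < n" using 2(1) n by simp
  have old: "best_ok n t ?r u" by (rule 2(4))
  then have le: "rats t 4 0 \<le> 0" "\<And>r' u'. r' < n \<Longrightarrow> u' < n \<Longrightarrow> r' < ?r \<Longrightarrow> rats t 4 0 \<le> ?mean r' u'"
    "\<And>u'. u' < u \<Longrightarrow> rats t 4 0 \<le> ?mean ?r u'"
    using r(1) u by (auto simp: best_ok_def Let_def t)
  show ?case
  proof (cases "?mean ?r u < rats t 4 0")
    case True
    have "?mean ?r u < ?mean r' u'" if "r' < ?r" "u' < n" for r' u'
      using le(2)[of r' u'] that True r(1) by linarith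
    moreover have "?mean ?r u \<le> ?mean ?r u'" if "u' < Suc u" for u'
      using le(3)[of u'] that True by (cases "u' = u") auto
    ultimately show ?thesis
      using True t u r(1) le(1) by (simp add: best_ok_def Let_def less_Suc_eq_le) (auto intro: less_imp_le)
  next
    case False
    then show ?thesis using old t u r(1) by (auto simp: best_ok_def Let_def less_Suc_eq not_less)
  qed
qed (use ok n in \<open>simp_all\<close>)

lemma best_cycle:
  assumes n: "nval s rowsE = n"
  shows "best_ok n (ev best_cycle s) n 0"
proof -
  let ?s = "rset (rset s 4 0 0) 5 0 0"
  have "best_ok n (ev (PFor 11 rowsE (PRSet 5 (NConst 0) (RAdd (RGet 5 (NConst 0)) (RConst 1)) ;; best_start)) ?s) n 0"
  proof (rule ev_for_frame[where P = "\<lambda>r t. best_ok n t r 0 \<and> rats t 5 0 = of_nat r"], goal_cases)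
    case 1
    then show ?case by (simp add: best_ok_def)
  next
    case (2 r t)
    let ?t = "rset (nset t 11 0 r) 5 0 (of_nat r + 1)"
    have "nats t a = nats s a" if "a \<notin> {8, 11, 14, 15}" for a using 2(2)[of a] that by simp
    then have "best_ok n (ev best_start ?t) (nats ?t 11 0) n"
      using n 2 by (intro best_start) auto
    then show ?case using 2(4) best_ok_Suc by (simp add: rats_ev)
  qed (use n in simp_all)
  then show ?thesis by (simp add: best_cycle_def)
qed

text \<open>Loop bounds may read only the array of sizes, so a loop along the cycle makes one round
  per row and a guard skips the rounds beyond its length. Vertices are found backwards, from the end
  of the walk.\<close>

definition trace_vertex :: prog where
  "trace_vertex = PIf (BNot (NLess (nvar 14) (nvar 10)))
    (PNSet 16 (NSub (nvar 14) (nvar 10))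
      (nget3 13 (NSub (nvar 14) (nvar 10)) (nvar 15)
        (NGet 16 (NAdd (NSub (nvar 14) (nvar 10)) (NConst 1))))) PSkip"

definition trace_cycle :: prog where
  "trace_cycle = PNSet 16 (NAdd (nvar 14) (NConst 1)) (nvar 15) ;; PFor 10 rowsE trace_vertex"

abbreviation cyc_vertex :: "nexp \<Rightarrow> nexp" where "cyc_vertex e \<equiv> NGet 16 e"
abbreviation cyc_col :: "nexp \<Rightarrow> nexp" where
  "cyc_col e \<equiv> nget2 12 (cyc_vertex e) (cyc_vertex (NAdd e (NConst 1)))"
abbreviation cyc_entry :: "nexp \<Rightarrow> rexp" where
  "cyc_entry e \<equiv> get2 2 (cyc_vertex (NAdd e (NConst 1))) (cyc_col e)"

definition push_amount :: prog where
  "push_amount = PRSet 6 (NConst 0) (cyc_entry (NConst 0)) ;;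
    PFor 10 rowsE (PIf (BAnd (BNot (NLess (nvar 14) (nvar 10))) (RLess (cyc_entry (nvar 10)) (RGet 6 (NConst 0))))
      (PRSet 6 (NConst 0) (cyc_entry (nvar 10))) PSkip)"

definition push_arc :: prog where
  "push_arc = PIf (BNot (NLess (nvar 14) (nvar 10)))
    (PRSet 2 (encE (cyc_vertex (NAdd (nvar 10) (NConst 1))) (cyc_col (nvar 10)))
       (RSub (cyc_entry (nvar 10)) (RGet 6 (NConst 0))) ;;
     PRSet 2 (encE (cyc_vertex (nvar 10)) (cyc_col (nvar 10)))
       (RAdd (get2 2 (cyc_vertex (nvar 10)) (cyc_col (nvar 10))) (RGet 6 (NConst 0)))) PSkip"

definition cancel_prog :: prog where
  "cancel_prog = arc_weights ;; extend_walks ;; best_cycle ;;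
    PIf (RLess (RGet 4 (NConst 0)) (RConst 0))
      (trace_cycle ;; push_amount ;; PFor 10 rowsE push_arc) PSkip"

lemma writes_trace_vertex [simp]: "nwrites trace_vertex = {16}" "rwrites trace_vertex = {}"
  and writes_trace_cycle [simp]: "nwrites trace_cycle = {10, 16}" "rwrites trace_cycle = {}"
  and writes_push_amount [simp]: "nwrites push_amount = {10}" "rwrites push_amount = {6}"
  and writes_push_arc [simp]: "nwrites push_arc = {}" "rwrites push_arc = {2}"
  and writes_cancel_prog [simp]: "nwrites cancel_prog = {5, 8, 9, 10, 11, 12, 13, 14, 15, 16}"
    "rwrites cancel_prog = {2, 3, 4, 5, 6}"
  by (auto simp: trace_vertex_def trace_cycle_def push_amount_def push_arc_def cancel_prog_def)

lemma trace_cycle: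
  assumes n: "nval s rowsE = n" "nats s 14 0 < n"
  defines "s' \<equiv> ev trace_cycle s"
  shows "nats s' 16 (Suc (nats s 14 0)) = nats s 15 0 \<and>
    (\<forall>i\<le>nats s 14 0. nats s' 16 i = nats s 13 (enc i (enc (nats s 15 0) (nats s' 16 (Suc i)))))"
proof -
  let ?b = "nats s 14 0"
  \<comment> \<open>After \<open>x\<close> rounds the positions above \<open>?b - x\<close> are
    known; the condition is written as a sum to avoid truncated subtraction.\<close>
  define ok where "ok x t \<longleftrightarrow> nats t 16 (Suc ?b) = nats s 15 0 \<and>
    (\<forall>i\<le>?b. ?b < i + x \<longrightarrow> nats t 16 i = nats s 13 (enc i (enc (nats s 15 0) (nats t 16 (Suc i)))))"
    for x and t :: state
  have "ok n s'"
    unfolding s'_def trace_cycle_def ev.simps(4)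
  proof (rule ev_for_frame[where P = ok], goal_cases)
    case 1
    then show ?case by (simp add: ok_def)
  next
    case (2 x t)
    have t: "nats t 14 0 = ?b" "nats t 15 0 = nats s 15 0" "nats t 13 = nats s 13"
      using 2(2)[of 14] 2(2)[of 15] 2(2)[of 13] by auto
    show ?case
    proof (cases "x \<le> ?b")
      case True
      let ?t = "ev trace_vertex (nset t 10 0 x)"
      have e: "nats ?t 16 = (nats t 16)(?b - x := nats s 13 (enc (?b - x) (enc (nats s 15 0) (nats t 16 (Suc (?b - x))))))"
        using True by (simp add: trace_vertex_def t)
      show ?thesis
        unfolding ok_def
      proof (intro conjI allI impI)
        show "nats ?t 16 (Suc ?b) = nats s 15 0"
          using 2(4) True unfolding e ok_def by (subst fun_upd_other) auto
        fix i assume i: "i \<le> ?b" "?b < i + Suc x"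
        show "nats ?t 16 i = nats s 13 (enc i (enc (nats s 15 0) (nats ?t 16 (Suc i))))"
        proof (cases "i = ?b - x")
          case True
          then show ?thesis unfolding e by simp
        next
          case ne: False
          then have "?b < i + x" "Suc i \<noteq> ?b - x" using i by auto
          then have "nats ?t 16 i = nats t 16 i" "nats ?t 16 (Suc i) = nats t 16 (Suc i)"
            using ne unfolding e by auto
          moreover have "nats t 16 i = nats s 13 (enc i (enc (nats s 15 0) (nats t 16 (Suc i))))"
            using 2(4) i(1) \<open>?b < i + x\<close> unfolding ok_def by blast
          ultimately show ?thesis by simp
        qed
      qed
    next
      case False
      then have "nats (ev trace_vertex (nset t 10 0 x)) 16 = nats t 16"
        by (simp add: trace_vertex_def t)
      moreover have "i \<le> ?b \<Longrightarrow> ?b < i + x" for i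
        using False 2(1) n by simp
      ultimately show ?thesis using 2(4) False unfolding ok_def by (metis trans_less_add2 not_le)
    qed
  next
    case (3 t)
    then show ?case using n by (simp add: ok_def)
  qed
  then show ?thesis unfolding ok_def using n(2) by (meson trans_less_add2)
qed

lemma push_amount:
  assumes n: "nval s rowsE = n" "nats s 14 0 < n"
  defines "f \<equiv> \<lambda>i. rats s 2 (enc (nats s 16 (Suc i)) (nats s 12 (enc (nats s 16 i) (nats s 16 (Suc i)))))"
  shows "rats (ev push_amount s) 6 0 = Min (f ` {..<Suc (nats s 14 0)})"
proof -
  let ?b = "nats s 14 0" and ?s = "rset s 6 0 (f 0)"
  define F where "F x q = (if x \<le> ?b \<and> f x < q then f x else q)" for x q
  have "ev (PFor 10 rowsE (PIf (BAnd (BNot (NLess (nvar 14) (nvar 10))) (RLess (cyc_entry (nvar 10)) (RGet 6 (NConst 0))))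
      (PRSet 6 (NConst 0) (cyc_entry (nvar 10))) PSkip)) ?s =
      nset (rset ?s 6 0 (fold F [0..<nval ?s rowsE] (rats ?s 6 0))) 10 0 (nval ?s rowsE)"
    by (rule ev_for_rat_cell) (auto simp: F_def f_def rset_nset not_less)
  then have e: "rats (ev push_amount s) 6 0 = fold F [0..<n] (f 0)"
    using n by (simp add: push_amount_def f_def)
  define A where "A k = f ` ({0} \<union> {i. i < k \<and> i \<le> ?b})" for k
  have A: "finite (A k)" "A k \<noteq> {}" for k by (auto simp: A_def)
  have "fold F [0..<k] (f 0) = Min (A k)" for k
  proof (induction k)
    case (Suc k)
    have "{i. i < Suc k \<and> i \<le> ?b} = (if k \<le> ?b then insert k {i. i < k \<and> i \<le> ?b} else {i. i < k \<and> i \<le> ?b})"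
      by (auto simp: less_Suc_eq)
    then have "A (Suc k) = (if k \<le> ?b then insert (f k) (A k) else A k)" by (auto simp: A_def)
    moreover have "F k q = (if k \<le> ?b then min (f k) q else q)" for q by (simp add: F_def min_def)
    ultimately show ?case using Suc A by simp
  qed (simp add: A_def)
  moreover have "{0} \<union> {i. i < n \<and> i \<le> ?b} = {..<Suc ?b}" using n(2) by auto
  then have "A n = f ` {..<Suc ?b}" by (simp only: A_def)
  ultimately show ?thesis using e by simp
qed

lemma push_Suc: "push (Suc r) ks ls \<delta> y k l = push r ks ls \<delta> y k l +
    \<delta> * (if ks r = k \<and> ls r = l then 1 else 0) - \<delta> * (if ks (Suc r) = k \<and> ls r = l then 1 else 0)"
  by (simp add: push_def algebra_simps)

text \<open>The amount is fixed beforehand and \<open>push\<close> is additive over the arcs, so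
  entries can be updated arc by arc. Rounds beyond the last arc change nothing, hence
  \<open>min\<close> in the invariant.\<close>

lemma push_arcs:
  assumes n: "nval s rowsE = n" "nats s 14 0 < n"
  defines "ks \<equiv> nats s 16" and "s' \<equiv> ev (PFor 10 rowsE push_arc) s"
  defines "ls \<equiv> \<lambda>i. nats s 12 (enc (ks i) (ks (Suc i)))"
  shows "rats s' 2 (enc k l) = push (Suc (nats s 14 0)) ks ls (rats s 6 0) (\<lambda>k l. rats s 2 (enc k l)) k l"
proof -
  let ?b = "nats s 14 0" and ?y = "\<lambda>k l. rats s 2 (enc k l)"
  define ok where "ok x t \<longleftrightarrow> (\<forall>k l. rats t 2 (enc k l) = push (min x (Suc ?b)) ks ls (rats s 6 0) ?y k l)"
    for x and t :: state
  have "ok n s'"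
    unfolding s'_def
  proof (rule ev_for_frame[where P = ok], goal_cases)
    case 1
    then show ?case by (simp add: ok_def push_def)
  next
    case (2 x t)
    have t: "nats t 14 0 = ?b" "nats t 16 = ks" "nats t 12 = nats s 12" "rats t 6 = rats s 6"
      using 2(2)[of 14] 2(2)[of 16] 2(2)[of 12] 2(3)[of 6] by (auto simp: ks_def)
    show ?case
    proof (cases "x \<le> ?b")
      case True
      then have "min x (Suc ?b) = x" "min (Suc x) (Suc ?b) = Suc x" by auto
      then show ?thesis
        using 2(4) True unfolding push_arc_def ok_def by (auto simp: t push_Suc ls_def)
    next
      case False
      then have "min x (Suc ?b) = Suc ?b" "min (Suc x) (Suc ?b) = Suc ?b" by auto
      then show ?thesis using 2(4) False unfolding push_arc_def ok_def by (auto simp: t)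
    qed
  qed (use n in \<open>simp_all add: ok_def\<close>)
  then show ?thesis using n(2) by (simp add: ok_def)
qed

text \<open>Positive row sums give every row a positive entry, so the graph of rows is complete. The
  witness \<open>e\<close> is \<open>- M\<close> for the least mean \<open>M\<close> found, which is
  0 if there is no negative cycle.\<close>

lemma cancel_prog:
  fixes s
  defines "y \<equiv> \<lambda>k l. rats s 2 (enc k l)" and "c \<equiv> \<lambda>k l. rats s 1 (enc k l)"
  assumes n: "nval s rowsE = n" "0 < n" and m: "nval s colsE = m"
    and plan: "plan n m a b y" and a: "\<And>k. k < n \<Longrightarrow> 0 < a k"
  shows "\<exists>e. cancel_step n m c y e (\<lambda>k l. rats (ev cancel_prog s) 2 (enc k l))"
proof -
  define s1 where "s1 = ev arc_weights s"
  define s2 where "s2 = ev extend_walks s1"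
  define s3 where "s3 = ev best_cycle s2"
  have pos: "\<exists>l<m. 0 < y v l" if "v < n" for v
  proof (rule ccontr)
    assume "\<not> ?thesis"
    then have "y v l \<le> 0" if "l < m" for l using that by (meson not_less)
    then have "(\<Sum>l<m. y v l) \<le> 0" by (intro sum_nonpos) auto
    then show False using plan a[OF that] that by (simp add: plan_def)
  qed
  have arcs: "arc_ok s s1 m u v" if "u < n" "v < n" for u v
    unfolding s1_def using arc_weights[OF n(1) m] pos that by (simp add: y_def)
  have n1: "nval s1 rowsE = n" using n by (simp add: s1_def nats_ev)
  note walks = extend_walks[OF n1 n(2), folded s2_def]
  have n2: "nval s2 rowsE = n" using n1 by (simp add: s2_def nats_ev)
  note best = best_cycle[OF n2, folded s3_def]
  have n3: "nval s3 rowsE = n" using n2 by (simp add: s3_def nats_ev)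
  have same3: "rats s3 2 = rats s 2" "rats s3 3 = rats s2 3" "nats s3 13 = nats s2 13" "nats s3 12 = nats s1 12"
    by (simp_all add: s3_def s2_def s1_def nats_ev rats_ev)
  define L where "L u v = nats s1 12 (enc u v)" for u v
  define D where "D r u v = rats s2 3 (enc r (enc u v))" for r u v
  define Pd where "Pd r u v = nats s2 13 (enc r (enc u v))" for r u v
  define M where "M = rats s3 4 0"
  have arc: "L u v < m \<and> 0 < y v (L u v)" "\<And>l. l < m \<Longrightarrow> 0 < y v l \<Longrightarrow> c u (L u v) - c v (L u v) \<le> c u l - c v l"
    "D 0 u v = c u (L u v) - c v (L u v)" "Pd 0 u v = u" if "u < n" "v < n" for u v
    using arcs[OF that] walks by (auto simp: arc_ok_def L_def D_def Pd_def y_def c_def Let_def)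
  interpret row_graph n m c y L "D 0"
    by unfold_locales (use n arc in auto)
  have Pd: "Pd (Suc r) u v < n" "D (Suc r) u v = D r u (Pd (Suc r) u v) + D 0 (Pd (Suc r) u v) v"
    "\<And>x. x < n \<Longrightarrow> D (Suc r) u v \<le> D r u x + D 0 x v" if "r < n" "u < n" "v < n" for r u v
  proof -
    have "walk_ok n s2 r u v" using walks that by blast
    then show "Pd (Suc r) u v < n" "D (Suc r) u v = D r u (Pd (Suc r) u v) + D 0 (Pd (Suc r) u v) v"
      "\<And>x. x < n \<Longrightarrow> D (Suc r) u v \<le> D r u x + D 0 x v"
      unfolding walk_ok_def D_def Pd_def Let_def by blast+
  qed
  \<comment> \<open>The entries bound the weights of all walks from below; the traced walk attains
    its entry, as \<open>D_walk\<close> shows further on.\<close>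
  have D_le: "D r (vs 0) (vs (Suc r)) \<le> walk_weight (Suc r) vs"
    if "r < n" "\<And>i. i \<le> Suc r \<Longrightarrow> vs i < n" for r vs
    using that
  proof (induction r)
    case (Suc r)
    then have "D (Suc r) (vs 0) (vs (Suc (Suc r))) \<le> D r (vs 0) (vs (Suc r)) + D 0 (vs (Suc r)) (vs (Suc (Suc r)))"
      by (intro Pd(3)) auto
    also have "D r (vs 0) (vs (Suc r)) \<le> walk_weight (Suc r) vs" using Suc by simp
    finally show ?case by (simp add: walk_weight_def)
  qed (simp add: walk_weight_def)
  have M_le: "of_nat r * M \<le> walk_weight r vs" if cw: "closed_walk r vs" for r vs
  proof -
    obtain q where q: "r = Suc q" using cw by (cases r) (auto simp: closed_walk_def)
    have w: "q < n" "vs 0 < n" "vs (Suc q) = vs 0" using cw q by (auto simp: closed_walk_def)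
    then have "M \<le> D q (vs 0) (vs 0) / of_nat (Suc q)"
      using best by (auto simp: best_ok_def M_def D_def Let_def same3)
    then have "of_nat r * M \<le> D q (vs 0) (vs 0)" by (simp add: q field_simps)
    also have "\<dots> \<le> walk_weight r vs" using D_le[of q vs] cw w by (simp add: q closed_walk_def)
    finally show ?thesis .
  qed
  have M: "M \<le> 0" using best by (simp add: best_ok_def M_def Let_def)
  show ?thesis
  proof (cases "M < 0")
    case False
    then have "M = 0" using M by simp
    then have "cancel_step n m c y 0 y" using M_le by (intro cancel_step_stop) fastforce
    moreover have "ev cancel_prog s = s3"
      using False by (simp add: cancel_prog_def s1_def s2_def s3_def M_def)
    ultimately show ?thesis using same3 by (auto simp: y_def)
  next
    case True
    define r u where "r = nats s3 14 0" and "u = nats s3 15 0"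
    have ru: "r < n" "u < n" "D r u u = of_nat (Suc r) * M"
      and strict: "\<And>r' u'. r' < r \<Longrightarrow> u' < n \<Longrightarrow> M < D r' u' u' / of_nat (Suc r')"
      using best True by (auto simp: best_ok_def M_def D_def r_def u_def Let_def same3 field_simps)
    define s4 where "s4 = ev trace_cycle s3"
    define s5 where "s5 = ev push_amount s4"
    have same4: "nats s4 14 = nats s3 14" "rats s4 = rats s3" "nats s4 12 = nats s3 12"
      "nats s5 14 = nats s3 14" "nats s5 16 = nats s4 16" "nats s5 12 = nats s3 12" "rats s5 2 = rats s3 2"
      by (auto simp: s4_def s5_def nats_ev rats_ev)
    have n4: "nval s4 rowsE = n" "nval s5 rowsE = n"
      using n3 by (simp_all add: s4_def s5_def nats_ev)
    define ks where "ks = nats s4 16"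
    define ls where "ls i = L (ks i) (ks (Suc i))" for i
    have ks: "ks (Suc r) = u" "\<And>i. i \<le> r \<Longrightarrow> ks i = Pd i u (ks (Suc i))"
      using trace_cycle[OF n3 ru(1)[unfolded r_def], folded s4_def]
      unfolding ks_def r_def u_def Pd_def same3 by blast+
    have ks_lt: "ks i < n" if "i \<le> Suc r" for i
      using that
    proof (induction i rule: inc_induct)
      case (step i)
      then have i: "i \<le> r" by simp
      show ?case
      proof (cases i)
        case 0
        then show ?thesis using ks(2)[OF i] arc(4)[of u "ks (Suc i)"] step ru by simp
      next
        case (Suc j)
        then show ?thesis using ks(2)[OF i] Pd(1)[of j u "ks (Suc i)"] step ru by simp
      qed
    qed (use ks ru in simp)
    have ks0: "ks 0 = u" using ks(2)[of 0] arc(4)[of u "ks 1"] ks_lt[of 1] ru by simp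
    have D_walk: "D i u (ks (Suc i)) = walk_weight (Suc i) ks" if "i \<le> r" for i
      using that
    proof (induction i)
      case (Suc i)
      then have "D (Suc i) u (ks (Suc (Suc i))) = D i u (ks (Suc i)) + D 0 (ks (Suc i)) (ks (Suc (Suc i)))"
        using Pd(2)[of i u "ks (Suc (Suc i))"] ks(2)[of "Suc i"] ks_lt[of "Suc (Suc i)"] ru by simp
      then show ?case using Suc by (simp add: walk_weight_def)
    qed (simp add: walk_weight_def ks0)
    let ?\<delta> = "Min ((\<lambda>i. y (ks (Suc i)) (ls i)) ` {..<Suc r})"
    have "cancel_step n m c y (- M) (push (Suc r) ks ls ?\<delta> y)"
      unfolding ls_def
    proof (rule cancel_step_push)
      show "closed_walk (Suc r) ks" using ks_lt ks0 ks(1) ru(1) by (auto simp: closed_walk_def)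
      show "walk_weight (Suc r) ks = - (of_nat (Suc r) * - M)"
        using D_walk[of r] ks(1) ru by simp
      show "0 < - M" using True by simp
      fix r' vs' assume w: "closed_walk r' vs'"
      show "- (of_nat r' * - M) \<le> walk_weight r' vs'" using M_le[OF w] by simp
      assume lt: "r' < Suc r"
      obtain q where q: "r' = Suc q" using w by (cases r') (auto simp: closed_walk_def)
      have v: "q < r" "vs' 0 < n" "vs' (Suc q) = vs' 0" using w q lt by (auto simp: closed_walk_def)
      have "of_nat r' * M < D q (vs' 0) (vs' 0)" using strict[OF v(1,2)] by (simp add: q field_simps)
      also have "\<dots> \<le> walk_weight r' vs'"
        using D_le[of q vs'] w v ru by (simp add: q closed_walk_def)
      finally show "- (of_nat r' * - M) < walk_weight r' vs'" by simp
    qed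
    moreover have "rats (ev cancel_prog s) 2 (enc k l) = push (Suc r) ks ls ?\<delta> y k l" for k l
    proof -
      have "rats s5 6 0 = ?\<delta>"
        unfolding s5_def using n4 ru(1)
        by (subst push_amount[of s4 n]) (simp_all add: same4 same3 r_def ks_def ls_def L_def y_def)
      moreover have "ev cancel_prog s = ev (PFor 10 rowsE push_arc) s5"
        using True by (simp add: cancel_prog_def s1_def s2_def s3_def s4_def s5_def M_def)
      moreover have "rats (ev (PFor 10 rowsE push_arc) s5) 2 (enc k l) =
          push (Suc (nats s5 14 0)) (nats s5 16) (\<lambda>i. nats s5 12 (enc (nats s5 16 i) (nats s5 16 (Suc i))))
            (rats s5 6 0) (\<lambda>k l. rats s5 2 (enc k l)) k l"
        by (rule push_arcs[OF n4(2)]) (use ru(1) in \<open>simp add: same4 r_def\<close>)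
      moreover have "(\<lambda>i. nats s5 12 (enc (nats s5 16 i) (nats s5 16 (Suc i)))) = ls"
        by (auto simp: same4 same3 ks_def ls_def L_def)
      ultimately show ?thesis
        by (simp add: same4(4,5,7) same3(1) r_def[symmetric] ks_def[symmetric] y_def[symmetric])
    qed
    ultimately show ?thesis by auto
  qed
qed

section \<open>Loops with set-based invariants\<close>

definition agrees :: "nat set \<Rightarrow> nat set \<Rightarrow> state \<Rightarrow> state \<Rightarrow> bool" where
  "agrees A B s t \<longleftrightarrow> (\<forall>a. a \<notin> A \<longrightarrow> nats t a = nats s a) \<and> (\<forall>a. a \<notin> B \<longrightarrow> rats t a = rats s a)"

lemma agrees_trans: "agrees A B s t \<Longrightarrow> agrees A' B' t u \<Longrightarrow> agrees (A \<union> A') (B \<union> B') s u"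
  by (simp add: agrees_def)

lemma agrees_ev: "agrees (nwrites p) (rwrites p) s (ev p s)"
  by (simp add: agrees_def nats_ev rats_ev)

lemma agrees_mono: "agrees A B s t \<Longrightarrow> A \<subseteq> A' \<Longrightarrow> B \<subseteq> B' \<Longrightarrow> agrees A' B' s t"
  by (auto simp: agrees_def)

lemma agrees_nset: "agrees A B s t \<Longrightarrow> a \<in> A \<Longrightarrow> agrees A B s (nset t a i x)"
  by (auto simp: agrees_def)

lemma agrees_nats: "agrees A B s t \<Longrightarrow> a \<notin> A \<Longrightarrow> nats t a = nats s a"
  and agrees_rats: "agrees A B s t \<Longrightarrow> a \<notin> B \<Longrightarrow> rats t a = rats s a"
  by (auto simp: agrees_def)

lemma ev_for_agrees:
  assumes "P 0 s" and "nval s e = n"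
    and "\<And>k t. k < n \<Longrightarrow> agrees (insert v (nwrites p)) (rwrites p) s t \<Longrightarrow> P k t \<Longrightarrow> P (Suc k) (ev p (nset t v 0 k))"
    and "\<And>t. P n t \<Longrightarrow> P n (nset t v 0 n)"
  shows "P n (ev (PFor v e p) s)"
  by (rule ev_for_frame[where P = P]) (use assms in \<open>auto simp: agrees_def\<close>)

text \<open>The invariant refers to the set of pairs already treated instead of two counters, so a
  nested loop is handled like a single loop over a set. In \<open>step\<close> the current pair is
  known to be new.\<close>

lemma ev_pairs:
  assumes n: "nval s e1 = n"
    and m: "\<And>t. agrees (insert v1 (insert v2 (nwrites p))) (rwrites p) s t \<Longrightarrow> nats t v1 0 < n \<Longrightarrow>
      nval t e2 = m (nats t v1 0)"
    and v: "v1 \<noteq> v2" "v1 \<notin> nwrites p"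
    and H: "\<And>S t x. H S (nset t v1 0 x) = H S t" "\<And>S t x. H S (nset t v2 0 x) = H S t"
    and init: "H {} s"
    and step: "\<And>S t i j. agrees (insert v1 (insert v2 (nwrites p))) (rwrites p) s t \<Longrightarrow>
      nats t v1 0 = i \<Longrightarrow> nats t v2 0 = j \<Longrightarrow> i < n \<Longrightarrow> j < m i \<Longrightarrow> (i, j) \<notin> S \<Longrightarrow>
      S \<subseteq> Sigma {..<n} (\<lambda>i. {..<m i}) \<Longrightarrow> H S t \<Longrightarrow> H (insert (i, j) S) (ev p t)"
  shows "H (Sigma {..<n} (\<lambda>i. {..<m i})) (ev (PFor v1 e1 (PFor v2 e2 p)) s)"
proof (rule ev_for_agrees[where P = "\<lambda>i. H (Sigma {..<i} (\<lambda>i. {..<m i}))"], goal_cases)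
  case (3 i t)
  let ?t = "nset t v1 0 i" and ?S = "Sigma {..<i} (\<lambda>i. {..<m i})"
  have ag: "agrees (insert v1 (insert v2 (nwrites p))) (rwrites p) s ?t"
    using 3(2) by (intro agrees_nset) auto
  have "nval ?t e2 = m i" using m[OF ag] 3(1) by simp
  have "H (?S \<union> {i} \<times> {..<m i}) (ev (PFor v2 e2 p) ?t)"
  proof (rule ev_for_agrees[where P = "\<lambda>j. H (?S \<union> {i} \<times> {..<j})"], goal_cases)
    case 1
    then show ?case using 3 H by simp
  next
    case 2
    then show ?case by fact
  next
    case jt: (3 j t')
    let ?t' = "nset t' v2 0 j"
    have "agrees (insert v1 (insert v2 (nwrites p))) (rwrites p) s ?t'"
      by (intro agrees_nset agrees_mono[OF agrees_trans[OF ag jt(2)]]) auto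
    moreover have "nats ?t' v1 0 = i" using agrees_nats[OF jt(2), of v1] v by simp
    ultimately have "H (insert (i, j) (?S \<union> {i} \<times> {..<j})) (ev p ?t')"
      using 3(1) jt(1,3) H by (intro step) auto
    moreover have "insert (i, j) (?S \<union> {i} \<times> {..<j}) = ?S \<union> {i} \<times> {..<Suc j}" by auto
    ultimately show ?case by simp
  qed (use H in auto)
  moreover have "?S \<union> {i} \<times> {..<m i} = Sigma {..<Suc i} (\<lambda>i. {..<m i})" by (auto simp: less_Suc_eq)
  ultimately show ?case by simp
qed (use n init H in auto)

lemma ev_for_nat_cell:
  assumes "a \<noteq> v" "\<And>x q. x < nval s e \<Longrightarrow> ev p (nset (nset s a i q) v 0 x) = nset (nset s a i (F x q)) v 0 x"
  shows "ev (PFor v e p) s = nset (nset s a i (fold F [0..<nval s e] (nats s a i))) v 0 (nval s e)"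
proof (rule ev_for_rule[where I = "\<lambda>k s'. \<forall>x. nset s' v 0 x = nset (nset s a i (fold F [0..<k] (nats s a i))) v 0 x"],
    goal_cases)
  case 1
  then show ?case by (simp add: nset_same)
next
  case (2 k s')
  then show ?case using assms(2)[of k] by simp
next
  case (3 s')
  then show ?case by simp
qed

lemma fold_add: "fold (\<lambda>x q. q + f x) [0..<n] q = q + (\<Sum>x<n. f x :: 'a::comm_monoid_add)"
  by (induction n) (auto simp: ac_simps)

section \<open>Reading the input\<close>

lemma concat_nth_prefix:
  assumes "i < length xss" "j < length (xss ! i)"
  shows "concat xss ! ((\<Sum>i'<i. length (xss ! i')) + j) = xss ! i ! j"
    and "(\<Sum>i'<i. length (xss ! i')) + j < length (concat xss)"
proof -
  have "concat xss ! ((\<Sum>i'<i. length (xss ! i')) + j) = xss ! i ! j \<and>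
    (\<Sum>i'<i. length (xss ! i')) + j < length (concat xss)"
    using assms
  proof (induction xss arbitrary: i)
    case (Cons xs xss)
    show ?case
    proof (cases i)
      case (Suc i')
      have "(\<Sum>i''<i. length ((xs # xss) ! i'')) = length xs + (\<Sum>i''<i'. length (xss ! i''))"
        unfolding Suc by (subst sum.lessThan_Suc_shift) simp
      then show ?thesis using Cons.IH[of i'] Cons.prems by (simp add: Suc nth_append)
    qed (use Cons.prems in \<open>simp add: nth_append\<close>)
  qed simp
  then show "concat xss ! ((\<Sum>i'<i. length (xss ! i')) + j) = xss ! i ! j"
    and "(\<Sum>i'<i. length (xss ! i')) + j < length (concat xss)" by auto
qed

lemma flat_nth:
  assumes "\<And>k. k < length P \<Longrightarrow> length (supp_pt P k) = d" "k < length P" "c \<le> d"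
  shows "flat P ! (k * (d + 1) + c) = (if c < d then supp_pt P k ! c else mass P k)"
    and "k * (d + 1) + c < length (flat P)"
proof -
  let ?xss = "map (\<lambda>(x, m). x @ [m]) P"
  have l: "length (?xss ! k') = d + 1" if "k' < length P" for k'
    using assms(1)[OF that] that by (simp add: supp_pt_def split_beta)
  have "(\<Sum>k'<k. length (?xss ! k')) = (\<Sum>k'<k. d + 1)"
    using l assms(2) by (intro sum.cong) auto
  then have s: "(\<Sum>k'<k. length (?xss ! k')) = k * (d + 1)" by simp
  have "?xss ! k ! c = (if c < d then supp_pt P k ! c else mass P k)"
    using assms(1)[OF assms(2)] assms(2,3)
    by (auto simp: supp_pt_def mass_def nth_append split_beta)
  then show "flat P ! (k * (d + 1) + c) = (if c < d then supp_pt P k ! c else mass P k)"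
    and "k * (d + 1) + c < length (flat P)"
    using concat_nth_prefix[of k ?xss c] l[OF assms(2)] assms(2,3) unfolding s flat_def by auto
qed

lemma length_flat:
  assumes "\<And>k. k < length P \<Longrightarrow> length (supp_pt P k) = d"
  shows "length (flat P) = length P * (d + 1)"
proof -
  have "length (fst z) = d" if "z \<in> set P" for z
    using that assms by (auto simp: supp_pt_def in_set_conv_nth)
  then have "map (length \<circ> (\<lambda>(x, m). x @ [m])) P = map (\<lambda>_. d + 1) P"
    by (intro map_cong) (auto simp: split_beta)
  then have "length (flat P) = sum_list (map (\<lambda>_. d + 1) P)"
    by (simp only: flat_def length_concat map_map)
  then show ?thesis by (simp add: sum_list_triv)
qed

locale barycenter_input =
  fixes I :: bary_input
  assumes valid: "valid_input I"
begin

abbreviation N :: nat where "N \<equiv> num I"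
abbreviation d :: nat where "d \<equiv> space_dim I"
definition len :: "nat \<Rightarrow> nat" where "len i = length (measures I ! i)"
definition pts :: "nat \<Rightarrow> nat \<Rightarrow> nat \<Rightarrow> rat" where "pts i k c = supp_pt (measures I ! i) k ! c"
definition ms :: "nat \<Rightarrow> nat \<Rightarrow> rat" where "ms i k = mass (measures I ! i) k"
definition wt :: "nat \<Rightarrow> rat" where "wt i = weights I ! i"
definition off :: "nat \<Rightarrow> nat" where "off i = N + (\<Sum>i'<i. len i' * (d + 1))"

lemma discrete: "i < N \<Longrightarrow> discrete_prob d (measures I ! i)"
  using valid by (simp add: valid_input_def)

lemma length_supp: "i < N \<Longrightarrow> k < len i \<Longrightarrow> length (supp_pt (measures I ! i) k) = d"
  using discrete by (auto simp: discrete_prob_def len_def)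

lemma ms_pos: "i < N \<Longrightarrow> k < len i \<Longrightarrow> 0 < ms i k"
  and ms_sum: "i < N \<Longrightarrow> (\<Sum>k<len i. ms i k) = 1"
  using discrete by (auto simp: discrete_prob_def len_def ms_def)

lemma wt_pos: "i < N \<Longrightarrow> 0 < wt i" and wt_sum: "(\<Sum>i<N. wt i) = 1"
  using valid by (auto simp: valid_input_def wt_def)

lemma N_pos: "0 < N"
  using wt_sum by (cases N) auto

lemma len_pos: "i < N \<Longrightarrow> 0 < len i"
  using ms_sum[of i] by (cases "len i") auto

lemma pts_inj:
  assumes "i < N" "k < len i" "k' < len i" "k \<noteq> k'"
  shows "\<exists>c<d. pts i k c \<noteq> pts i k' c"
proof (rule ccontr)
  assume "\<not> ?thesis"
  then have "supp_pt (measures I ! i) k = supp_pt (measures I ! i) k'"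
    using length_supp assms by (intro nth_equalityI) (auto simp: pts_def)
  then show False
    using discrete[OF assms(1)] assms nth_eq_iff_index_eq[of "map fst (measures I ! i)" k k']
    by (auto simp: discrete_prob_def supp_pt_def len_def)
qed

definition inp :: "state \<Rightarrow> bool" where
  "inp s \<longleftrightarrow> nats s 0 = nats (init_state (encode_input I)) 0 \<and> rats s 0 = rats (init_state (encode_input I)) 0"

lemma inp_nats:
  assumes "inp s"
  shows "nats s 0 0 = N" "nats s 0 1 = d" "nats s 0 (Suc 0) = d" "i < N \<Longrightarrow> nats s 0 (Suc (Suc i)) = len i"
  using assms by (auto simp: inp_def init_state_def encode_input_def len_def)

lemma inp_weight:
  assumes "inp s" "i < N"
  shows "rats s 0 i = wt i"
  using assms valid by (auto simp: inp_def init_state_def encode_input_def wt_def valid_input_def nth_append)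

lemma inp_rats:
  assumes "inp s" "i < N" "k < len i" "c \<le> d"
  shows "rats s 0 (off i + k * (d + 1) + c) = (if c < d then pts i k c else ms i k)"
proof -
  let ?f = "map flat (measures I)"
  have lf: "length (?f ! i') = len i' * (d + 1)" if "i' < N" for i'
    using that length_supp by (simp add: len_def length_flat[of _ d])
  have kc: "k * (d + 1) + c < length (?f ! i)"
    "?f ! i ! (k * (d + 1) + c) = (if c < d then pts i k c else ms i k)"
    using flat_nth[of "measures I ! i" d k c] length_supp assms by (auto simp: len_def pts_def ms_def)
  have "(\<Sum>i'<i. length (?f ! i')) = (\<Sum>i'<i. len i' * (d + 1))"
    using lf assms(2) by (intro sum.cong) auto
  then have o: "off i + k * (d + 1) + c = length (weights I) + ((\<Sum>i'<i. length (?f ! i')) + (k * (d + 1) + c))"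
    using valid by (simp add: off_def valid_input_def)
  have "i < length ?f" using assms by simp
  from concat_nth_prefix[OF this kc(1)] show ?thesis
    using assms(1) kc(2) unfolding o
    by (simp add: inp_def init_state_def encode_input_def nth_append)
qed

text \<open>Running times are polynomial in the largest size, but the bound is to be in the number
  of entries. The dimension is the critical size: it is covered because there is a measure, and it
  has a point, whose coordinates are all listed.\<close>

lemma sizes_le_entries: "nats (init_state (encode_input I)) 0 i \<le> entries (encode_input I)"
proof -
  let ?e = "entries (encode_input I)" and ?f = "map flat (measures I)"
  have e: "?e = 2 + N + length (weights I) + length (concat ?f)"
    by (simp add: entries_def encode_input_def)
  have l: "len i * (d + 1) \<le> length (concat ?f)" if "i < N" for i
  proof -
    have "length (?f ! i) = len i * (d + 1)"
      using that length_supp by (simp add: len_def length_flat[of _ d])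
    moreover have "length (?f ! i) \<in> set (map length ?f)" using that by auto
    then have "length (?f ! i) \<le> sum_list (map length ?f)" by (rule member_le_sum_list) simp
    ultimately show ?thesis by (simp add: length_concat)
  qed
  have "1 * (d + 1) \<le> len 0 * (d + 1)"
    using len_pos[OF N_pos] by (intro mult_right_mono) auto
  from order_trans[OF this l[OF N_pos]] have "d \<le> ?e" unfolding e by simp
  moreover have "len i \<le> ?e" if "i < N" for i
  proof -
    have "len i \<le> len i * (d + 1)" by simp
    then show ?thesis using l[OF that] unfolding e by simp
  qed
  ultimately show ?thesis
    using e by (auto simp: init_state_def encode_input_def len_def nth_Cons split: nat.split)
qed

end

abbreviation coordE :: "nexp \<Rightarrow> nexp \<Rightarrow> nexp \<Rightarrow> rexp" where
  "coordE i k c \<equiv> RGet 0 (NAdd (NAdd (NGet 1 i) (NMul k (NAdd dimE (NConst 1)))) c)"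
abbreviation massE :: "nexp \<Rightarrow> nexp \<Rightarrow> rexp" where
  "massE i k \<equiv> coordE i k dimE"

definition offsets :: prog where
  "offsets = PNSet 1 (NConst 0) numE ;;
    PFor 2 numE (PNSet 1 (NAdd (nvar 2) (NConst 1))
      (NAdd (NGet 1 (nvar 2)) (NMul (lenE (nvar 2)) (NAdd dimE (NConst 1)))))"

lemma writes_offsets [simp]: "nwrites offsets = {1, 2}" "rwrites offsets = {}"
  by (auto simp: offsets_def)

context barycenter_input
begin

definition ready :: "state \<Rightarrow> bool" where
  "ready s \<longleftrightarrow> inp s \<and> (\<forall>i<N. nats s 1 i = off i)"

lemma ready_agrees: "ready s \<Longrightarrow> agrees A B s t \<Longrightarrow> 0 \<notin> A \<Longrightarrow> 1 \<notin> A \<Longrightarrow> 0 \<notin> B \<Longrightarrow> ready t"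
  by (auto simp: ready_def inp_def agrees_def)

lemma ready_nset [simp]: "a \<noteq> 0 \<Longrightarrow> a \<noteq> 1 \<Longrightarrow> ready (nset s a i x) = ready s"
  and ready_rset [simp]: "a \<noteq> 0 \<Longrightarrow> ready (rset s a i q) = ready s"
  by (auto simp: ready_def inp_def)

lemma ready_nats:
  assumes "ready s"
  shows "nats s 0 0 = N" "nats s 0 (Suc 0) = d" "i < N \<Longrightarrow> nats s 0 (Suc (Suc i)) = len i"
  using inp_nats assms by (auto simp: ready_def)

lemma ready_wt: "ready s \<Longrightarrow> i < N \<Longrightarrow> rats s 0 i = wt i"
  using inp_weight by (auto simp: ready_def)

lemma ready_pts:
  assumes "ready s" "i < N" "k < len i"
  shows "c < d \<Longrightarrow> rats s 0 (nats s (Suc 0) i + (k + k * d) + c) = pts i k c"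
    and "rats s 0 (nats s (Suc 0) i + (k + k * d) + d) = ms i k"
  using inp_rats[of s i k c] inp_rats[of s i k d] assms by (auto simp: ready_def)

lemma offsets:
  assumes "inp s"
  shows "ready (ev offsets s)"
proof -
  define ok where "ok k t \<longleftrightarrow> (\<forall>i\<le>k. nats t 1 i = off i)" for k and t :: state
  let ?s = "nset s 1 0 N"
  have "ok N (ev (PFor 2 numE (PNSet 1 (NAdd (nvar 2) (NConst 1))
      (NAdd (NGet 1 (nvar 2)) (NMul (lenE (nvar 2)) (NAdd dimE (NConst 1)))))) ?s)"
  proof (rule ev_for_agrees[where P = ok], goal_cases)
    case (3 k t)
    have "nats t 0 = nats s 0" using agrees_nats[OF 3(2), of 0] by simp
    then show ?case using 3(1,3) inp_nats[OF assms] by (auto simp: ok_def le_Suc_eq off_def)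
  qed (use inp_nats[OF assms] in \<open>auto simp: ok_def off_def\<close>)
  then have "ok N (ev offsets s)" using inp_nats[OF assms] by (simp add: offsets_def)
  moreover have "inp (ev offsets s)" using assms by (simp add: inp_def nats_ev rats_ev)
  ultimately show ?thesis by (simp add: ready_def ok_def)
qed

end

section \<open>All pairwise optimal transports\<close>

text \<open>Costs are squared distances and therefore rational. The initial plan is the product of
  the masses.\<close>

definition cost_cell :: prog where
  "cost_cell = PRSet 1 (encE (nvar 4) (nvar 5)) (RConst 0) ;;
    PFor 6 dimE (PRSet 1 (encE (nvar 4) (nvar 5)) (RAdd (get2 1 (nvar 4) (nvar 5))
      (RMul (RSub (coordE (nvar 2) (nvar 4) (nvar 6)) (coordE (nvar 3) (nvar 5) (nvar 6)))
        (RSub (coordE (nvar 2) (nvar 4) (nvar 6)) (coordE (nvar 3) (nvar 5) (nvar 6)))))) ;;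
    PRSet 2 (encE (nvar 4) (nvar 5)) (RMul (massE (nvar 2) (nvar 4)) (massE (nvar 3) (nvar 5)))"

definition pair_init :: prog where
  "pair_init = PFor 4 rowsE (PFor 5 colsE cost_cell)"

definition phaseE :: "nexp \<Rightarrow> nexp \<Rightarrow> nexp" where
  "phaseE n m = NMul (NMul (NMul (NConst 2) n) (NAdd (NMul (NConst 2) (NMul n n)) (NConst 3)))
    (NAdd (NMul n m) (NConst 1))"

definition stepsE :: "nexp \<Rightarrow> nexp \<Rightarrow> nexp" where
  "stepsE n m = NAdd (NMul (NAdd (NMul n m) (NConst 1)) (phaseE n m)) (NConst 1)"

lemma nval_stepsE [simp]: "nval s (stepsE n m) = num_steps (nval s n) (nval s m)"
  by (simp add: stepsE_def phaseE_def num_steps_def phase_length_def power2_eq_square)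

definition optimize :: prog where
  "optimize = PFor 7 (stepsE rowsE colsE) cancel_prog"

text \<open>Array 7 keeps the plans of all pairs, as those of the base measure, not known yet, will
  be glued. Cell \<open>i\<close> of array 8 accumulates the weighted cost of measure
  \<open>i\<close> as a base.\<close>

definition store_cell :: prog where
  "store_cell = PRSet 7 (encE (encE (nvar 2) (nvar 3)) (encE (nvar 4) (nvar 5))) (get2 2 (nvar 4) (nvar 5)) ;;
    PRSet 8 (nvar 2) (RAdd (RGet 8 (nvar 2))
      (RMul (RGet 0 (nvar 3)) (RMul (get2 1 (nvar 4) (nvar 5)) (get2 2 (nvar 4) (nvar 5)))))"

definition pair_prog :: prog where
  "pair_prog = pair_init ;; optimize ;; PFor 4 rowsE (PFor 5 colsE store_cell)"

definition all_pairs :: prog where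
  "all_pairs = PFor 2 numE (PRSet 8 (nvar 2) (RConst 0) ;; PFor 3 numE pair_prog)"

lemma writes_cost_cell [simp]: "nwrites cost_cell = {6}" "rwrites cost_cell = {1, 2}"
  and writes_pair_init [simp]: "nwrites pair_init = {4, 5, 6}" "rwrites pair_init = {1, 2}"
  and writes_optimize [simp]: "nwrites optimize = {5, 7, 8, 9, 10, 11, 12, 13, 14, 15, 16}"
    "rwrites optimize = {2, 3, 4, 5, 6}"
  and writes_store_cell [simp]: "nwrites store_cell = {}" "rwrites store_cell = {7, 8}"
  and writes_pair_prog [simp]: "nwrites pair_prog = {4, 5, 6, 7, 8, 9, 10, 11, 12, 13, 14, 15, 16}"
    "rwrites pair_prog = {1, 2, 3, 4, 5, 6, 7, 8}"
  and writes_all_pairs [simp]: "nwrites all_pairs = {2, 3, 4, 5, 6, 7, 8, 9, 10, 11, 12, 13, 14, 15, 16}"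
    "rwrites all_pairs = {1, 2, 3, 4, 5, 6, 7, 8}"
  by (auto simp: cost_cell_def pair_init_def optimize_def store_cell_def pair_prog_def all_pairs_def)

context barycenter_input
begin

definition sq :: "nat \<Rightarrow> nat \<Rightarrow> nat \<Rightarrow> nat \<Rightarrow> rat" where
  "sq i j k l = (\<Sum>c<d. (pts i k c - pts j l c) * (pts i k c - pts j l c))"

lemma cost_cell:
  assumes "ready s" "nats s 2 0 = i" "nats s 3 0 = j" "nats s 4 0 = k" "nats s 5 0 = l"
    "i < N" "j < N" "k < len i" "l < len j"
  shows "rats (ev cost_cell s) 1 = (rats s 1)(enc k l := sq i j k l)"
    and "rats (ev cost_cell s) 2 = (rats s 2)(enc k l := ms i k * ms j l)"
proof -
  let ?s = "rset s 1 (enc k l) 0"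
  let ?p = "PRSet 1 (encE (nvar 4) (nvar 5)) (RAdd (get2 1 (nvar 4) (nvar 5))
      (RMul (RSub (coordE (nvar 2) (nvar 4) (nvar 6)) (coordE (nvar 3) (nvar 5) (nvar 6)))
        (RSub (coordE (nvar 2) (nvar 4) (nvar 6)) (coordE (nvar 3) (nvar 5) (nvar 6)))))"
  define F where "F c q = q + (pts i k c - pts j l c) * (pts i k c - pts j l c)" for c q
  note rd = ready_nats[OF assms(1)] ready_pts[OF assms(1)]
  have "ev (PFor 6 dimE ?p) ?s = nset (rset ?s 1 (enc k l) (fold F [0..<nval ?s dimE] (rats ?s 1 (enc k l)))) 6 0 (nval ?s dimE)"
    by (rule ev_for_rat_cell) (use assms rd in \<open>simp add: F_def rset_nset\<close>)
  moreover have "F = (\<lambda>c q. q + (pts i k c - pts j l c) * (pts i k c - pts j l c))"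
    by (intro ext) (simp add: F_def)
  then have "fold F [0..<nval ?s dimE] (rats ?s 1 (enc k l)) = sq i j k l"
    using rd by (simp add: fold_add sq_def)
  moreover have "nval ?s dimE = d" using rd by simp
  ultimately have e: "ev (PFor 6 dimE ?p) ?s = nset (rset s 1 (enc k l) (sq i j k l)) 6 0 d"
    by (simp only: rset_rset)
  show "rats (ev cost_cell s) 1 = (rats s 1)(enc k l := sq i j k l)"
    "rats (ev cost_cell s) 2 = (rats s 2)(enc k l := ms i k * ms j l)"
    unfolding cost_cell_def using e assms rd by simp_all
qed

lemma pair_init:
  assumes s: "ready s" "nats s 2 0 = i" "nats s 3 0 = j" and ij: "i < N" "j < N"
  shows "\<forall>k<len i. \<forall>l<len j. rats (ev pair_init s) 1 (enc k l) = sq i j k l \<and>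
    rats (ev pair_init s) 2 (enc k l) = ms i k * ms j l"
proof -
  define H where "H S t \<longleftrightarrow> (\<forall>(k, l)\<in>S. rats t 1 (enc k l) = sq i j k l \<and> rats t 2 (enc k l) = ms i k * ms j l)"
    for S and t :: state
  have "H (Sigma {..<len i} (\<lambda>_. {..<len j})) (ev pair_init s)"
    unfolding pair_init_def
  proof (rule ev_pairs, goal_cases)
    case (2 t)
    then show ?case using s ij ready_nats[OF s(1)] agrees_nats[OF 2(1), of 0] agrees_nats[OF 2(1), of 3] by simp
  next
    case (8 S t k l)
    have t: "ready t" "nats t 2 0 = i" "nats t 3 0 = j"
      using s ready_agrees[OF s(1) 8(1)] agrees_nats[OF 8(1), of 2] agrees_nats[OF 8(1), of 3] by auto
    from cost_cell[OF t 8(2,3) ij 8(4,5)] show ?case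
      using 8(8) by (auto simp: H_def)
  qed (use s ij ready_nats[OF s(1)] in \<open>auto simp: H_def\<close>)
  then show ?thesis by (auto simp: H_def)
qed

lemma optimize:
  assumes s: "ready s" "nats s 2 0 = i" "nats s 3 0 = j" and ij: "i < N" "j < N"
    and c: "\<And>k l. k < len i \<Longrightarrow> l < len j \<Longrightarrow> rats s 1 (enc k l) = sq i j k l"
    and plan: "plan (len i) (len j) (ms i) (ms j) (\<lambda>k l. rats s 2 (enc k l))"
  defines "y \<equiv> \<lambda>k l. rats (ev optimize s) 2 (enc k l)"
  shows "plan (len i) (len j) (ms i) (ms j) y \<and> (\<exists>p. eps_opt (len i) (len j) (sq i j) 0 p y)"
proof -
  let ?n = "len i" and ?m = "len j"
  let ?c = "\<lambda>k l. rats s 1 (enc k l)"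
  let ?y = "\<lambda>t k l. rats t 2 (enc k l)"
  \<comment> \<open>The invariant carries the history of plans, since optimality after the last step
    is a statement about the whole sequence.\<close>
  define ok where "ok T t \<longleftrightarrow> (\<exists>ys es. ys 0 = ?y s \<and> ys T = ?y t \<and>
    (\<forall>q<T. cancel_step ?n ?m ?c (ys q) (es q) (ys (Suc q))))" for T and t :: state
  have sizes: "nval s rowsE = ?n" "nval s colsE = ?m" using s ij ready_nats[OF s(1)] by auto
  have ok_seq: "cancel_sequence ?n ?m T ?c (ms i) (ms j) ys es"
    if "ys 0 = ?y s" "\<forall>q<T. cancel_step ?n ?m ?c (ys q) (es q) (ys (Suc q))" for T ys es
    using that plan len_pos[OF ij(1)] by unfold_locales auto
  have "ok (num_steps ?n ?m) (ev optimize s)"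
    unfolding optimize_def
  proof (rule ev_for_agrees[where P = ok], goal_cases)
    case 1
    then show ?case by (auto simp: ok_def intro!: exI[of _ "\<lambda>_. ?y s"])
  next
    case 2
    then show ?case using sizes by simp
  next
    case (3 T t)
    from 3(3) obtain ys es where ys: "ys 0 = ?y s" "ys T = ?y t"
      "\<forall>q<T. cancel_step ?n ?m ?c (ys q) (es q) (ys (Suc q))" by (auto simp: ok_def)
    interpret cancel_sequence ?n ?m T ?c "ms i" "ms j" ys es by (rule ok_seq) (use ys in auto)
    let ?t = "nset t 7 0 T"
    have same: "nats t a = nats s a" if "a \<in> {0, 2, 3}" for a
      using agrees_nats[OF 3(2), of a] that by auto
    have c_same: "rats t 1 = rats s 1" using agrees_rats[OF 3(2), of 1] by simp
    have "\<exists>e. cancel_step ?n ?m (\<lambda>k l. rats ?t 1 (enc k l)) (?y ?t) e (?y (ev cancel_prog ?t))"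
    proof (rule cancel_prog)
      show "nval ?t rowsE = ?n" "nval ?t colsE = ?m" using sizes same by auto
      show "plan ?n ?m (ms i) (ms j) (?y ?t)" using plans[of T] ys(2) by simp
    qed (use ms_pos ij len_pos in auto)
    then obtain e where e: "cancel_step ?n ?m ?c (ys T) e (?y (ev cancel_prog ?t))"
      using ys(2) c_same by auto
    let ?ys = "ys(Suc T := ?y (ev cancel_prog ?t))" and ?es = "es(T := e)"
    have "?ys 0 = ?y s" "?ys (Suc T) = ?y (ev cancel_prog ?t)"
      "\<forall>q<Suc T. cancel_step ?n ?m ?c (?ys q) (?es q) (?ys (Suc q))"
      using ys e by (auto simp: less_Suc_eq)
    then show ?case unfolding ok_def by blast
  qed (simp add: ok_def)
  then obtain ys es where ys: "ys 0 = ?y s" "ys (num_steps ?n ?m) = y"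
    "\<forall>q<num_steps ?n ?m. cancel_step ?n ?m ?c (ys q) (es q) (ys (Suc q))"
    by (auto simp: ok_def y_def)
  interpret cancel_sequence ?n ?m "num_steps ?n ?m" ?c "ms i" "ms j" ys es
    by (rule ok_seq) (use ys in auto)
  obtain p where "eps_opt ?n ?m ?c 0 p y" using optimal_at_end ys(2) by auto
  then have "eps_opt ?n ?m (sq i j) 0 p y" using c by (auto simp: eps_opt_def)
  then show ?thesis using plans[of "num_steps ?n ?m"] ys(2) by auto
qed

lemma pair_prog:
  assumes s: "ready s" "nats s 2 0 = i" "nats s 3 0 = j" and ij: "i < N" "j < N"
  defines "s' \<equiv> ev pair_prog s"
  defines "Y \<equiv> \<lambda>k l. rats s' 7 (enc (enc i j) (enc k l))"
  shows "plan (len i) (len j) (ms i) (ms j) Y \<and> (\<exists>p. eps_opt (len i) (len j) (sq i j) 0 p Y)"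
    and "rats s' 8 = (rats s 8)(i := rats s 8 i + wt j * (\<Sum>k<len i. \<Sum>l<len j. sq i j k l * Y k l))"
    and "\<And>q z. q \<noteq> enc i j \<Longrightarrow> rats s' 7 (enc q z) = rats s 7 (enc q z)"
proof -
  define s1 where "s1 = ev pair_init s"
  define s2 where "s2 = ev optimize s1"
  have a1: "agrees {4, 5, 6} {1, 2} s s1" using agrees_ev[of pair_init s] by (simp add: s1_def)
  have a2: "agrees (nwrites optimize) (rwrites optimize) s1 s2" unfolding s2_def by (rule agrees_ev)
  note init = pair_init[OF s ij, folded s1_def]
  have r1: "ready s1" "nats s1 2 0 = i" "nats s1 3 0 = j"
    using ready_agrees[OF s(1) a1] agrees_nats[OF a1] s by auto
  have r2: "ready s2" "nats s2 2 0 = i" "nats s2 3 0 = j"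
    using ready_agrees[OF r1(1) a2] agrees_nats[OF a2] r1 by auto
  have "plan (len i) (len j) (ms i) (ms j) (\<lambda>k l. rats s1 2 (enc k l))"
    unfolding plan_def
  proof (intro conjI allI impI)
    fix k assume k: "k < len i"
    have "(\<Sum>l<len j. rats s1 2 (enc k l)) = (\<Sum>l<len j. ms i k * ms j l)" using init k by simp
    then show "(\<Sum>l<len j. rats s1 2 (enc k l)) = ms i k"
      using ms_sum[OF ij(2)] by (simp add: sum_distrib_left[symmetric])
  next
    fix l assume l: "l < len j"
    have "(\<Sum>k<len i. rats s1 2 (enc k l)) = (\<Sum>k<len i. ms i k * ms j l)" using init l by simp
    then show "(\<Sum>k<len i. rats s1 2 (enc k l)) = ms j l"
      using ms_sum[OF ij(1)] by (simp add: sum_distrib_right[symmetric])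
  next
    fix k l assume kl: "k < len i" "l < len j"
    then show "0 \<le> rats s1 2 (enc k l)"
      using init ms_pos[OF ij(1) kl(1)] ms_pos[OF ij(2) kl(2)] by simp
  qed
  note opt = optimize[OF r1 ij _ this, folded s2_def]
  define y where "y = (\<lambda>k l. rats s2 2 (enc k l))"
  have y: "plan (len i) (len j) (ms i) (ms j) y \<and> (\<exists>p. eps_opt (len i) (len j) (sq i j) 0 p y)"
    unfolding y_def by (rule opt) (use init in simp)
  have c2: "rats s2 1 (enc k l) = sq i j k l" if "k < len i" "l < len j" for k l
    using init that agrees_rats[OF a2, of 1] by simp
  define H where "H S t \<longleftrightarrow> finite S \<and> (\<forall>(k, l)\<in>S. rats t 7 (enc (enc i j) (enc k l)) = y k l) \<and>
    (\<forall>q z. q \<noteq> enc i j \<longrightarrow> rats t 7 (enc q z) = rats s 7 (enc q z)) \<and>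
    rats t 8 = (rats s 8)(i := rats s 8 i + wt j * (\<Sum>(k, l)\<in>S. sq i j k l * y k l))" for S and t :: state
  have "H (Sigma {..<len i} (\<lambda>_. {..<len j})) (ev (PFor 4 rowsE (PFor 5 colsE store_cell)) s2)"
  proof (rule ev_pairs, goal_cases)
    case (2 t)
    then show ?case
      using r2 ij ready_nats[OF r2(1)] agrees_nats[OF 2(1), of 0] agrees_nats[OF 2(1), of 3] by simp
  next
    case 7
    show ?case using agrees_rats[OF a1] agrees_rats[OF a2] by (simp add: H_def)
  next
    case (8 S t k l)
    have t: "ready t" "nats t 2 0 = i" "nats t 3 0 = j"
      using r2 ready_agrees[OF r2(1) 8(1)] agrees_nats[OF 8(1), of 2] agrees_nats[OF 8(1), of 3] by auto
    have "rats t 1 (enc k l) = sq i j k l" "rats t 2 (enc k l) = y k l"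
      using c2[OF 8(4,5)] agrees_rats[OF 8(1)] by (auto simp: y_def)
    then show ?case
      using 8(2,3,6,8) t ready_wt[OF t(1) ij(2)]
      by (auto simp: H_def store_cell_def algebra_simps)
  qed (use r2 ij ready_nats[OF r2(1)] in \<open>auto simp: H_def\<close>)
  then have H: "H (Sigma {..<len i} (\<lambda>_. {..<len j})) s'"
    by (simp add: s'_def pair_prog_def s1_def s2_def)
  then have Y: "Y k l = y k l" if "k < len i" "l < len j" for k l
    using that by (auto simp: H_def Y_def)
  show "plan (len i) (len j) (ms i) (ms j) Y \<and> (\<exists>p. eps_opt (len i) (len j) (sq i j) 0 p Y)"
    using y Y by (simp add: plan_def eps_opt_def)
  show "rats s' 8 = (rats s 8)(i := rats s 8 i + wt j * (\<Sum>k<len i. \<Sum>l<len j. sq i j k l * Y k l))"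
    using H Y by (simp add: H_def sum.Sigma)
  show "\<And>q z. q \<noteq> enc i j \<Longrightarrow> rats s' 7 (enc q z) = rats s 7 (enc q z)"
    using H by (simp add: H_def)
qed

definition solved :: "(nat \<times> nat) set \<Rightarrow> state \<Rightarrow> bool" where
  "solved S s \<longleftrightarrow> (\<forall>(i, j)\<in>S. let Y = \<lambda>k l. rats s 7 (enc (enc i j) (enc k l)) in
    plan (len i) (len j) (ms i) (ms j) Y \<and> (\<exists>p. eps_opt (len i) (len j) (sq i j) 0 p Y))"

definition pair_cost :: "state \<Rightarrow> nat \<Rightarrow> nat \<Rightarrow> rat" where
  "pair_cost s i j = (\<Sum>k<len i. \<Sum>l<len j. sq i j k l * rats s 7 (enc (enc i j) (enc k l)))"

lemma solved_nset [simp]: "solved S (nset s a i x) = solved S s"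
  and pair_cost_nset [simp]: "pair_cost (nset s a i x) = pair_cost s"
  by (auto simp: solved_def pair_cost_def fun_eq_iff)

lemma solved_cong:
  assumes "\<And>i j z. (i, j) \<in> S \<Longrightarrow> rats t 7 (enc (enc i j) z) = rats s 7 (enc (enc i j) z)"
  shows "solved S t = solved S s"
  unfolding solved_def Let_def by (intro ball_cong) (auto simp: assms)

lemma pair_cost_cong:
  assumes "\<And>z. rats t 7 (enc (enc i j) z) = rats s 7 (enc (enc i j) z)"
  shows "pair_cost t i j = pair_cost s i j"
  unfolding pair_cost_def by (simp add: assms)

lemma all_pairs:
  assumes s: "ready s"
  defines "s' \<equiv> ev all_pairs s"
  shows "solved ({..<N} \<times> {..<N}) s'" "\<forall>i<N. rats s' 8 i = (\<Sum>j<N. wt j * pair_cost s' i j)"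
proof -
  define H where "H i t \<longleftrightarrow> solved ({..<i} \<times> {..<N}) t \<and> (\<forall>i'<i. rats t 8 i' = (\<Sum>j<N. wt j * pair_cost t i' j))"
    for i t
  define H2 where "H2 i j t \<longleftrightarrow> H i t \<and> solved ({i} \<times> {..<j}) t \<and> rats t 8 i = (\<Sum>j'<j. wt j' * pair_cost t i j')"
    for i j t
  have H_nset: "H i (nset t a v x) = H i t" "H2 i j (nset t a v x) = H2 i j t" for i j t a v x
    by (simp_all add: H_def H2_def)
  have "H N s'"
    unfolding s'_def all_pairs_def
  proof (rule ev_for_agrees[where P = H], goal_cases)
    case (3 i t)
    let ?t = "rset (nset t 2 0 i) 8 i 0"
    have t: "ready ?t" "nats ?t 2 0 = i" using ready_agrees[OF s 3(2)] by auto
    have "H2 i N (ev (PFor 3 numE pair_prog) ?t)"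
    proof (rule ev_for_agrees[where P = "H2 i"], goal_cases)
      case 1
      show ?case using 3(3) by (auto simp: H2_def H_def solved_def pair_cost_def)
    next
      case 2
      show ?case using ready_nats[OF t(1)] by simp
    next
      case j: (3 j t')
      let ?t' = "nset t' 3 0 j"
      have t': "ready ?t'" "nats ?t' 2 0 = i" "nats ?t' 3 0 = j"
        using ready_agrees[OF t(1) j(2)] agrees_nats[OF j(2), of 2] t(2) by auto
      note pp = pair_prog[OF t' 3(1) j(1)]
      let ?u = "ev pair_prog ?t'"
      have keep: "rats ?u 7 (enc (enc i' j') z) = rats t' 7 (enc (enc i' j') z)" if "(i', j') \<noteq> (i, j)" for i' j' z
        using pp(3)[of "enc i' j'" z] that by simp
      have pc: "pair_cost ?u i' j' = pair_cost t' i' j'" if "(i', j') \<noteq> (i, j)" for i' j'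
        by (rule pair_cost_cong) (use keep that in auto)
      have "solved ({..<i} \<times> {..<N}) ?u" "solved ({i} \<times> {..<j}) ?u"
        using j(3) keep by (auto simp: H2_def H_def intro!: solved_cong[THEN iffD2, of _ ?u t'])
      moreover have "{i} \<times> {..<Suc j} = insert (i, j) ({i} \<times> {..<j})" by (auto simp: less_Suc_eq)
      ultimately have "solved ({i} \<times> {..<Suc j}) ?u"
        using pp(1) by (simp add: solved_def Let_def)
      moreover have "rats ?u 8 i = (\<Sum>j'<Suc j. wt j' * pair_cost ?u i j')"
        using pp(2) j(3) pc by (simp add: H2_def pair_cost_def[of ?u i j])
      moreover have "\<forall>i'<i. rats ?u 8 i' = (\<Sum>j<N. wt j * pair_cost ?u i' j)"
        using pp(2) j(3) pc by (simp add: H2_def H_def)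
      ultimately show ?case using \<open>solved ({..<i} \<times> {..<N}) ?u\<close> by (simp add: H2_def H_def)
    qed (simp add: H_nset)
    moreover have "{..<Suc i} \<times> {..<N} = {..<i} \<times> {..<N} \<union> {i} \<times> {..<N}" by (auto simp: less_Suc_eq)
    ultimately show ?case by (auto simp: H2_def H_def solved_def less_Suc_eq)
  qed (use ready_nats[OF s] in \<open>simp_all add: H_nset, simp add: H_def solved_def\<close>)
  then show "solved ({..<N} \<times> {..<N}) s'" "\<forall>i<N. rats s' 8 i = (\<Sum>j<N. wt j * pair_cost s' i j)"
    by (auto simp: H_def)
qed

end

section \<open>Gluing transport plans monotonically\<close>

text \<open>
  The plans to the various measures are restricted to the mass of one fixed support point of the base
  measure; \<open>r j l\<close> is the mass bound for the point \<open>l\<close> of measure \<open>j\<close> which has not yet been assigned to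
  a tuple.  The tuples \<open>sel a\<close> with masses \<open>\<delta> a\<close> chosen so far are indexed by \<open>a \<in> S\<close>.  As each choice
  takes least remaining points, any two tuples are comparable.
\<close>

definition comparable :: "nat \<Rightarrow> (nat \<Rightarrow> nat \<Rightarrow> nat \<Rightarrow> bool) \<Rightarrow> (nat \<Rightarrow> nat) \<Rightarrow> (nat \<Rightarrow> nat) \<Rightarrow> bool" where
  "comparable N prec t t' \<longleftrightarrow> (\<exists>j<N. t j \<noteq> t' j) \<and>
    ((\<forall>j<N. \<not> prec j (t j) (t' j)) \<or> (\<forall>j<N. \<not> prec j (t' j) (t j)))"

locale glue_inv =
  fixes N :: nat and len :: "nat \<Rightarrow> nat" and prec :: "nat \<Rightarrow> nat \<Rightarrow> nat \<Rightarrow> bool"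
    and r0 :: "nat \<Rightarrow> nat \<Rightarrow> 'a::linordered_field" and S :: "'i set" and \<delta> :: "'i \<Rightarrow> 'a"
    and sel :: "'i \<Rightarrow> nat \<Rightarrow> nat" and r :: "nat \<Rightarrow> nat \<Rightarrow> 'a"
  assumes fin: "finite S"
    and r_nonneg: "\<And>j l. j < N \<Longrightarrow> l < len j \<Longrightarrow> 0 \<le> r j l"
    and total: "\<exists>m. \<forall>j<N. (\<Sum>l<len j. r j l) = m"
    and \<delta>_nonneg: "\<And>a. a \<in> S \<Longrightarrow> 0 \<le> \<delta> a"
    and sel_lt: "\<And>a j. a \<in> S \<Longrightarrow> j < N \<Longrightarrow> sel a j < len j"
    and marginal: "\<And>j l. j < N \<Longrightarrow> l < len j \<Longrightarrow> (\<Sum>a\<in>S. if sel a j = l then \<delta> a else 0) + r j l = r0 j l"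
    and least: "\<And>a j l. a \<in> S \<Longrightarrow> 0 < \<delta> a \<Longrightarrow> j < N \<Longrightarrow> l < len j \<Longrightarrow> 0 < r j l \<Longrightarrow> \<not> prec j l (sel a j)"
    and used: "\<And>a. a \<in> S \<Longrightarrow> 0 < \<delta> a \<Longrightarrow> \<exists>j<N. r j (sel a j) = 0"
    and comp: "\<And>a b. a \<in> S \<Longrightarrow> b \<in> S \<Longrightarrow> a \<noteq> b \<Longrightarrow> 0 < \<delta> a \<Longrightarrow> 0 < \<delta> b \<Longrightarrow>
      comparable N prec (sel a) (sel b)"
    and count: "card S \<le> card {(j, l). j < N \<and> l < len j \<and> r j l = 0} \<or> (\<forall>j<N. \<forall>l<len j. r j l = 0)"

lemma comparable_sym: "comparable N prec t t' \<Longrightarrow> comparable N prec t' t"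
  unfolding comparable_def by metis

lemma glue_inv_cong:
  assumes "glue_inv N len prec r0 S \<delta> sel r"
    and "\<And>a. a \<in> S \<Longrightarrow> \<delta>' a = \<delta> a" "\<And>a j. a \<in> S \<Longrightarrow> j < N \<Longrightarrow> sel' a j = sel a j"
    and "\<And>j l. j < N \<Longrightarrow> l < len j \<Longrightarrow> r' j l = r j l"
  shows "glue_inv N len prec r0 S \<delta>' sel' r'"
proof -
  interpret glue_inv N len prec r0 S \<delta> sel r by fact
  have Z: "{(j, l). j < N \<and> l < len j \<and> r' j l = 0} = {(j, l). j < N \<and> l < len j \<and> r j l = 0}"
    using assms(4) by auto
  have m: "(\<Sum>a\<in>S. if sel' a j = l then \<delta>' a else 0) = (\<Sum>a\<in>S. if sel a j = l then \<delta> a else 0)"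
    if "j < N" for j l
    using assms(2,3) that by (intro sum.cong) auto
  have c: "comparable N prec (sel' a) (sel' b) = comparable N prec (sel a) (sel b)" if "a \<in> S" "b \<in> S" for a b
    using assms(3) that by (auto simp: comparable_def)
  show ?thesis
  proof
    show "\<exists>m. \<forall>j<N. (\<Sum>l<len j. r' j l) = m" using total assms(4) by simp
    show "\<exists>j<N. r' j (sel' a j) = 0" if a: "a \<in> S" "0 < \<delta>' a" for a
    proof -
      obtain j where "j < N" "r j (sel a j) = 0" using used[of a] a assms(2) by auto
      then show ?thesis using assms(3,4) sel_lt a by auto
    qed
    show "\<not> prec j l (sel' a j)" if "a \<in> S" "0 < \<delta>' a" "j < N" "l < len j" "0 < r' j l" for a j l
      using least[of a j l] assms that by simp
    show "card S \<le> card {(j, l). j < N \<and> l < len j \<and> r' j l = 0} \<or> (\<forall>j<N. \<forall>l<len j. r' j l = 0)"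
      unfolding Z using count assms(4) by simp
  qed (use fin r_nonneg \<delta>_nonneg sel_lt marginal comp assms(2-4) m c in auto)
qed

text \<open>The mass taken is the least of the chosen remainders, so one of them becomes 0. This
  separates the tuple from all later ones of positive mass, which use positive remainders. Older
  tuples of positive mass chose minimal points among those that remain, so the new points precede
  theirs in no measure.\<close>

lemma glue_inv_step:
  fixes r :: "nat \<Rightarrow> nat \<Rightarrow> 'a::linordered_field"
  assumes inv: "glue_inv N len prec r0 S \<delta> sel r" and a: "a \<notin> S" and N: "0 < N"
    and sel: "\<And>j. j < N \<Longrightarrow> sel a j < len j"
      "\<And>j l. j < N \<Longrightarrow> l < len j \<Longrightarrow> 0 < r j l \<Longrightarrow> 0 < r j (sel a j) \<and> \<not> prec j l (sel a j)"
    and \<delta>: "\<And>j. j < N \<Longrightarrow> \<delta> a \<le> r j (sel a j)" "\<exists>j<N. \<delta> a = r j (sel a j)"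
    and r': "\<And>j l. j < N \<Longrightarrow> l < len j \<Longrightarrow> r' j l = r j l - (if l = sel a j then \<delta> a else 0)"
  shows "glue_inv N len prec r0 (insert a S) \<delta> sel r'"
proof -
  interpret glue_inv N len prec r0 S \<delta> sel r by fact
  obtain m where m: "\<And>j. j < N \<Longrightarrow> (\<Sum>l<len j. r j l) = m" using total by blast
  have \<delta>a_nonneg: "0 \<le> \<delta> a" using \<delta>(2) r_nonneg sel(1) by auto
  have r'_nonneg: "0 \<le> r' j l" if "j < N" "l < len j" for j l
    using r' r_nonneg \<delta>(1) that by auto
  have r'_le: "r' j l \<le> r j l" if "j < N" "l < len j" for j l
    using r' \<delta>a_nonneg that by simp
  obtain j0 where j0: "j0 < N" "\<delta> a = r j0 (sel a j0)" using \<delta>(2) by blast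
  have zero: "r' j0 (sel a j0) = 0" using r' j0 sel(1) by simp
  have stay: "r' j l = 0" if "r j l = 0" "j < N" "l < len j" for j l
    using r'_le[OF that(2,3)] r'_nonneg[OF that(2,3)] that(1) by simp
  have pos: "0 < r j (sel a j)" if "0 < \<delta> a" "j < N" for j using \<delta>(1)[OF that(2)] that(1) by simp
  have new: "comparable N prec (sel a) (sel b)" if b: "b \<in> S" "0 < \<delta> a" "0 < \<delta> b" for b
    unfolding comparable_def
  proof
    obtain j where "j < N" "r j (sel b j) = 0" using used b by blast
    then show "\<exists>j<N. sel a j \<noteq> sel b j" using pos[OF b(2)] by force
    show "(\<forall>j<N. \<not> prec j (sel a j) (sel b j)) \<or> (\<forall>j<N. \<not> prec j (sel b j) (sel a j))"
      using least[OF b(1,3)] pos[OF b(2)] sel(1) by blast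
  qed
  have total': "(\<Sum>l<len j. r' j l) = m - \<delta> a" if j: "j < N" for j
    using r'[OF j] sel(1)[OF j] m[OF j] by (simp add: sum_subtractf)
  \<comment> \<open>All measures have the same remaining total. While it is positive, the chosen
    remainder of \<open>j0\<close> is positive before and 0 after the step, so exhausted entries
    keep up with the tuples.\<close>
  have cnt: "card (insert a S) \<le> card {(j, l). j < N \<and> l < len j \<and> r' j l = 0} \<or> (\<forall>j<N. \<forall>l<len j. r' j l = 0)"
  proof (cases "\<forall>j<N. \<forall>l<len j. r j l = 0")
    case True
    then show ?thesis using stay by blast
  next
    case False
    then obtain j l where jl: "j < N" "l < len j" "r j l \<noteq> 0" by blast
    have "0 < r j l" using r_nonneg[OF jl(1,2)] jl(3) by simp
    then have "0 < m" using m[OF jl(1)] jl r_nonneg sum_pos2[of "{..<len j}" l "r j"] by auto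
    have "\<exists>l<len j0. 0 < r j0 l"
    proof (rule ccontr)
      assume "\<not> ?thesis"
      then have "r j0 l \<le> 0" if "l < len j0" for l using that by (meson not_less)
      then have "(\<Sum>l<len j0. r j0 l) \<le> 0" by (intro sum_nonpos) auto
      then show False using m[OF j0(1)] \<open>0 < m\<close> by simp
    qed
    then have "0 < r j0 (sel a j0)" using sel(2)[OF j0(1)] by blast
    let ?Z = "\<lambda>r. {(j, l). j < N \<and> l < len j \<and> r j l = 0}"
    have fin': "finite (?Z q)" for q :: "nat \<Rightarrow> nat \<Rightarrow> 'a"
      by (rule finite_subset[of _ "Sigma {..<N} (\<lambda>j. {..<len j})"]) auto
    have "?Z r \<subseteq> ?Z r'" using stay by auto
    moreover have "(j0, sel a j0) \<in> ?Z r' - ?Z r"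
      using zero j0(1) sel(1)[OF j0(1)] \<open>0 < r j0 (sel a j0)\<close> by simp
    ultimately have "?Z r \<subset> ?Z r'" by blast
    then have "card (?Z r) < card (?Z r')" by (intro psubset_card_mono fin')
    then show ?thesis using count False fin a by auto
  qed
  show ?thesis
  proof
    show "\<exists>m. \<forall>j<N. (\<Sum>l<len j. r' j l) = m" using total' by blast
    show "(\<Sum>b\<in>insert a S. if sel b j = l then \<delta> b else 0) + r' j l = r0 j l" if "j < N" "l < len j" for j l
      using marginal[OF that] r'[OF that] fin a by auto
    show "\<not> prec j l (sel b j)" if b: "b \<in> insert a S" "0 < \<delta> b" and jl: "j < N" "l < len j" "0 < r' j l" for b j l
    proof -
      have "0 < r j l" using r'_le[OF jl(1,2)] jl(3) by simp
      then show ?thesis using b jl sel(2) least by blast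
    qed
    show "\<exists>j<N. r' j (sel b j) = 0" if b: "b \<in> insert a S" "0 < \<delta> b" for b
    proof (cases "b = a")
      case True
      then show ?thesis using zero j0(1) by blast
    next
      case False
      then obtain j where "j < N" "r j (sel b j) = 0" using used[of b] b by blast
      then show ?thesis using stay sel_lt[of b j] b False by blast
    qed
    show "comparable N prec (sel b) (sel c)"
      if "b \<in> insert a S" "c \<in> insert a S" "b \<noteq> c" "0 < \<delta> b" "0 < \<delta> c" for b c
      using comp new comparable_sym that by blast
  qed (use fin r'_nonneg \<delta>a_nonneg \<delta>_nonneg sel(1) sel_lt cnt in auto)
qed

text \<open>With as many tuples as there are entries, \<open>count\<close> forces every remainder to
  be 0, and \<open>marginal\<close> becomes the claim.\<close>

lemma glue_inv_end:
  assumes inv: "glue_inv N len prec r0 S \<delta> sel r" and card: "card S = (\<Sum>j<N. len j)"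
    and jl: "j < N" "l < len j"
  shows "(\<Sum>a\<in>S. if sel a j = l then \<delta> a else 0) = r0 j l"
proof -
  interpret glue_inv N len prec r0 S \<delta> sel r by fact
  have "r j l = 0"
  proof (cases "\<forall>j<N. \<forall>l<len j. r j l = 0")
    case False
    let ?Z = "{(j, l). j < N \<and> l < len j \<and> r j l = 0}" and ?A = "Sigma {..<N} (\<lambda>j. {..<len j})"
    have "card ?A \<le> card ?Z" using False card count by auto
    moreover have "?Z \<subseteq> ?A" by auto
    ultimately have "?Z = ?A" by (intro card_seteq) auto
    then have "(j, l) \<in> ?Z" using jl by simp
    then show ?thesis by simp
  qed (use jl in blast)
  then show ?thesis using marginal[OF jl] by simp
qed

lemma glue_inv_start:
  assumes "\<And>j l. j < N \<Longrightarrow> l < len j \<Longrightarrow> 0 \<le> r j l" "\<And>j. j < N \<Longrightarrow> (\<Sum>l<len j. r j l) = m"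
  shows "glue_inv N len prec r {} \<delta> sel r"
  by unfold_locales (use assms in auto)

section \<open>The lexicographic order and the choice of the base measure\<close>

context barycenter_input
begin

definition lexless :: "nat \<Rightarrow> nat \<Rightarrow> nat \<Rightarrow> bool" where
  "lexless i k l \<longleftrightarrow> (\<exists>c<d. pts i k c < pts i l c \<and> (\<forall>c'<c. pts i k c' = pts i l c'))"

lemma lexless_irrefl: "\<not> lexless i k k"
  by (simp add: lexless_def)

lemma lexless_trans:
  assumes "lexless i k l" "lexless i l m"
  shows "lexless i k m"
proof -
  obtain c where c: "c < d" "pts i k c < pts i l c" "\<forall>c'<c. pts i k c' = pts i l c'"
    using assms(1) by (auto simp: lexless_def)
  obtain c2 where c2: "c2 < d" "pts i l c2 < pts i m c2" "\<forall>c'<c2. pts i l c' = pts i m c'"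
    using assms(2) by (auto simp: lexless_def)
  show ?thesis
    unfolding lexless_def
  proof (intro exI[of _ "min c c2"] conjI)
    show "pts i k (min c c2) < pts i m (min c c2)"
      using c c2 by (cases c c2 rule: linorder_cases) (auto simp: min_def)
  qed (use c c2 in \<open>auto simp: min_def\<close>)
qed

text \<open>In the first coordinate in which some points of comparable tuples differ, all differences have the
  same sign.\<close>

lemma comparable_means:
  assumes comp: "comparable N lexless t t'" and t: "\<And>j. j < N \<Longrightarrow> t j < len j" "\<And>j. j < N \<Longrightarrow> t' j < len j"
  shows "\<exists>c<d. (\<Sum>j<N. wt j * pts j (t j) c) \<noteq> (\<Sum>j<N. wt j * pts j (t' j) c)"
proof -
  have main: "\<exists>c<d. (\<Sum>j<N. wt j * pts j (t j) c) < (\<Sum>j<N. wt j * pts j (t' j) c)"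
    if ne: "\<exists>j<N. t j \<noteq> t' j" and le: "\<forall>j<N. \<not> lexless j (t' j) (t j)"
      and t: "\<And>j. j < N \<Longrightarrow> t j < len j" "\<And>j. j < N \<Longrightarrow> t' j < len j" for t t'
  proof -
    define diff where "diff c \<longleftrightarrow> c < d \<and> (\<exists>j<N. pts j (t j) c \<noteq> pts j (t' j) c)" for c
    have "\<exists>c. diff c" using ne pts_inj t unfolding diff_def by blast
    define c where "c = (LEAST c. diff c)"
    have c: "diff c" unfolding c_def using \<open>\<exists>c. diff c\<close> by (rule LeastI_ex)
    have before: "pts j (t j) c' = pts j (t' j) c'" if "j < N" "c' < c" for j c'
    proof -
      have "\<not> diff c'" using that(2) unfolding c_def by (rule not_less_Least)
      moreover have "c' < d" using that c by (auto simp: diff_def)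
      ultimately show ?thesis using that(1) by (auto simp: diff_def)
    qed
    have "pts j (t j) c \<le> pts j (t' j) c" if "j < N" for j
    proof (rule ccontr)
      assume "\<not> ?thesis"
      then have "lexless j (t' j) (t j)"
        unfolding lexless_def using c before[OF that] by (intro exI[of _ c]) (auto simp: diff_def)
      then show False using le that by blast
    qed
    moreover obtain j where j: "j < N" "pts j (t j) c \<noteq> pts j (t' j) c" using c by (auto simp: diff_def)
    ultimately have "(\<Sum>j<N. wt j * pts j (t j) c) < (\<Sum>j<N. wt j * pts j (t' j) c)"
      using wt_pos by (intro sum_strict_mono_ex1) (auto intro!: mult_left_mono mult_strict_left_mono
          less_imp_le bexI[of _ j] simp: order.not_eq_order_implies_strict)
    then show ?thesis using c by (auto simp: diff_def)
  qed
  have ne: "\<exists>j<N. t j \<noteq> t' j" "\<exists>j<N. t' j \<noteq> t j" using comp by (auto simp: comparable_def)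
  show ?thesis
  proof (cases "\<forall>j<N. \<not> lexless j (t' j) (t j)")
    case True
    from main[OF ne(1) this t] show ?thesis by force
  next
    case False
    then have "\<forall>j<N. \<not> lexless j (t j) (t' j)" using comp by (auto simp: comparable_def)
    from main[OF ne(2) this t(2,1)] show ?thesis by force
  qed
qed

end

text \<open>An entry is 0 while the coordinates compared so far agree, 1 once the first point is
  found smaller and 2 once it is found larger. With the table a later comparison is a single test,
  which fits into a condition.\<close>

definition lex_cell :: prog where
  "lex_cell = PNSet 24 (encE (nvar 2) (encE (nvar 4) (nvar 5))) (NConst 0) ;;
    PFor 6 dimE (PIf (NLess (nget3 24 (nvar 2) (nvar 4) (nvar 5)) (NConst 1))
      (PIf (RLess (coordE (nvar 2) (nvar 4) (nvar 6)) (coordE (nvar 2) (nvar 5) (nvar 6)))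
        (PNSet 24 (encE (nvar 2) (encE (nvar 4) (nvar 5))) (NConst 1))
        (PIf (RLess (coordE (nvar 2) (nvar 5) (nvar 6)) (coordE (nvar 2) (nvar 4) (nvar 6)))
          (PNSet 24 (encE (nvar 2) (encE (nvar 4) (nvar 5))) (NConst 2)) PSkip)) PSkip)"

definition lex_table :: prog where
  "lex_table = PFor 2 numE (PFor 4 rowsE (PFor 5 rowsE lex_cell))"

definition choose_base :: prog where
  "choose_base = PNSet 17 (NConst 0) (NConst 0) ;;
    PFor 2 numE (PIf (RLess (RGet 8 (nvar 2)) (RGet 8 (nvar 17))) (PNSet 17 (NConst 0) (nvar 2)) PSkip)"

lemma writes_lex_cell [simp]: "nwrites lex_cell = {6, 24}" "rwrites lex_cell = {}"
  and writes_lex_table [simp]: "nwrites lex_table = {2, 4, 5, 6, 24}" "rwrites lex_table = {}"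
  and writes_choose_base [simp]: "nwrites choose_base = {2, 17}" "rwrites choose_base = {}"
  by (auto simp: lex_cell_def lex_table_def choose_base_def)

context barycenter_input
begin

lemma choose_base:
  assumes "ready s"
  defines "b \<equiv> nats (ev choose_base s) 17 0"
  shows "b < N" "\<And>i. i < N \<Longrightarrow> rats s 8 b \<le> rats s 8 i"
proof -
  define key where "key i = rats s 8 i" for i
  define r where "r = fold (\<lambda>x c. if True \<and> (True \<longrightarrow> key x < key c) then x else c) [0..<N] 0"
  let ?s = "nset s 17 0 0"
  have "ev (PFor 2 numE (PIf (RLess (RGet 8 (nvar 2)) (RGet 8 (nvar 17))) (PNSet 17 (NConst 0) (nvar 2)) PSkip)) ?s =
    nset (nset ?s 17 0 (fold (\<lambda>x c. if True \<and> (True \<longrightarrow> key x < key c) then x else c) [0..<nval ?s numE] (nats ?s 17 0))) 2 0 (nval ?s numE)"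
    by (rule ev_for_argmin) (auto simp: key_def)
  then have "b = r" using ready_nats[OF assms(1)] by (simp add: b_def choose_base_def r_def)
  moreover note am = fold_argmin[of "\<lambda>x z. key x < key z" r "\<lambda>_. True" N, OF _ _ r_def N_pos]
  ultimately show "b < N" "\<And>i. i < N \<Longrightarrow> rats s 8 b \<le> rats s 8 i" using am by (auto simp: key_def not_less)
qed

definition lexed :: "state \<Rightarrow> bool" where
  "lexed s \<longleftrightarrow> (\<forall>i<N. \<forall>k<len i. \<forall>l<len i. nats s 24 (enc i (enc k l)) = 1 \<longleftrightarrow> lexless i k l)"

lemma lex_cell:
  assumes s: "ready s" "nats s 2 0 = i" "nats s 4 0 = k" "nats s 5 0 = l" and i: "i < N" "k < len i" "l < len i"
  shows "nats (ev lex_cell s) 24 (enc i (enc k l)) = 1 \<longleftrightarrow> lexless i k l"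
    and "\<And>z. z \<noteq> enc i (enc k l) \<Longrightarrow> nats (ev lex_cell s) 24 z = nats s 24 z"
proof -
  let ?i = "enc i (enc k l)"
  let ?s = "nset s 24 ?i 0"
  let ?p = "PIf (NLess (nget3 24 (nvar 2) (nvar 4) (nvar 5)) (NConst 1))
      (PIf (RLess (coordE (nvar 2) (nvar 4) (nvar 6)) (coordE (nvar 2) (nvar 5) (nvar 6)))
        (PNSet 24 (encE (nvar 2) (encE (nvar 4) (nvar 5))) (NConst 1))
        (PIf (RLess (coordE (nvar 2) (nvar 5) (nvar 6)) (coordE (nvar 2) (nvar 4) (nvar 6)))
          (PNSet 24 (encE (nvar 2) (encE (nvar 4) (nvar 5))) (NConst 2)) PSkip)) PSkip"
  define F :: "nat \<Rightarrow> nat \<Rightarrow> nat" where "F c q = (if q < 1 then if pts i k c < pts i l c then 1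
    else if pts i l c < pts i k c then 2 else q else q)" for c q
  note rd = ready_nats[OF s(1)] ready_pts[OF s(1)]
  have "ev (PFor 6 dimE ?p) ?s = nset (nset ?s 24 ?i (fold F [0..<nval ?s dimE] (nats ?s 24 ?i))) 6 0 (nval ?s dimE)"
    by (rule ev_for_nat_cell) (use s i rd in \<open>auto simp: F_def nset_commute[of 6 24]\<close>)
  moreover have "nval ?s dimE = d" using rd by simp
  ultimately have e: "ev (PFor 6 dimE ?p) ?s = nset (nset s 24 ?i (fold F [0..<d] 0)) 6 0 d"
    by simp
  have "(fold F [0..<n] 0 = 1 \<longleftrightarrow> (\<exists>c<n. pts i k c < pts i l c \<and> (\<forall>c'<c. pts i k c' = pts i l c'))) \<and>
    (fold F [0..<n] 0 = 0 \<longleftrightarrow> (\<forall>c<n. pts i k c = pts i l c))" for n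
  proof (induction n)
    case (Suc n)
    let ?f = "fold F [0..<n] 0"
    have f: "fold F [0..<Suc n] 0 = F n ?f" by simp
    show ?case
    proof (cases "?f = 0")
      case True
      then have eq: "\<forall>c<n. pts i k c = pts i l c" using Suc by blast
      then have "(\<exists>c<Suc n. pts i k c < pts i l c \<and> (\<forall>c'<c. pts i k c' = pts i l c')) \<longleftrightarrow> pts i k n < pts i l n"
        by (auto simp: less_Suc_eq)
      moreover have "(\<forall>c<Suc n. pts i k c = pts i l c) \<longleftrightarrow> pts i k n = pts i l n"
        using eq by (auto simp: less_Suc_eq)
      ultimately show ?thesis unfolding f using True by (auto simp: F_def)
    next
      case False
      then have "F n ?f = ?f" by (simp add: F_def)
      moreover have "\<not> (\<forall>c<n. pts i k c = pts i l c)" using Suc False by blast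
      then have "(\<exists>c<Suc n. pts i k c < pts i l c \<and> (\<forall>c'<c. pts i k c' = pts i l c')) \<longleftrightarrow>
          (\<exists>c<n. pts i k c < pts i l c \<and> (\<forall>c'<c. pts i k c' = pts i l c'))"
        by (auto simp: less_Suc_eq)
      ultimately show ?thesis unfolding f using Suc False by (auto simp: less_Suc_eq)
    qed
  qed simp
  then show "nats (ev lex_cell s) 24 ?i = 1 \<longleftrightarrow> lexless i k l"
    using e s by (simp add: lex_cell_def lexless_def)
  show "\<And>z. z \<noteq> ?i \<Longrightarrow> nats (ev lex_cell s) 24 z = nats s 24 z"
    using e s by (simp add: lex_cell_def)
qed

lemma lex_table:
  assumes s: "ready s"
  shows "lexed (ev lex_table s)"
proof -
  define ok where "ok t i k l \<longleftrightarrow> (nats t 24 (enc i (enc k l)) = 1 \<longleftrightarrow> lexless i k l)" for t :: state and i k l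
  define P where "P i t \<longleftrightarrow> (\<forall>i'<i. \<forall>k<len i'. \<forall>l<len i'. ok t i' k l)" for i t
  have "P N (ev lex_table s)"
    unfolding lex_table_def
  proof (rule ev_for_agrees[where P = P], goal_cases)
    case (3 i t)
    let ?t = "nset t 2 0 i"
    have t: "ready ?t" using ready_agrees[OF s 3(2)] by simp
    define H where "H S u \<longleftrightarrow> P i u \<and> (\<forall>(k, l)\<in>S. ok u i k l)" for S u
    have "H (Sigma {..<len i} (\<lambda>_. {..<len i})) (ev (PFor 4 rowsE (PFor 5 rowsE lex_cell)) ?t)"
    proof (rule ev_pairs, goal_cases)
      case (2 u)
      then show ?case using ready_nats[OF t] 3(1) agrees_nats[OF 2(1), of 0] agrees_nats[OF 2(1), of 2] by simp
    next
      case (8 S u k l)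
      have u: "ready u" "nats u 2 0 = i" using ready_agrees[OF t 8(1)] agrees_nats[OF 8(1), of 2] by auto
      note lc = lex_cell[OF u 8(2,3) 3(1) 8(4,5)]
      have keep: "ok (ev lex_cell u) i' k' l' = ok u i' k' l'" if "(i', k', l') \<noteq> (i, k, l)" for i' k' l'
        unfolding ok_def using lc(2)[of "enc i' (enc k' l')"] that by auto
      have "ok (ev lex_cell u) i k l" using lc(1) by (simp add: ok_def)
      then have "ok (ev lex_cell u) i' k' l'" if "ok u i' k' l'" for i' k' l'
        using keep that by (cases "(i', k', l') = (i, k, l)") auto
      then show ?case using 8(8) \<open>ok (ev lex_cell u) i k l\<close> by (auto simp: H_def P_def)
    qed (use ready_nats[OF t] 3 in \<open>auto simp: H_def P_def ok_def\<close>)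
    then show ?case by (auto simp: H_def P_def less_Suc_eq)
  qed (use ready_nats[OF s] in \<open>auto simp: P_def ok_def\<close>)
  then show ?thesis by (simp add: lexed_def P_def ok_def)
qed

end

section \<open>The gluing program\<close>

definition slot_loop :: "prog \<Rightarrow> prog" where
  "slot_loop p = PFor 18 (lenE (nvar 17)) (PFor 19 numE (PFor 20 (lenE (nvar 19)) p))"

abbreviation slotE :: nexp where "slotE \<equiv> encE (nvar 18) (encE (nvar 19) (nvar 20))"
abbreviation restE :: "nexp \<Rightarrow> nexp \<Rightarrow> nexp" where
  "restE j l \<equiv> encE (encE (nvar 17) j) (encE (nvar 18) l)"
abbreviation selE :: "nexp \<Rightarrow> nexp" where "selE j \<equiv> nget2 23 slotE j"

text \<open>Only points with a positive remainder are admissible, and a lexicographically minimal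
  one is selected. The test that the table entry is 1 appears as two strict inequalities, above 0
  and below 2.\<close>

definition select_point :: prog where
  "select_point = PFor 22 (lenE (nvar 21))
    (PIf (BAnd (RLess (RConst 0) (RGet 7 (restE (nvar 21) (nvar 22))))
      (BNot (BAnd (RLess (RConst 0) (RGet 7 (restE (nvar 21) (selE (nvar 21)))))
        (BNot (BAnd (NLess (NConst 0) (nget3 24 (nvar 21) (nvar 22) (selE (nvar 21))))
          (NLess (nget3 24 (nvar 21) (nvar 22) (selE (nvar 21))) (NConst 2)))))))
      (PNSet 23 (encE slotE (nvar 21)) (nvar 22)) PSkip)"

definition select_tuple :: prog where
  "select_tuple = PFor 21 numE (PNSet 23 (encE slotE (nvar 21)) (NConst 0) ;; select_point)"

definition tuple_mass :: prog where
  "tuple_mass = PRSet 6 (NConst 0) (RGet 7 (restE (NConst 0) (selE (NConst 0)))) ;;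
    PFor 21 numE (PIf (RLess (RGet 7 (restE (nvar 21) (selE (nvar 21)))) (RGet 6 (NConst 0)))
      (PRSet 6 (NConst 0) (RGet 7 (restE (nvar 21) (selE (nvar 21))))) PSkip)"

definition take_mass :: prog where
  "take_mass = PRSet 9 slotE (RGet 6 (NConst 0)) ;;
    PFor 21 numE (PRSet 7 (restE (nvar 21) (selE (nvar 21)))
      (RSub (RGet 7 (restE (nvar 21) (selE (nvar 21)))) (RGet 6 (NConst 0))))"

text \<open>The array of rationals 10 receives the differences of the means of the tuples and the base points,
  and cell 0 of array 12 the sum of their squared lengths.\<close>

definition shift_coord :: prog where
  "shift_coord = PRSet 10 (encE slotE (nvar 6)) (RSub (RConst 0) (coordE (nvar 17) (nvar 18) (nvar 6))) ;;
    PFor 21 numE (PRSet 10 (encE slotE (nvar 6)) (RAdd (get2 10 slotE (nvar 6))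
      (RMul (RGet 0 (nvar 21)) (coordE (nvar 21) (selE (nvar 21)) (nvar 6))))) ;;
    PRSet 12 (NConst 0) (RAdd (RGet 12 (NConst 0)) (RMul (get2 10 slotE (nvar 6)) (get2 10 slotE (nvar 6))))"

definition glue_slot :: prog where
  "glue_slot = select_tuple ;; tuple_mass ;; take_mass ;; PFor 6 dimE shift_coord"

definition glue :: prog where
  "glue = PRSet 12 (NConst 0) (RConst 0) ;; slot_loop glue_slot"

lemma nwrites_slot_loop [simp]: "nwrites (slot_loop p) = {18, 19, 20} \<union> nwrites p"
  and rwrites_slot_loop [simp]: "rwrites (slot_loop p) = rwrites p"
  by (auto simp: slot_loop_def)

lemma writes_select_point [simp]: "nwrites select_point = {22, 23}" "rwrites select_point = {}"
  and writes_select_tuple [simp]: "nwrites select_tuple = {21, 22, 23}" "rwrites select_tuple = {}"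
  and writes_tuple_mass [simp]: "nwrites tuple_mass = {21}" "rwrites tuple_mass = {6}"
  and writes_take_mass [simp]: "nwrites take_mass = {21}" "rwrites take_mass = {7, 9}"
  and writes_shift_coord [simp]: "nwrites shift_coord = {21}" "rwrites shift_coord = {10, 12}"
  and writes_glue_slot [simp]: "nwrites glue_slot = {6, 21, 22, 23}" "rwrites glue_slot = {6, 7, 9, 10, 12}"
  and writes_glue [simp]: "nwrites glue = {6, 18, 19, 20, 21, 22, 23}" "rwrites glue = {6, 7, 9, 10, 12}"
  by (auto simp: select_point_def select_tuple_def tuple_mass_def take_mass_def shift_coord_def
      glue_slot_def glue_def)

context barycenter_input
begin

text \<open>A slot is a place for one tuple over the base point in its first component; the other
  two components merely number the slots. Per base point there are as many as points in all measures
  together, because each tuple of positive mass exhausts one of them.\<close>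

definition slots :: "nat \<Rightarrow> (nat \<times> nat \<times> nat) set" where
  "slots b = {..<len b} \<times> Sigma {..<N} (\<lambda>j. {..<len j})"

definition sized :: "state \<Rightarrow> bool" where
  "sized s \<longleftrightarrow> nats s 0 = nats (init_state (encode_input I)) 0"

lemma sized_nats:
  assumes "sized s"
  shows "nats s 0 0 = N" "nats s 0 (Suc 0) = d" "i < N \<Longrightarrow> nats s 0 (Suc (Suc i)) = len i"
  using assms by (auto simp: sized_def init_state_def encode_input_def len_def)

lemma ready_sized: "ready s \<Longrightarrow> sized s"
  by (simp add: ready_def inp_def sized_def)

lemma ev_slots:
  assumes s: "sized s" "nats s 17 0 = b" "b < N"
    and p: "nwrites p \<inter> {0, 17, 18, 19, 20} = {}"
    and H: "\<And>S t a x. a \<in> {18, 19, 20} \<Longrightarrow> H S (nset t a 0 x) = H S t"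
    and init: "H {} s"
    and step: "\<And>S t k i j. agrees ({18, 19, 20} \<union> nwrites p) (rwrites p) s t \<Longrightarrow>
      nats t 18 0 = k \<Longrightarrow> nats t 19 0 = i \<Longrightarrow> nats t 20 0 = j \<Longrightarrow>
      k < len b \<Longrightarrow> i < N \<Longrightarrow> j < len i \<Longrightarrow> (k, i, j) \<notin> S \<Longrightarrow> S \<subseteq> slots b \<Longrightarrow> H S t \<Longrightarrow>
      H (insert (k, i, j) S) (ev p t)"
  shows "H (slots b) (ev (slot_loop p) s)"
  unfolding slot_loop_def slots_def
proof (rule ev_for_agrees[where P = "\<lambda>k. H ({..<k} \<times> Sigma {..<N} (\<lambda>j. {..<len j}))"], goal_cases)
  case (3 k t)
  let ?t = "nset t 18 0 k" and ?J = "Sigma {..<N} (\<lambda>j. {..<len j})"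
  have ag: "agrees ({18, 19, 20} \<union> nwrites p) (rwrites p) s ?t"
    using 3(2) by (intro agrees_nset agrees_mono[OF 3(2)]) auto
  have "sized ?t" using agrees_nats[OF ag, of 0] s(1) p by (auto simp: sized_def)
  have "H ({..<k} \<times> ?J \<union> {k} \<times> ?J) (ev (PFor 19 numE (PFor 20 (lenE (nvar 19)) p)) ?t)"
  proof (rule ev_pairs[where H = "\<lambda>S. H ({..<k} \<times> ?J \<union> {k} \<times> S)"], goal_cases)
    case 1
    then show ?case using sized_nats[OF \<open>sized ?t\<close>] by simp
  next
    case (2 u)
    have "sized u" using agrees_nats[OF 2(1), of 0] \<open>sized ?t\<close> p by (auto simp: sized_def)
    then show ?case using sized_nats(3)[of u "nats u 19 0"] 2(2) by simp
  next
    case (8 S u i j)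
    have ag_u: "agrees ({18, 19, 20} \<union> nwrites p) (rwrites p) s u"
      by (rule agrees_mono[OF agrees_trans[OF ag 8(1)]]) auto
    have "nats u 18 0 = k" using agrees_nats[OF 8(1), of 18] p by simp
    then have "H (insert (k, i, j) ({..<k} \<times> ?J \<union> {k} \<times> S)) (ev p u)"
      using 8 3(1) by (intro step[OF ag_u]) (auto simp: slots_def)
    then show ?case by simp
  qed (use H p 3 in auto)
  moreover have "{..<k} \<times> ?J \<union> {k} \<times> ?J = {..<Suc k} \<times> ?J" by (auto simp: less_Suc_eq)
  ultimately show ?case by simp
qed (use s sized_nats[OF s(1)] H init in auto)

abbreviation sel :: "state \<Rightarrow> nat \<times> nat \<times> nat \<Rightarrow> nat \<Rightarrow> nat" where
  "sel s a j \<equiv> nats s 23 (enc (enc (fst a) (enc (fst (snd a)) (snd (snd a)))) j)"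
abbreviation slot_mass :: "state \<Rightarrow> nat \<times> nat \<times> nat \<Rightarrow> rat" where
  "slot_mass s a \<equiv> rats s 9 (enc (fst a) (enc (fst (snd a)) (snd (snd a))))"
abbreviation shift :: "state \<Rightarrow> nat \<times> nat \<times> nat \<Rightarrow> nat \<Rightarrow> rat" where
  "shift s a c \<equiv> rats s 10 (enc (enc (fst a) (enc (fst (snd a)) (snd (snd a)))) c)"
abbreviation rest :: "nat \<Rightarrow> state \<Rightarrow> nat \<Rightarrow> nat \<Rightarrow> nat \<Rightarrow> rat" where
  "rest b s k j l \<equiv> rats s 7 (enc (enc b j) (enc k l))"

lemma lexed_agrees: "lexed s \<Longrightarrow> agrees A B s t \<Longrightarrow> 24 \<notin> A \<Longrightarrow> lexed t"
  by (simp add: lexed_def agrees_def)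

lemma lexed_nset [simp]: "a \<noteq> 24 \<Longrightarrow> lexed (nset s a i x) = lexed s"
  by (simp add: lexed_def)

lemma select_point:
  assumes s: "ready s" "lexed s" and j: "nats s 21 0 = j" "j < N"
  defines "q \<equiv> enc (nats s 18 0) (enc (nats s 19 0) (nats s 20 0))"
  defines "r \<equiv> \<lambda>l. rats s 7 (enc (enc (nats s 17 0) j) (enc (nats s 18 0) l))"
  assumes cur: "nats s 23 (enc q j) = 0"
  defines "s' \<equiv> ev select_point s"
  shows "nats s' 23 (enc q j) < len j"
    and "\<And>l. l < len j \<Longrightarrow> 0 < r l \<Longrightarrow> 0 < r (nats s' 23 (enc q j)) \<and> \<not> lexless j l (nats s' 23 (enc q j))"
    and "\<And>z. z \<noteq> enc q j \<Longrightarrow> nats s' 23 z = nats s 23 z"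
proof -
  define lt where "lt x c \<longleftrightarrow> nats s 24 (enc j (enc x c)) = 1" for x c
  let ?f = "\<lambda>x c. if 0 < r x \<and> (0 < r c \<longrightarrow> lt x c) then x else c"
  have n: "nval s (lenE (nvar 21)) = len j" using ready_nats[OF s(1)] j by simp
  have "s' = nset (nset s 23 (enc q j) (fold ?f [0..<nval s (lenE (nvar 21))] (nats s 23 (enc q j)))) 22 0 (nval s (lenE (nvar 21)))"
    unfolding s'_def select_point_def
    by (rule ev_for_argmin) (use j in \<open>auto simp: q_def r_def lt_def\<close>)
  then have e: "s' = nset (nset s 23 (enc q j) (fold ?f [0..<len j] 0)) 22 0 (len j)"
    unfolding n cur .
  \<comment> \<open>The table is meaningful only for indices below \<open>len j\<close>. Restricting
    the order to them gives an irreflexive and transitive relation without changing the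
    fold.\<close>
  let ?g = "\<lambda>x c. if 0 < r x \<and> (0 < r c \<longrightarrow> x < len j \<and> c < len j \<and> lexless j x c) then x else c"
  have lt: "lt x c = lexless j x c" if "x < len j" "c < len j" for x c
    using s(2) that j(2) by (simp add: lexed_def lt_def)
  have "m \<le> len j \<Longrightarrow> fold ?f [0..<m] 0 = fold ?g [0..<m] 0 \<and> fold ?g [0..<m] 0 < len j" for m
    by (induction m) (use lt len_pos[OF j(2)] in auto)
  from this[of "len j"] have sel: "nats s' 23 (enc q j) = fold ?g [0..<len j] 0" using e by simp
  have "fold ?g [0..<len j] 0 < len j \<and> (\<forall>l<len j. 0 < r l \<longrightarrow> 0 < r (fold ?g [0..<len j] 0) \<and>
      \<not> (l < len j \<and> fold ?g [0..<len j] 0 < len j \<and> lexless j l (fold ?g [0..<len j] 0)))"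
    using fold_argmin[of "\<lambda>x c. x < len j \<and> c < len j \<and> lexless j x c" "fold ?g [0..<len j] 0" "\<lambda>x. 0 < r x" "len j"]
      lexless_irrefl lexless_trans len_pos[OF j(2)] by blast
  then show "nats s' 23 (enc q j) < len j"
    and "\<And>l. l < len j \<Longrightarrow> 0 < r l \<Longrightarrow> 0 < r (nats s' 23 (enc q j)) \<and> \<not> lexless j l (nats s' 23 (enc q j))"
    unfolding sel by auto
  show "\<And>z. z \<noteq> enc q j \<Longrightarrow> nats s' 23 z = nats s 23 z" using e by simp
qed

lemma select_tuple:
  assumes s: "ready s" "lexed s"
  defines "q \<equiv> enc (nats s 18 0) (enc (nats s 19 0) (nats s 20 0))"
  defines "r \<equiv> \<lambda>j l. rats s 7 (enc (enc (nats s 17 0) j) (enc (nats s 18 0) l))"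
  defines "s' \<equiv> ev select_tuple s"
  shows "\<And>j. j < N \<Longrightarrow> nats s' 23 (enc q j) < len j"
    and "\<And>j l. j < N \<Longrightarrow> l < len j \<Longrightarrow> 0 < r j l \<Longrightarrow> 0 < r j (nats s' 23 (enc q j)) \<and> \<not> lexless j l (nats s' 23 (enc q j))"
    and "\<And>p j. p \<noteq> q \<Longrightarrow> nats s' 23 (enc p j) = nats s 23 (enc p j)"
proof -
  define P where "P n t \<longleftrightarrow> (\<forall>j<n. nats t 23 (enc q j) < len j \<and>
      (\<forall>l<len j. 0 < r j l \<longrightarrow> 0 < r j (nats t 23 (enc q j)) \<and> \<not> lexless j l (nats t 23 (enc q j)))) \<and>
    (\<forall>p j. p \<noteq> q \<longrightarrow> nats t 23 (enc p j) = nats s 23 (enc p j))" for n and t :: state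
  have "P N s'"
    unfolding s'_def select_tuple_def
  proof (rule ev_for_agrees[where P = P], goal_cases)
    case (3 j t)
    let ?t = "nset (nset t 21 0 j) 23 (enc q j) 0"
    have same: "nats t a = nats s a" if "a \<in> {17, 18, 19, 20}" for a
      using agrees_nats[OF 3(2), of a] that by auto
    have rats: "rats t = rats s" using agrees_rats[OF 3(2)] by auto
    have t: "ready ?t" "lexed ?t" using ready_agrees[OF s(1) 3(2)] lexed_agrees[OF s(2) 3(2)] by auto
    have e: "ev (PNSet 23 (encE slotE (nvar 21)) (NConst 0) ;; select_point) (nset t 21 0 j) = ev select_point ?t"
      using same by (simp add: q_def)
    have q: "enc (nats ?t 18 0) (enc (nats ?t 19 0) (nats ?t 20 0)) = q" using same by (simp add: q_def)
    have r: "rats ?t 7 (enc (enc (nats ?t 17 0) j) (enc (nats ?t 18 0) l)) = r j l" for l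
      using same rats by (simp add: r_def)
    have "nats ?t 21 0 = j" by simp
    note sp = select_point[OF t this 3(1), unfolded q r]
    have cur: "nats ?t 23 (enc q j) = 0" by simp
    show ?case
      unfolding e P_def
    proof (intro conjI allI impI)
      fix j' assume "j' < Suc j"
      then consider "j' < j" | "j' = j" by linarith
      then show "nats (ev select_point ?t) 23 (enc q j') < len j'"
      proof cases
        case 1
        then show ?thesis using sp(3)[OF cur, of "enc q j'"] 3(3) by (simp add: P_def)
      qed (use sp(1)[OF cur] in simp)
    next
      fix j' l assume jl: "j' < Suc j" "l < len j'" "0 < r j' l"
      have "0 < r j' (nats (ev select_point ?t) 23 (enc q j')) \<and> \<not> lexless j' l (nats (ev select_point ?t) 23 (enc q j'))"
      proof (cases "j' = j")
        case True
        then show ?thesis using sp(2)[OF cur] jl by simp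
      next
        case False
        then show ?thesis using sp(3)[OF cur, of "enc q j'"] 3(3) jl by (simp add: P_def)
      qed
      then show "0 < r j' (nats (ev select_point ?t) 23 (enc q j'))"
        "\<not> lexless j' l (nats (ev select_point ?t) 23 (enc q j'))" by auto
    next
      fix p j' assume "p \<noteq> q"
      then show "nats (ev select_point ?t) 23 (enc p j') = nats s 23 (enc p j')"
        using sp(3)[OF cur, of "enc p j'"] 3(3) by (simp add: P_def)
    qed
  qed (use ready_nats[OF s(1)] in \<open>auto simp: P_def\<close>)
  then show "\<And>j. j < N \<Longrightarrow> nats s' 23 (enc q j) < len j"
    and "\<And>j l. j < N \<Longrightarrow> l < len j \<Longrightarrow> 0 < r j l \<Longrightarrow> 0 < r j (nats s' 23 (enc q j)) \<and> \<not> lexless j l (nats s' 23 (enc q j))"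
    and "\<And>p j. p \<noteq> q \<Longrightarrow> nats s' 23 (enc p j) = nats s 23 (enc p j)"
    by (auto simp: P_def)
qed

lemma tuple_mass:
  assumes s: "ready s"
  defines "q \<equiv> enc (nats s 18 0) (enc (nats s 19 0) (nats s 20 0))"
  defines "f \<equiv> \<lambda>j. rats s 7 (enc (enc (nats s 17 0) j) (enc (nats s 18 0) (nats s 23 (enc q j))))"
  defines "\<delta> \<equiv> rats (ev tuple_mass s) 6 0"
  shows "\<And>j. j < N \<Longrightarrow> \<delta> \<le> f j" and "\<exists>j<N. \<delta> = f j"
proof -
  let ?s = "rset s 6 0 (f 0)"
  let ?F = "\<lambda>j q. if f j < q then f j else q"
  have "ev (PFor 21 numE (PIf (RLess (RGet 7 (restE (nvar 21) (selE (nvar 21)))) (RGet 6 (NConst 0)))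
      (PRSet 6 (NConst 0) (RGet 7 (restE (nvar 21) (selE (nvar 21))))) PSkip)) ?s =
    nset (rset ?s 6 0 (fold ?F [0..<nval ?s numE] (rats ?s 6 0))) 21 0 (nval ?s numE)"
    by (rule ev_for_rat_cell) (auto simp: f_def q_def rset_nset)
  then have "\<delta> = fold ?F [0..<N] (f 0)"
    using ready_nats[OF s] by (simp add: \<delta>_def tuple_mass_def f_def q_def)
  moreover have "(\<forall>j<n. fold ?F [0..<n] (f 0) \<le> f j) \<and> (\<exists>j. (j < n \<or> j = 0) \<and> fold ?F [0..<n] (f 0) = f j)" for n
  proof (induction n)
    case (Suc n)
    then show ?case by (auto simp: less_Suc_eq intro: order_trans less_imp_le)
  qed auto
  ultimately show "\<And>j. j < N \<Longrightarrow> \<delta> \<le> f j" and "\<exists>j<N. \<delta> = f j" using N_pos by (auto; metis)+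
qed

lemma take_mass:
  assumes s: "ready s"
  defines "k \<equiv> nats s 18 0" and "b \<equiv> nats s 17 0"
  defines "q \<equiv> enc k (enc (nats s 19 0) (nats s 20 0))"
  defines "s' \<equiv> ev take_mass s"
  shows "rats s' 9 = (rats s 9)(q := rats s 6 0)"
    and "\<And>j l. j < N \<Longrightarrow> rest b s' k j l = rest b s k j l - (if l = nats s 23 (enc q j) then rats s 6 0 else 0)"
    and "\<And>k' j l. k' \<noteq> k \<Longrightarrow> rest b s' k' j l = rest b s k' j l"
proof -
  let ?s = "rset s 9 q (rats s 6 0)"
  define P where "P n t \<longleftrightarrow> rats t 9 = rats ?s 9 \<and>
    (\<forall>j l. rest b t k j l = rest b s k j l - (if j < n \<and> l = nats s 23 (enc q j) then rats s 6 0 else 0)) \<and>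
    (\<forall>k' j l. k' \<noteq> k \<longrightarrow> rest b t k' j l = rest b s k' j l)" for n and t :: state
  have "P N (ev (PFor 21 numE (PRSet 7 (restE (nvar 21) (selE (nvar 21)))
      (RSub (RGet 7 (restE (nvar 21) (selE (nvar 21)))) (RGet 6 (NConst 0))))) ?s)"
  proof (rule ev_for_agrees[where P = P], goal_cases)
    case (3 j t)
    have same: "nats t a = nats s a" if "a \<in> {17, 18, 19, 20, 23}" for a
      using agrees_nats[OF 3(2), of a] that by auto
    have "rats t 6 = rats s 6" using agrees_rats[OF 3(2), of 6] by simp
    then show ?case
      using 3(3) same unfolding P_def q_def k_def b_def by (auto simp: less_Suc_eq)
  qed (use ready_nats[OF s] in \<open>auto simp: P_def\<close>)
  then have "P N s'" by (simp add: s'_def take_mass_def q_def k_def)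
  then show "rats s' 9 = (rats s 9)(q := rats s 6 0)"
    and "\<And>j l. j < N \<Longrightarrow> rest b s' k j l = rest b s k j l - (if l = nats s 23 (enc q j) then rats s 6 0 else 0)"
    and "\<And>k' j l. k' \<noteq> k \<Longrightarrow> rest b s' k' j l = rest b s k' j l"
    by (auto simp: P_def)
qed

lemma shift_coord:
  assumes s: "ready s" "nats s 17 0 = b" "b < N" "nats s 18 0 = k" "k < len b" "nats s 6 0 = c" "c < d"
  defines "q \<equiv> enc k (enc (nats s 19 0) (nats s 20 0))"
  assumes sel: "\<And>j. j < N \<Longrightarrow> nats s 23 (enc q j) < len j"
  defines "v \<equiv> (\<Sum>j<N. wt j * pts j (nats s 23 (enc q j)) c) - pts b k c"
  shows "rats (ev shift_coord s) 10 = (rats s 10)(enc q c := v)"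
    and "rats (ev shift_coord s) 12 = (rats s 12)(0 := rats s 12 0 + v * v)"
proof -
  note rd = ready_nats[OF s(1)] ready_pts[OF s(1)]
  let ?s = "rset s 10 (enc q c) (- pts b k c)"
  define f where "f j = wt j * pts j (nats s 23 (enc q j)) c" for j
  let ?p = "PRSet 10 (encE slotE (nvar 6)) (RAdd (get2 10 slotE (nvar 6))
      (RMul (RGet 0 (nvar 21)) (coordE (nvar 21) (selE (nvar 21)) (nvar 6))))"
  have n: "nval ?s numE = N" using rd by simp
  have "ev (PFor 21 numE ?p) ?s = nset (rset ?s 10 (enc q c) (fold (\<lambda>x q. q + f x) [0..<nval ?s numE] (rats ?s 10 (enc q c)))) 21 0 (nval ?s numE)"
  proof (rule ev_for_rat_cell)
    fix x z assume "x < nval ?s numE"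
    then have x: "x < N" using n by simp
    show "ev ?p (nset (rset ?s 10 (enc q c) z) 21 0 x) = nset (rset ?s 10 (enc q c) (z + f x)) 21 0 x"
      using s rd(4)[OF x sel[OF x] s(7)] rd(2) ready_wt[OF s(1) x] by (simp add: f_def q_def rset_nset)
  qed
  then have e: "ev (PFor 21 numE ?p) ?s = nset (rset s 10 (enc q c) v) 21 0 N"
    unfolding n fold_add by (simp add: v_def f_def)
  have first: "ev (PRSet 10 (encE slotE (nvar 6)) (RSub (RConst 0) (coordE (nvar 17) (nvar 18) (nvar 6)))) s = ?s"
    using s rd(2) rd(4)[OF s(3) s(5) s(7)] by (simp add: q_def)
  show "rats (ev shift_coord s) 10 = (rats s 10)(enc q c := v)"
    "rats (ev shift_coord s) 12 = (rats s 12)(0 := rats s 12 0 + v * v)"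
    unfolding shift_coord_def ev.simps(4) first e using s by (simp_all add: q_def)
qed

text \<open>The sum of all squared shifts, accumulated across the slots, dominates the square of
  each single one; it serves as the bound on shifts in the choice of the step size.\<close>

lemma shift_coords:
  assumes s: "ready s" "nats s 17 0 = b" "b < N" "nats s 18 0 = k" "k < len b"
  defines "q \<equiv> enc k (enc (nats s 19 0) (nats s 20 0))"
  assumes sel: "\<And>j. j < N \<Longrightarrow> nats s 23 (enc q j) < len j"
  defines "v \<equiv> \<lambda>c. (\<Sum>j<N. wt j * pts j (nats s 23 (enc q j)) c) - pts b k c"
  defines "s' \<equiv> ev (PFor 6 dimE shift_coord) s"
  shows "\<And>c. c < d \<Longrightarrow> rats s' 10 (enc q c) = v c \<and> v c * v c \<le> rats s' 12 0 - rats s 12 0"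
    and "rats s 12 0 \<le> rats s' 12 0"
    and "\<And>p c. p \<noteq> q \<Longrightarrow> rats s' 10 (enc p c) = rats s 10 (enc p c)"
proof -
  define P where "P n t \<longleftrightarrow> (\<forall>c<n. rats t 10 (enc q c) = v c) \<and> rats t 12 0 = rats s 12 0 + (\<Sum>c<n. v c * v c) \<and>
    (\<forall>p c. p \<noteq> q \<longrightarrow> rats t 10 (enc p c) = rats s 10 (enc p c))" for n and t :: state
  have "P d s'"
    unfolding s'_def
  proof (rule ev_for_agrees[where P = P], goal_cases)
    case (3 c t)
    let ?t = "nset t 6 0 c"
    have same: "nats t a = nats s a" if "a \<in> {17, 18, 19, 20, 23}" for a
      using agrees_nats[OF 3(2), of a] that by auto
    have t: "ready ?t" "nats ?t 17 0 = b" "nats ?t 18 0 = k" "nats ?t 6 0 = c"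
      using ready_agrees[OF s(1) 3(2)] same s by auto
    have q: "enc k (enc (nats ?t 19 0) (nats ?t 20 0)) = q" "nats ?t 23 = nats s 23"
      using same by (auto simp: q_def)
    from shift_coord[OF t(1,2) s(3) t(3) s(5) t(4) 3(1), unfolded q, OF sel]
    show ?case using 3(3) by (auto simp: P_def v_def less_Suc_eq)
  qed (use ready_nats[OF s(1)] in \<open>auto simp: P_def\<close>)
  then have P: "\<And>c. c < d \<Longrightarrow> rats s' 10 (enc q c) = v c" "rats s' 12 0 = rats s 12 0 + (\<Sum>c<d. v c * v c)"
    "\<And>p c. p \<noteq> q \<Longrightarrow> rats s' 10 (enc p c) = rats s 10 (enc p c)" by (auto simp: P_def)
  have "v c * v c \<le> (\<Sum>c<d. v c * v c)" if "c < d" for c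
    using that by (intro member_le_sum) auto
  then show "\<And>c. c < d \<Longrightarrow> rats s' 10 (enc q c) = v c \<and> v c * v c \<le> rats s' 12 0 - rats s 12 0"
    using P by simp
  show "rats s 12 0 \<le> rats s' 12 0" unfolding P(2) by (simp add: sum_nonneg)
  show "\<And>p c. p \<noteq> q \<Longrightarrow> rats s' 10 (enc p c) = rats s 10 (enc p c)" by (rule P(3))
qed

end

context barycenter_input
begin

definition tuple_shift :: "nat \<Rightarrow> nat \<Rightarrow> (nat \<Rightarrow> nat) \<Rightarrow> nat \<Rightarrow> rat" where
  "tuple_shift b k t c = (\<Sum>j<N. wt j * pts j (t j) c) - pts b k c"

lemma tuple_shift_cong: "(\<And>j. j < N \<Longrightarrow> t j = t' j) \<Longrightarrow> tuple_shift b k t c = tuple_shift b k t' c"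
  by (simp add: tuple_shift_def)

text \<open>\<open>s\<close> is the state before gluing, whose plans are the initial remainders. The
  base points are glued independently of each other, each with an invariant of its own.\<close>

definition glued :: "nat \<Rightarrow> state \<Rightarrow> (nat \<times> nat \<times> nat) set \<Rightarrow> state \<Rightarrow> bool" where
  "glued b s S t \<longleftrightarrow>
    (\<forall>k<len b. glue_inv N len lexless (rest b s k) {x. (k, x) \<in> S} (\<lambda>x. slot_mass t (k, x))
      (\<lambda>x. sel t (k, x)) (rest b t k)) \<and>
    0 \<le> rats t 12 0 \<and> (\<forall>a\<in>S. \<forall>c<d. shift t a c = tuple_shift b (fst a) (sel t a) c \<and>
      shift t a c * shift t a c \<le> rats t 12 0)"

lemma glue_slot:
  assumes t: "ready t" "lexed t" "nats t 17 0 = b" "nats t 18 0 = k" "nats t 19 0 = i" "nats t 20 0 = j"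
    and lt: "b < N" "k < len b" and S: "(k, i, j) \<notin> S" and H: "glued b s S t"
  shows "glued b s (insert (k, i, j) S) (ev glue_slot t)"
proof -
  let ?a = "(k, i, j)"
  define q where "q = enc k (enc i j)"
  define t1 where "t1 = ev select_tuple t"
  define t2 where "t2 = ev tuple_mass t1"
  define t3 where "t3 = ev take_mass t2"
  define t4 where "t4 = ev (PFor 6 dimE shift_coord) t3"
  have t4: "ev glue_slot t = t4" by (simp add: glue_slot_def t1_def t2_def t3_def t4_def)
  have a1: "agrees {21, 22, 23} {} t t1" using agrees_ev[of select_tuple t] by (simp add: t1_def)
  have a2: "agrees {21} {6} t1 t2" using agrees_ev[of tuple_mass t1] by (simp add: t2_def)
  have a3: "agrees {21} {7, 9} t2 t3" using agrees_ev[of take_mass t2] by (simp add: t3_def)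
  have a4: "agrees {6, 21} {10, 12} t3 t4" using agrees_ev[of "PFor 6 dimE shift_coord" t3] by (simp add: t4_def)
  have rd: "ready t1" "ready t2" "ready t3"
    using ready_agrees[OF t(1) a1] ready_agrees[OF _ a2] ready_agrees[OF _ a3] by auto
  have vars: "nats t1 v = nats t v" "nats t2 v = nats t v" "nats t3 v = nats t v" if "v \<in> {17, 18, 19, 20}" for v
    using that agrees_nats[OF a1, of v] agrees_nats[OF a2, of v] agrees_nats[OF a3, of v] by auto
  have sel23: "nats t4 23 = nats t1 23" "nats t3 23 = nats t1 23" "nats t2 23 = nats t1 23"
    using agrees_nats[OF a2, of 23] agrees_nats[OF a3, of 23] agrees_nats[OF a4, of 23] by auto
  have r7: "rats t1 = rats t" "rats t2 7 = rats t 7" "rats t4 7 = rats t3 7" "rats t4 9 = rats t3 9"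
    "rats t2 9 = rats t 9" "rats t3 10 = rats t 10" "rats t3 12 = rats t 12" "rats t3 6 = rats t2 6"
    using agrees_rats[OF a1] agrees_rats[OF a2] agrees_rats[OF a3] agrees_rats[OF a4] by auto
  have v1: "nats t1 17 0 = b" "nats t1 18 0 = k" "nats t1 19 0 = i" "nats t1 20 0 = j"
    and v2: "nats t2 17 0 = b" "nats t2 18 0 = k" "nats t2 19 0 = i" "nats t2 20 0 = j"
    and v3: "nats t3 17 0 = b" "nats t3 18 0 = k" "nats t3 19 0 = i" "nats t3 20 0 = j"
    using t vars by auto
  note st = select_tuple[OF t(1,2), unfolded t(3-6) q_def[symmetric], folded t1_def]
  define \<delta> where "\<delta> = rats t2 6 0"
  note tm = tuple_mass[OF rd(1), unfolded v1 q_def[symmetric] r7(1), folded t2_def, folded \<delta>_def]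
  note tk = take_mass[OF rd(2), unfolded v2 q_def[symmetric], folded t3_def, unfolded \<delta>_def[symmetric] sel23 r7(2,5)]
  have sc: "\<And>c. c < d \<Longrightarrow> rats t4 10 (enc q c) = tuple_shift b k (\<lambda>j. nats t1 23 (enc q j)) c \<and>
      tuple_shift b k (\<lambda>j. nats t1 23 (enc q j)) c * tuple_shift b k (\<lambda>j. nats t1 23 (enc q j)) c \<le> rats t4 12 0 - rats t 12 0"
    "rats t 12 0 \<le> rats t4 12 0" "\<And>p c. p \<noteq> q \<Longrightarrow> rats t4 10 (enc p c) = rats t 10 (enc p c)"
    using shift_coords[OF rd(3) v3(1) lt(1) v3(2) lt(2)] st(1)
    unfolding v3 q_def[symmetric] t4_def[symmetric] sel23 r7 tuple_shift_def by simp_all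
  have inv: "glue_inv N len lexless (rest b s k') {x. (k', x) \<in> S} (\<lambda>x. slot_mass t (k', x))
      (\<lambda>x. sel t (k', x)) (rest b t k')" if "k' < len b" for k'
    using H that by (simp add: glued_def)
  have nq: "enc k' (enc (fst x) (snd x)) \<noteq> q" if "(k', x) \<in> S" for k' x
    using S that by (cases x) (auto simp: q_def)
  have sel_old: "sel t4 (k', x) j' = sel t (k', x) j'" if "(k', x) \<in> S" for k' x j'
    using st(3)[OF nq[OF that]] sel23 by simp
  have mass_old: "slot_mass t4 (k', x) = slot_mass t (k', x)" if "(k', x) \<in> S" for k' x
    using nq[OF that] tk(1) r7 by simp
  have step: "glue_inv N len lexless (rest b s k') {x. (k', x) \<in> insert ?a S} (\<lambda>x. slot_mass t4 (k', x))
      (\<lambda>x. sel t4 (k', x)) (rest b t4 k')" if k': "k' < len b" for k'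
  proof (cases "k' = k")
    case True
    have "glue_inv N len lexless (rest b s k) {x. (k, x) \<in> S} (\<lambda>x. slot_mass t4 (k, x))
        (\<lambda>x. sel t4 (k, x)) (rest b t k)"
      by (rule glue_inv_cong[OF inv[OF lt(2)]]) (use sel_old mass_old in auto)
    then have "glue_inv N len lexless (rest b s k) (insert (i, j) {x. (k, x) \<in> S}) (\<lambda>x. slot_mass t4 (k, x))
        (\<lambda>x. sel t4 (k, x)) (rest b t4 k)"
    proof (rule glue_inv_step)
      show "(i, j) \<notin> {x. (k, x) \<in> S}" using S by simp
      show "0 < N" by (rule N_pos)
      show "sel t4 (k, i, j) j' < len j'" if "j' < N" for j'
        using st(1)[OF that] by (simp add: sel23 q_def[symmetric])
      show "0 < rest b t k j' (sel t4 (k, i, j) j') \<and> \<not> lexless j' l (sel t4 (k, i, j) j')"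
        if "j' < N" "l < len j'" "0 < rest b t k j' l" for j' l
        using st(2)[OF that] by (simp add: sel23 q_def[symmetric])
      have "slot_mass t4 (k, i, j) = \<delta>" using tk(1) by (simp add: r7 q_def[symmetric])
      then show "slot_mass t4 (k, i, j) \<le> rest b t k j' (sel t4 (k, i, j) j')" if "j' < N" for j'
        using tm(1)[OF that] by (simp add: sel23 q_def[symmetric])
      show "\<exists>j'<N. slot_mass t4 (k, i, j) = rest b t k j' (sel t4 (k, i, j) j')"
        using tm(2) \<open>slot_mass t4 (k, i, j) = \<delta>\<close> by (simp add: sel23 q_def[symmetric])
      show "rest b t4 k j' l = rest b t k j' l - (if l = sel t4 (k, i, j) j' then slot_mass t4 (k, i, j) else 0)"
        if "j' < N" "l < len j'" for j' l
        using tk(2)[OF that(1), of l] \<open>slot_mass t4 (k, i, j) = \<delta>\<close> by (simp add: r7 sel23 q_def[symmetric])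
    qed
    moreover have "{x. (k, x) \<in> insert ?a S} = insert (i, j) {x. (k, x) \<in> S}" by auto
    ultimately show ?thesis using True by simp
  next
    case False
    then have e: "{x. (k', x) \<in> insert ?a S} = {x. (k', x) \<in> S}" by auto
    show ?thesis
      unfolding e by (rule glue_inv_cong[OF inv[OF k']]) (use sel_old mass_old tk(3)[OF False] in \<open>auto simp: r7\<close>)
  qed
  moreover have "shift t4 a c = tuple_shift b (fst a) (sel t4 a) c \<and> shift t4 a c * shift t4 a c \<le> rats t4 12 0"
    if a: "a \<in> insert ?a S" and c: "c < d" for a c
  proof (cases "a = ?a")
    case True
    have "0 \<le> rats t 12 0" using H by (simp add: glued_def)
    then show ?thesis using True sc(1)[OF c] by (auto simp: q_def[symmetric] sel23)
  next
    case False
    then have aS: "a \<in> S" using a by simp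
    obtain k' x where kx: "a = (k', x)" by (cases a)
    have "shift t4 a c = shift t a c" using sc(3) nq[of k' x] aS kx by simp
    moreover have "shift t a c = tuple_shift b (fst a) (sel t a) c" "shift t a c * shift t a c \<le> rats t 12 0"
      using H aS c unfolding glued_def by blast+
    moreover have "tuple_shift b (fst a) (sel t4 a) c = tuple_shift b (fst a) (sel t a) c"
      using sel_old[of k' x] aS kx by (intro tuple_shift_cong) auto
    ultimately show ?thesis using sc(2) by auto
  qed
  moreover have "0 \<le> rats t4 12 0" using sc(2) H by (auto simp: glued_def)
  ultimately show ?thesis unfolding t4 glued_def by blast
qed

lemma glue:
  assumes s: "ready s" "lexed s" "nats s 17 0 = b" "b < N"
    and r: "\<And>k j l. k < len b \<Longrightarrow> j < N \<Longrightarrow> l < len j \<Longrightarrow> 0 \<le> rest b s k j l"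
      "\<And>k j. k < len b \<Longrightarrow> j < N \<Longrightarrow> (\<Sum>l<len j. rest b s k j l) = ms b k"
  shows "glued b s (slots b) (ev glue s)"
proof -
  let ?s = "rset s 12 0 0"
  have "glued b s (slots b) (ev (slot_loop glue_slot) ?s)"
  proof (rule ev_slots[where b = b], goal_cases)
    case 1
    then show ?case using ready_sized[OF s(1)] by (simp add: sized_def)
  next
    case (5 S t a x)
    then show ?case by (auto simp: glued_def)
  next
    case 6
    show ?case using r by (auto simp: glued_def intro!: glue_inv_start)
  next
    case (7 S t k i j)
    have "ready t" "lexed t" using s ready_agrees[OF _ 7(1)] lexed_agrees[OF _ 7(1)]
      by (auto simp: lexed_def)
    moreover have "nats t 17 0 = b" using agrees_nats[OF 7(1), of 17] s by simp
    ultimately show ?case using 7 s by (intro glue_slot) auto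
  qed (use s in auto)
  then show ?thesis by (simp add: glue_def)
qed

end

section \<open>Moving the tuples apart and writing the output\<close>

text \<open>The output overwrites the array of rationals 0, where the input points are stored, so
  the base points are saved beforehand.\<close>

definition base_copy :: prog where
  "base_copy = PFor 4 (lenE (nvar 17)) (PFor 6 dimE
    (PRSet 11 (encE (nvar 4) (nvar 6)) (coordE (nvar 17) (nvar 4) (nvar 6))))"

abbreviation gapE :: rexp where
  "gapE \<equiv> RMul (RSub (get2 11 (nvar 4) (nvar 6)) (get2 11 (nvar 5) (nvar 6)))
    (RSub (get2 11 (nvar 4) (nvar 6)) (get2 11 (nvar 5) (nvar 6)))"

definition gap_cell :: prog where
  "gap_cell = PFor 6 dimE (PIf (BAnd (RLess (RConst 0) gapE) (RLess gapE (RGet 13 (NConst 0))))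
    (PRSet 13 (NConst 0) gapE) PSkip)"

text \<open>Let \<open>A\<close> be the least positive squared coordinate difference of base points,
  capped at 1, and \<open>W\<close> the sum of the squared shifts. Two shifts differ in a coordinate
  by some \<open>v\<close> with \<open>v * v \<le> 4 * W\<close>. With step size
  \<open>A / (A + 4 * W)\<close> the square of the resulting displacement is at most
  \<open>A^2 * 4 * W / (A + 4 * W)^2 < A\<close>, so points over different base points cannot meet,
  and no square root is taken.\<close>

definition scale :: prog where
  "scale = base_copy ;; PRSet 13 (NConst 0) (RConst 1) ;;
    PFor 4 (lenE (nvar 17)) (PFor 5 (lenE (nvar 17)) gap_cell) ;;
    PRSet 14 (NConst 0) (RDiv (RGet 13 (NConst 0))
      (RAdd (RGet 13 (NConst 0)) (RMul (RConst 4) (RGet 12 (NConst 0)))))"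

definition out_coords :: prog where
  "out_coords = PFor 6 dimE (PRSet 0 (NAdd (NMul (nvar 28) (NAdd dimE (NConst 1))) (nvar 6))
     (RAdd (get2 11 (nvar 18) (nvar 6)) (RMul (RGet 14 (NConst 0)) (get2 10 slotE (nvar 6)))))"

text \<open>Slots of mass 0 are left out, as the masses of a discrete measure are positive. Cell 0
  of array 28 counts the points written and so determines the next address.\<close>

definition out_slot :: prog where
  "out_slot = PIf (RLess (RConst 0) (RGet 9 slotE))
    (out_coords ;;
     PRSet 0 (NAdd (NMul (nvar 28) (NAdd dimE (NConst 1))) dimE) (RGet 9 slotE) ;;
     PNSet 28 (NConst 0) (NAdd (nvar 28) (NConst 1))) PSkip"

definition write_output :: prog where
  "write_output = PNSet 28 (NConst 0) (NConst 0) ;; slot_loop out_slot"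

lemma writes_base_copy [simp]: "nwrites base_copy = {4, 6}" "rwrites base_copy = {11}"
  and writes_gap_cell [simp]: "nwrites gap_cell = {6}" "rwrites gap_cell = {13}"
  and writes_scale [simp]: "nwrites scale = {4, 5, 6}" "rwrites scale = {11, 13, 14}"
  and writes_out_coords [simp]: "nwrites out_coords = {6}" "rwrites out_coords = {0}"
  and writes_out_slot [simp]: "nwrites out_slot = {6, 28}" "rwrites out_slot = {0}"
  and writes_write_output [simp]: "nwrites write_output = {6, 18, 19, 20, 28}" "rwrites write_output = {0}"
  by (auto simp: base_copy_def gap_cell_def scale_def out_coords_def out_slot_def write_output_def)

context barycenter_input
begin

lemma scale:
  assumes s: "ready s" "nats s 17 0 = b" "b < N" and W: "0 \<le> rats s 12 0"
  defines "s' \<equiv> ev scale s"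
  defines "\<sigma> \<equiv> rats s' 14 0"
  shows "\<And>k c. k < len b \<Longrightarrow> c < d \<Longrightarrow> rats s' 11 (enc k c) = pts b k c"
    and "0 < \<sigma>" "\<sigma> \<le> 1"
    and "\<And>k k' c v. k < len b \<Longrightarrow> k' < len b \<Longrightarrow> c < d \<Longrightarrow> pts b k c \<noteq> pts b k' c \<Longrightarrow>
      v * v \<le> 4 * rats s 12 0 \<Longrightarrow> pts b k c + \<sigma> * v \<noteq> pts b k' c"
proof -
  note rd = ready_nats[OF s(1)] ready_pts[OF s(1)]
  define s1 where "s1 = ev base_copy s"
  define H where "H S t \<longleftrightarrow> (\<forall>(k, c)\<in>S. rats t 11 (enc k c) = pts b k c)" for S and t :: state
  have "H (Sigma {..<len b} (\<lambda>_. {..<d})) s1"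
    unfolding s1_def base_copy_def
  proof (rule ev_pairs, goal_cases)
    case (2 t)
    then show ?case using rd agrees_nats[OF 2(1), of 0] by simp
  next
    case (8 S t k c)
    have t: "ready t" "nats t 17 0 = b" using ready_agrees[OF s(1) 8(1)] agrees_nats[OF 8(1), of 17] s by auto
    show ?case
      using 8 t ready_pts(1)[OF t(1) s(3) 8(4,5)] ready_nats(2)[OF t(1)] by (auto simp: H_def)
  qed (use s rd in \<open>auto simp: H_def\<close>)
  then have base: "rats s1 11 (enc k c) = pts b k c" if "k < len b" "c < d" for k c
    using that by (auto simp: H_def)
  let ?s1 = "rset s1 13 0 1"
  have a1: "agrees {4, 6} {11} s s1" using agrees_ev[of base_copy s] by (simp add: s1_def)
  have r1: "ready ?s1" "nats ?s1 17 0 = b"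
    using ready_agrees[OF s(1) a1] agrees_nats[OF a1, of 17] s by auto
  define g where "g k k' c = (pts b k c - pts b k' c) * (pts b k c - pts b k' c)" for k k' c
  define G where "G S t \<longleftrightarrow> 0 < rats t 13 0 \<and> rats t 13 0 \<le> 1 \<and>
    (\<forall>(k, k')\<in>S. \<forall>c<d. 0 < g k k' c \<longrightarrow> rats t 13 0 \<le> g k k' c)" for S and t :: state
  define s2 where "s2 = ev (PFor 4 (lenE (nvar 17)) (PFor 5 (lenE (nvar 17)) gap_cell)) ?s1"
  have "G (Sigma {..<len b} (\<lambda>_. {..<len b})) s2"
    unfolding s2_def
  proof (rule ev_pairs, goal_cases)
    case 1
    show ?case using r1 s ready_nats[OF r1(1)] by simp
  next
    case (2 t)
    then show ?case
      using r1 s ready_nats[OF r1(1)] agrees_nats[OF 2(1), of 0] agrees_nats[OF 2(1), of 17] by simp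
  next
    case 7
    show ?case by (simp add: G_def)
  next
    case (8 S t k k')
    have t: "ready t" using ready_agrees[OF r1(1) 8(1)] by auto
    have t11: "rats t 11 = rats s1 11" using agrees_rats[OF 8(1), of 11] by simp
    let ?F = "\<lambda>c q. if 0 < g k k' c \<and> g k k' c < q then g k k' c else q"
    have n: "nval t dimE = d" using ready_nats[OF t] by simp
    have "ev gap_cell t = nset (rset t 13 0 (fold ?F [0..<nval t dimE] (rats t 13 0))) 6 0 (nval t dimE)"
      unfolding gap_cell_def
    proof (rule ev_for_rat_cell)
      fix c q assume "c < nval t dimE"
      then have c: "c < d" using n by simp
      show "ev (PIf (BAnd (RLess (RConst 0) gapE) (RLess gapE (RGet 13 (NConst 0)))) (PRSet 13 (NConst 0) gapE) PSkip)
          (nset (rset t 13 0 q) 6 0 c) = nset (rset t 13 0 (?F c q)) 6 0 c"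
        using 8(2,3) t11 base[OF 8(4) c] base[OF 8(5) c] by (simp add: g_def rset_nset)
    qed
    then have e: "rats (ev gap_cell t) 13 0 = fold ?F [0..<d] (rats t 13 0)" unfolding n by simp
    have "(0 < q \<longrightarrow> 0 < fold ?F [0..<m] q) \<and> fold ?F [0..<m] q \<le> q \<and>
        (\<forall>c<m. 0 < g k k' c \<longrightarrow> fold ?F [0..<m] q \<le> g k k' c)" for m q
    proof (induction m)
      case (Suc m)
      then show ?case by (auto simp: less_Suc_eq not_less intro: less_imp_le order_trans)
    qed simp
    from this[of "rats t 13 0" d] show ?case
      using 8(8) unfolding G_def e by (fastforce intro: order_trans)
  qed (auto simp: G_def)
  then have A: "0 < rats s2 13 0" "rats s2 13 0 \<le> 1"
    "\<And>k k' c. k < len b \<Longrightarrow> k' < len b \<Longrightarrow> c < d \<Longrightarrow> 0 < g k k' c \<Longrightarrow> rats s2 13 0 \<le> g k k' c"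
    by (auto simp: G_def)
  have a2: "agrees {4, 5, 6} {13} ?s1 s2"
    using agrees_ev[of "PFor 4 (lenE (nvar 17)) (PFor 5 (lenE (nvar 17)) gap_cell)" ?s1] by (simp add: s2_def)
  have w2: "rats s2 12 = rats s 12" "rats s2 11 = rats s1 11"
    using agrees_rats[OF a1, of 12] agrees_rats[OF a2, of 12] agrees_rats[OF a2, of 11] by auto
  have s': "s' = rset s2 14 0 (rats s2 13 0 / (rats s2 13 0 + 4 * rats s2 12 0))"
    by (simp add: s'_def scale_def s2_def s1_def)
  show "\<And>k c. k < len b \<Longrightarrow> c < d \<Longrightarrow> rats s' 11 (enc k c) = pts b k c"
    using base w2 by (simp add: s')
  define A0 where "A0 = rats s2 13 0"
  define W0 where "W0 = rats s 12 0"
  have \<sigma>: "\<sigma> = A0 / (A0 + 4 * W0)" by (simp add: \<sigma>_def s' w2 A0_def W0_def)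
  have pos: "0 < A0" "0 \<le> W0" using A W by (auto simp: A0_def W0_def)
  show "0 < \<sigma>" "\<sigma> \<le> 1" using pos by (auto simp: \<sigma> field_simps)
  show "pts b k c + \<sigma> * v \<noteq> pts b k' c"
    if k: "k < len b" "k' < len b" "c < d" "pts b k c \<noteq> pts b k' c" "v * v \<le> 4 * rats s 12 0" for k k' c v
  proof
    define a where "a = pts b k c - pts b k' c"
    assume "pts b k c + \<sigma> * v = pts b k' c"
    then have "a * (A0 + 4 * W0) = - (A0 * v)"
      using pos by (simp add: \<sigma> a_def field_simps)
    have "0 < g k k' c" using k(4) by (auto simp: g_def zero_less_mult_iff linorder_neq_iff)
    then have Aa: "A0 \<le> a * a" using A(3)[OF k(1-3)] by (simp add: g_def a_def A0_def)
    \<comment> \<open>Squaring the hypothetical equality leaves an expression in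
      \<open>v * v\<close>, the only quantity about \<open>v\<close> that is bounded.\<close>
    have "a * a * ((A0 + 4 * W0) * (A0 + 4 * W0)) = A0 * A0 * (v * v)"
    proof -
      have "a * a * ((A0 + 4 * W0) * (A0 + 4 * W0)) = (a * (A0 + 4 * W0)) * (a * (A0 + 4 * W0))" by simp
      also have "\<dots> = (- (A0 * v)) * (- (A0 * v))" using \<open>a * (A0 + 4 * W0) = - (A0 * v)\<close> by simp
      finally show ?thesis by simp
    qed
    also have "\<dots> \<le> A0 * A0 * (4 * W0)" using k(5) pos by (intro mult_left_mono) (auto simp: W0_def)
    finally have "a * a * ((A0 + 4 * W0) * (A0 + 4 * W0)) \<le> A0 * (A0 * (4 * W0))" by simp
    moreover have "A0 * ((A0 + 4 * W0) * (A0 + 4 * W0)) \<le> a * a * ((A0 + 4 * W0) * (A0 + 4 * W0))"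
      using Aa pos by (intro mult_right_mono) auto
    ultimately have "A0 * ((A0 + 4 * W0) * (A0 + 4 * W0)) \<le> A0 * (A0 * (4 * W0))" by simp
    then have "(A0 + 4 * W0) * (A0 + 4 * W0) \<le> A0 * (4 * W0)" using pos by (simp add: mult_le_cancel_left)
    moreover have "(A0 + 4 * W0) * (A0 + 4 * W0) = A0 * A0 + 16 * (W0 * W0) + 8 * (A0 * W0)"
      by (simp add: algebra_simps)
    moreover have "0 < A0 * A0" "0 \<le> W0 * W0" "0 \<le> A0 * W0" using pos by auto
    ultimately show False by (simp add: algebra_simps)
  qed
qed

lemma write_output:
  assumes s: "sized s" "nats s 17 0 = b" "b < N"
  defines "z \<equiv> \<lambda>a c. rats s 11 (enc (fst a) c) + rats s 14 0 * shift s a c"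
  defines "s' \<equiv> ev write_output s"
  obtains ss where "distinct ss" "set ss = {a \<in> slots b. 0 < slot_mass s a}" "nats s' 28 0 = length ss"
    "\<And>u c. u < length ss \<Longrightarrow> c < d \<Longrightarrow> rats s' 0 (u * (d + 1) + c) = z (ss ! u) c"
    "\<And>u. u < length ss \<Longrightarrow> rats s' 0 (u * (d + 1) + d) = slot_mass s (ss ! u)"
proof -
  let ?s = "nset s 28 0 0"
  define H where "H S t \<longleftrightarrow> (\<exists>ss. distinct ss \<and> set ss = {a \<in> S. 0 < slot_mass s a} \<and> nats t 28 0 = length ss \<and>
    (\<forall>u<length ss. (\<forall>c<d. rats t 0 (u * (d + 1) + c) = z (ss ! u) c) \<and>
      rats t 0 (u * (d + 1) + d) = slot_mass s (ss ! u)))" for S and t :: state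
  have "H (slots b) (ev (slot_loop out_slot) ?s)"
  proof (rule ev_slots[where b = b], goal_cases)
    case (7 S t k i j)
    let ?a = "(k, i, j)"
    have sz: "nats t 0 (Suc 0) = d"
      using agrees_nats[OF 7(1), of 0] sized_nats(2)[OF s(1)] by simp
    have rt: "rats t a = rats s a" if "a \<noteq> 0" for a using agrees_rats[OF 7(1), of a] that by simp
    from 7(10)[unfolded H_def] obtain ss where "distinct ss \<and> set ss = {a \<in> S. 0 < slot_mass s a} \<and>
      nats t 28 0 = length ss \<and> (\<forall>u<length ss. (\<forall>c<d. rats t 0 (u * (d + 1) + c) = z (ss ! u) c) \<and>
      rats t 0 (u * (d + 1) + d) = slot_mass s (ss ! u))" ..
    then have ss: "distinct ss" "set ss = {a \<in> S. 0 < slot_mass s a}" "nats t 28 0 = length ss"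
      "\<And>u c. u < length ss \<Longrightarrow> c < d \<Longrightarrow> rats t 0 (u * (d + 1) + c) = z (ss ! u) c"
      "\<And>u. u < length ss \<Longrightarrow> rats t 0 (u * (d + 1) + d) = slot_mass s (ss ! u)" by simp_all
    show ?case
    proof (cases "0 < slot_mass s ?a")
      case False
      then have "{a \<in> insert ?a S. 0 < slot_mass s a} = {a \<in> S. 0 < slot_mass s a}" by auto
      moreover have "ev out_slot t = t" using False 7 rt by (simp add: out_slot_def)
      ultimately show ?thesis using 7(10) by (simp only: H_def)
    next
      case True
      define m where "m = length ss * (d + 1)"
      define P where "P n u \<longleftrightarrow> (\<forall>c<n. rats u 0 (m + c) = z ?a c) \<and> (\<forall>x<m. rats u 0 x = rats t 0 x)"
        for n and u :: state
      define t1 where "t1 = ev out_coords t"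
      have "P d t1"
        unfolding t1_def out_coords_def
      proof (rule ev_for_agrees[where P = P], goal_cases)
        case (3 c u)
        have same: "nats u v = nats t v" if "v \<noteq> 6" for v using agrees_nats[OF 3(2), of v] that by simp
        have "rats u v = rats s v" if "v \<noteq> 0" for v using agrees_rats[OF 3(2), of v] rt[OF that] that by simp
        then show ?case
          using 3(3) same 7(2-4) ss(3) sz unfolding P_def z_def by (auto simp: m_def less_Suc_eq)
      qed (use sz in \<open>auto simp: P_def\<close>)
      have at: "agrees {6} {0} t t1"
        using agrees_ev[of out_coords t] by (simp add: t1_def)
      have e: "ev out_slot t = nset (rset t1 0 (m + d) (slot_mass s ?a)) 28 0 (Suc (length ss))"
        using True 7(2-4) rt ss(3) sz agrees_nats[OF at] agrees_rats[OF at]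
        by (simp add: out_slot_def t1_def[symmetric] m_def)
      \<comment> \<open>Points written earlier occupy addresses below \<open>m\<close> and are not
        overwritten.\<close>
      have low: "u * (d + 1) + c < m" if "u < length ss" "c \<le> d" for u c
      proof -
        have "u * (d + 1) + c < Suc u * (d + 1)" using that by simp
        also have "\<dots> \<le> m" unfolding m_def using that by (intro mult_right_mono) auto
        finally show ?thesis .
      qed
      show ?thesis
        unfolding H_def
      proof (intro exI[of _ "ss @ [?a]"] conjI allI impI)
        show "distinct (ss @ [?a])" using ss 7(8) \<open>(k, i, j) \<notin> S\<close> by simp
        have "{a \<in> insert ?a S. 0 < slot_mass s a} = insert ?a {a \<in> S. 0 < slot_mass s a}"
          using True by blast
        then show "set (ss @ [?a]) = {a \<in> insert ?a S. 0 < slot_mass s a}" using ss(2) by simp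
        show "nats (ev out_slot t) 28 0 = length (ss @ [?a])" by (simp add: e)
        fix u assume u: "u < length (ss @ [?a])"
        show "rats (ev out_slot t) 0 (u * (d + 1) + d) = slot_mass s ((ss @ [?a]) ! u)"
        proof (cases "u < length ss")
          case lt: True
          then show ?thesis
            using ss(5)[OF lt] low[OF lt, of d] \<open>P d t1\<close> by (simp add: e P_def nth_append)
        next
          case False
          then have "u = length ss" using u by simp
          then show ?thesis by (simp add: e m_def)
        qed
        fix c assume c: "c < d"
        show "rats (ev out_slot t) 0 (u * (d + 1) + c) = z ((ss @ [?a]) ! u) c"
        proof (cases "u < length ss")
          case lt: True
          then show ?thesis
            using ss(4)[OF lt c] low[OF lt, of c] c \<open>P d t1\<close> by (simp add: e P_def nth_append)
        next
          case False
          then have "u = length ss" using u by simp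
          then show ?thesis using \<open>P d t1\<close> c by (simp add: e P_def m_def)
        qed
      qed
    qed
  next
    case 6
    show ?case by (auto simp: H_def)
  next
    case (5 S t a x)
    then show ?case by (auto simp: H_def)
  qed (use s in \<open>auto simp: sized_def\<close>)
  then have "H (slots b) s'" by (simp add: s'_def write_output_def)
  then show thesis unfolding H_def by (elim exE conjE) (rule that, blast+)
qed

end

section \<open>The algorithm\<close>

definition barycenter_prog :: prog where
  "barycenter_prog = offsets ;; all_pairs ;; choose_base ;; lex_table ;; glue ;; scale ;; write_output"

text \<open>The number of output points is put in its place by a command outside
  \<open>prog\<close>, since \<open>wf_prog\<close> forbids writing the array of sizes.\<close>

definition barycenter_com :: com where
  "barycenter_com = Seq (compile barycenter_prog) (NSet 0 (NConst 0) (nvar 28))"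

lemma wf_barycenter_prog: "wf_prog barycenter_prog"
  by (simp add: barycenter_prog_def offsets_def all_pairs_def pair_prog_def pair_init_def cost_cell_def
      optimize_def stepsE_def phaseE_def cancel_prog_def arc_weights_def arc_weight_def arc_col_def
      extend_walks_def extend_walk_def extend_col_def best_cycle_def best_start_def trace_cycle_def
      trace_vertex_def push_amount_def push_arc_def store_cell_def choose_base_def lex_table_def lex_cell_def
      glue_def slot_loop_def glue_slot_def select_tuple_def select_point_def tuple_mass_def take_mass_def
      shift_coord_def scale_def base_copy_def gap_cell_def write_output_def out_slot_def out_coords_def)

context barycenter_input
begin

lemma exec_barycenter_com:
  defines "s0 \<equiv> init_state (encode_input I)"
  defines "s \<equiv> ev barycenter_prog s0"
  shows "\<exists>t. exec barycenter_com s0 t (nset s 0 0 (nats s 28 0)) \<and>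
    t \<le> poly (time_poly barycenter_prog + [:4:]) (entries (encode_input I))"
proof -
  obtain t where t: "exec (compile barycenter_prog) s0 t s" "t \<le> poly (time_poly barycenter_prog) (entries (encode_input I))"
    using exec_compile[OF wf_barycenter_prog, of s0 "entries (encode_input I)"] sizes_le_entries
    unfolding s_def s0_def by blast
  have "exec (NSet 0 (NConst 0) (nvar 28)) s 4 (nset s 0 0 (nats s 28 0))"
    using exec.NSet[of 0 "NConst 0" "nvar 28" s] by (simp add: eval_nat_numeral)
  from exec.Seq[OF t(1) this] show ?thesis
    using t(2) unfolding barycenter_com_def by (intro exI[of _ "t + 4"]) simp
qed

lemma sum_slots:
  fixes g :: "nat \<times> nat \<times> nat \<Rightarrow> rat"
  shows "(\<Sum>a\<in>slots b. g a) = (\<Sum>k<len b. \<Sum>x\<in>Sigma {..<N} (\<lambda>j. {..<len j}). g (k, x))"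
  unfolding slots_def by (simp add: sum.cartesian_product)

lemma card_slots: "card (Sigma {..<N} (\<lambda>j. {..<len j})) = (\<Sum>j<N. len j)"
  by (subst card_SigmaI) auto

text \<open>The output as a family of tuples \<open>t u\<close> with masses \<open>m u\<close> and points \<open>z u\<close> on the segments between
  the base point \<open>kb u\<close> and the means.\<close>

lemma barycenter_prog_result:
  defines "s \<equiv> ev barycenter_prog (init_state (encode_input I))"
  obtains b n kb t m z \<sigma> Y C where "b < N" "nats s 28 0 = n"
    "\<And>u c. u < n \<Longrightarrow> c < d \<Longrightarrow> rats s 0 (u * (d + 1) + c) = z u c"
    "\<And>u. u < n \<Longrightarrow> rats s 0 (u * (d + 1) + d) = m u"
    "\<And>u. u < n \<Longrightarrow> 0 < m u \<and> kb u < len b \<and> (\<forall>i<N. t u i < len i)"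
    "0 < \<sigma>" "\<sigma> \<le> 1"
    "\<And>u c. u < n \<Longrightarrow> c < d \<Longrightarrow> z u c = pts b (kb u) c + \<sigma> * tuple_shift b (kb u) (t u) c"
    "\<And>u u'. u < n \<Longrightarrow> u' < n \<Longrightarrow> u \<noteq> u' \<Longrightarrow> \<exists>c<d. z u c \<noteq> z u' c"
    "\<And>i k l. i < N \<Longrightarrow> k < len b \<Longrightarrow> l < len i \<Longrightarrow>
      (\<Sum>u<n. if kb u = k \<and> t u i = l then m u else 0) = Y b i k l"
    "\<And>i j. i < N \<Longrightarrow> j < N \<Longrightarrow> plan (len i) (len j) (ms i) (ms j) (Y i j) \<and>
      (\<exists>p. eps_opt (len i) (len j) (sq i j) 0 p (Y i j)) \<and>
      C i j = (\<Sum>k<len i. \<Sum>l<len j. sq i j k l * Y i j k l)"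
    "\<And>i. i < N \<Longrightarrow> (\<Sum>j<N. wt j * C b j) \<le> (\<Sum>j<N. wt j * C i j)"
proof -
  define s0 where "s0 = init_state (encode_input I)"
  define s1 where "s1 = ev offsets s0"
  define s2 where "s2 = ev all_pairs s1"
  define s3 where "s3 = ev choose_base s2"
  define s4 where "s4 = ev lex_table s3"
  define s5 where "s5 = ev glue s4"
  define s6 where "s6 = ev scale s5"
  have s: "s = ev write_output s6"
    by (simp add: s_def barycenter_prog_def s0_def s1_def s2_def s3_def s4_def s5_def s6_def)
  have r1: "ready s1" unfolding s1_def by (rule offsets) (simp add: inp_def s0_def)
  have ag2: "agrees (nwrites all_pairs) (rwrites all_pairs) s1 s2" unfolding s2_def by (rule agrees_ev)
  have ag3: "agrees (nwrites choose_base) (rwrites choose_base) s2 s3" unfolding s3_def by (rule agrees_ev)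
  have ag4: "agrees (nwrites lex_table) (rwrites lex_table) s3 s4" unfolding s4_def by (rule agrees_ev)
  have ag5: "agrees (nwrites glue) (rwrites glue) s4 s5" unfolding s5_def by (rule agrees_ev)
  have ag6: "agrees (nwrites scale) (rwrites scale) s5 s6" unfolding s6_def by (rule agrees_ev)
  have r2: "ready s2" using ready_agrees[OF r1 ag2] by simp
  have r3: "ready s3" using ready_agrees[OF r2 ag3] by simp
  have r4: "ready s4" using ready_agrees[OF r3 ag4] by simp
  have r5: "ready s5" using ready_agrees[OF r4 ag5] by simp
  have r6: "ready s6" using ready_agrees[OF r5 ag6] by simp
  note ap = all_pairs[OF r1, folded s2_def]
  define b where "b = nats s3 17 0"
  have b: "b < N" "\<And>i. i < N \<Longrightarrow> rats s2 8 b \<le> rats s2 8 i"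
    using choose_base[OF r2] by (auto simp: b_def s3_def)
  have b17: "nats s4 17 0 = b" "nats s5 17 0 = b" "nats s6 17 0 = b"
    using agrees_nats[OF ag4, of 17] agrees_nats[OF ag5, of 17] agrees_nats[OF ag6, of 17] by (auto simp: b_def)
  have rats34: "rats s4 = rats s2" using agrees_rats[OF ag3] agrees_rats[OF ag4] by auto
  define Y where "Y i j k l = rats s2 7 (enc (enc i j) (enc k l))" for i j k l
  have Y: "plan (len i) (len j) (ms i) (ms j) (Y i j) \<and> (\<exists>p. eps_opt (len i) (len j) (sq i j) 0 p (Y i j))"
    if "i < N" "j < N" for i j
  proof -
    have "Y i j = (\<lambda>k l. rats s2 7 (enc (enc i j) (enc k l)))" by (intro ext) (simp add: Y_def)
    then show ?thesis using ap(1) that by (auto simp: solved_def Let_def)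
  qed
  define C where "C = pair_cost s2"
  have C: "C i j = (\<Sum>k<len i. \<Sum>l<len j. sq i j k l * Y i j k l)" for i j
    by (simp add: C_def pair_cost_def Y_def)
  have lex: "lexed s4" unfolding s4_def by (rule lex_table[OF r3])
  have glued: "glued b s4 (slots b) s5"
    unfolding s5_def
  proof (rule glue[OF r4 lex b17(1) b(1)])
    fix k j assume kj: "k < len b" "j < N"
    show "l < len j \<Longrightarrow> 0 \<le> rest b s4 k j l" for l
      using Y[OF b(1) kj(2)] kj by (simp add: plan_def Y_def rats34)
    show "(\<Sum>l<len j. rest b s4 k j l) = ms b k"
      using Y[OF b(1) kj(2)] kj by (simp add: plan_def Y_def rats34)
  qed
  have W: "0 \<le> rats s5 12 0" using glued by (simp add: glued_def)
  note sc = scale[OF r5 b17(2) b(1) W, folded s6_def]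
  define \<sigma> where "\<sigma> = rats s6 14 0"
  have same6: "nats s6 23 = nats s5 23" "rats s6 9 = rats s5 9" "rats s6 10 = rats s5 10"
    using agrees_nats[OF ag6] agrees_rats[OF ag6] by auto
  obtain ss where ss: "distinct ss" "set ss = {a \<in> slots b. 0 < slot_mass s6 a}" "nats s 28 0 = length ss"
    "\<And>u c. u < length ss \<Longrightarrow> c < d \<Longrightarrow> rats s 0 (u * (d + 1) + c) =
      rats s6 11 (enc (fst (ss ! u)) c) + rats s6 14 0 * shift s6 (ss ! u) c"
    "\<And>u. u < length ss \<Longrightarrow> rats s 0 (u * (d + 1) + d) = slot_mass s6 (ss ! u)"
    unfolding s by (rule write_output[OF ready_sized[OF r6] b17(3) b(1)]) blast
  let ?J = "Sigma {..<N} (\<lambda>j. {..<len j})"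
  have inv: "glue_inv N len lexless (rest b s4 k) ?J (\<lambda>x. slot_mass s5 (k, x)) (\<lambda>x. sel s5 (k, x)) (rest b s5 k)"
    if "k < len b" for k
  proof -
    have J: "{x. (k, x) \<in> slots b} = ?J" using that by (auto simp: slots_def)
    have "glue_inv N len lexless (rest b s4 k) {x. (k, x) \<in> slots b} (\<lambda>x. slot_mass s5 (k, x))
        (\<lambda>x. sel s5 (k, x)) (rest b s5 k)"
      using glued that by (simp add: glued_def)
    then show ?thesis unfolding J .
  qed
  have shift: "shift s6 a c = tuple_shift b (fst a) (sel s5 a) c" "shift s6 a c * shift s6 a c \<le> rats s5 12 0"
    if "a \<in> slots b" "c < d" for a c
    using glued that unfolding glued_def same6 by blast+
  have mass_nonneg: "0 \<le> slot_mass s5 a" and sel_len: "j < N \<Longrightarrow> sel s5 a j < len j" if aS: "a \<in> slots b" for a j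
  proof -
    obtain k x where a: "a = (k, x)" "k < len b" "x \<in> ?J" using aS unfolding slots_def by blast
    interpret glue_inv N len lexless "rest b s4 k" ?J "\<lambda>x. slot_mass s5 (k, x)" "\<lambda>x. sel s5 (k, x)" "rest b s5 k"
      by (rule inv[OF a(2)])
    show "0 \<le> slot_mass s5 a" using \<delta>_nonneg[OF a(3)] a(1) by simp
    show "j < N \<Longrightarrow> sel s5 a j < len j" using sel_lt[OF a(3), of j] a(1) by simp
  qed
  have in_slots: "ss ! u \<in> slots b" "0 < slot_mass s5 (ss ! u)" if "u < length ss" for u
    using nth_mem[OF that] ss(2) by (auto simp: same6)
  define z where "z a c = pts b (fst a) c + \<sigma> * tuple_shift b (fst a) (sel s5 a) c" for a c
  have z: "rats s 0 (u * (d + 1) + c) = z (ss ! u) c" if "u < length ss" "c < d" for u c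
    using ss(4)[OF that] sc(1)[of "fst (ss ! u)" c] shift(1)[OF in_slots(1)[OF that(1)] that(2)] in_slots(1)[OF that(1)] that(2)
    by (auto simp: z_def \<sigma>_def slots_def)
  have sums: "(\<Sum>u<length ss. if fst (ss ! u) = k \<and> sel s5 (ss ! u) i = l then slot_mass s5 (ss ! u) else 0) = Y b i k l"
    if i: "i < N" "k < len b" "l < len i" for i k l
  proof -
    let ?g = "\<lambda>a. if fst a = k \<and> sel s5 a i = l then slot_mass s5 a else 0"
    have "(\<Sum>u<length ss. ?g (ss ! u)) = (\<Sum>a\<in>set ss. ?g a)"
      by (rule sum.reindex_bij_betw[OF bij_betw_nth[OF ss(1)]]) auto
    also have "\<dots> = (\<Sum>a\<in>slots b. ?g a)"
    proof (rule sum.mono_neutral_left)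
      show "finite (slots b)" by (simp add: slots_def)
      show "set ss \<subseteq> slots b" using ss(2) by auto
      show "\<forall>a\<in>slots b - set ss. ?g a = 0"
        using ss(2) mass_nonneg by (force simp: same6 not_less)
    qed
    also have "\<dots> = (\<Sum>k'<len b. if k' = k then \<Sum>x\<in>?J. if sel s5 (k, x) i = l then slot_mass s5 (k, x) else 0 else 0)"
      unfolding sum_slots by (intro sum.cong refl) (auto intro: sum.neutral)
    also have "\<dots> = (\<Sum>x\<in>?J. if sel s5 (k, x) i = l then slot_mass s5 (k, x) else 0)" using i(2) by simp
    also have "\<dots> = rest b s4 k i l"
      by (rule glue_inv_end[OF inv[OF i(2)] card_slots i(1,3)])
    finally show ?thesis by (simp add: rats34 Y_def)
  qed
  have distinct_z: "\<exists>c<d. z a c \<noteq> z a' c"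
    if a: "a \<in> slots b" "0 < slot_mass s5 a" and a': "a' \<in> slots b" "0 < slot_mass s5 a'" and ne: "a \<noteq> a'" for a a'
  proof (cases "fst a = fst a'")
    \<comment> \<open>Over the same base point, comparable tuples have different means, and the
      positive step size preserves the difference.\<close>
    case True
    define k where "k = fst a"
    define x x' where "x = snd a" and "x' = snd a'"
    have x: "a = (k, x)" "a' = (k, x')" "k < len b" "x \<in> ?J" "x' \<in> ?J" "x \<noteq> x'"
      using a(1) a'(1) ne True unfolding slots_def k_def x_def x'_def by (auto simp: prod_eq_iff)
    interpret glue_inv N len lexless "rest b s4 k" ?J "\<lambda>x. slot_mass s5 (k, x)" "\<lambda>x. sel s5 (k, x)" "rest b s5 k"
      by (rule inv[OF x(3)])
    have "comparable N lexless (sel s5 a) (sel s5 a')"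
      using comp[OF x(4-6)] a(2) a'(2) x(1,2) by simp
    then obtain c where c: "c < d" "(\<Sum>j<N. wt j * pts j (sel s5 a j) c) \<noteq> (\<Sum>j<N. wt j * pts j (sel s5 a' j) c)"
      using comparable_means[of "sel s5 a" "sel s5 a'"] sel_len[OF a(1)] sel_len[OF a'(1)] a(1) a'(1) by blast
    then have "tuple_shift b k (sel s5 a) c \<noteq> tuple_shift b k (sel s5 a') c" by (simp add: tuple_shift_def)
    then have "z a c \<noteq> z a' c" using sc(2) x(1,2) by (simp add: z_def \<sigma>_def)
    then show ?thesis using c(1) by blast
  next
    case False
    have k: "fst a < len b" "fst a' < len b" using a(1) a'(1) by (auto simp: slots_def)
    obtain c where c: "c < d" "pts b (fst a) c \<noteq> pts b (fst a') c" using pts_inj[OF b(1) k False] by blast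
    define v v' where "v = shift s6 a c" and "v' = shift s6 a' c"
    \<comment> \<open>The factor 4 in the step size originates here: the base points differ by more
      than the difference of two shifts can make up, and each squared shift is at most the
      accumulated sum.\<close>
    have "(v - v') * (v - v') \<le> 2 * (v * v) + 2 * (v' * v')"
      using zero_le_square[of "v + v'"] by (simp add: algebra_simps)
    also have "\<dots> \<le> 4 * rats s5 12 0"
      using shift(2)[OF a(1) c(1)] shift(2)[OF a'(1) c(1)] by (simp add: v_def v'_def)
    finally have "pts b (fst a) c + \<sigma> * (v - v') \<noteq> pts b (fst a') c"
      using sc(4)[OF k c] by (simp add: \<sigma>_def)
    then have "z a c \<noteq> z a' c"
      using shift(1)[OF a(1) c(1)] shift(1)[OF a'(1) c(1)] by (simp add: z_def v_def v'_def algebra_simps)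
    then show ?thesis using c(1) by blast
  qed
  show thesis
  proof (rule that[of b "length ss" "\<lambda>u. z (ss ! u)" "\<lambda>u. slot_mass s5 (ss ! u)" "\<lambda>u. fst (ss ! u)"
        "\<lambda>u. sel s5 (ss ! u)" \<sigma> Y C])
    show "b < N" by (rule b(1))
    show "nats s 28 0 = length ss" by (rule ss(3))
    show "rats s 0 (u * (d + 1) + c) = z (ss ! u) c" if "u < length ss" "c < d" for u c
      by (rule z[OF that])
    show "rats s 0 (u * (d + 1) + d) = slot_mass s5 (ss ! u)" if "u < length ss" for u
      using ss(5)[OF that] by (simp add: same6)
    show "0 < slot_mass s5 (ss ! u) \<and> fst (ss ! u) < len b \<and> (\<forall>i<N. sel s5 (ss ! u) i < len i)" if "u < length ss" for u
      using in_slots[OF that] sel_len by (auto simp: slots_def)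
    show "0 < \<sigma>" "\<sigma> \<le> 1" using sc(2,3) by (auto simp: \<sigma>_def)
    show "z (ss ! u) c = pts b (fst (ss ! u)) c + \<sigma> * tuple_shift b (fst (ss ! u)) (sel s5 (ss ! u)) c" for u c
      by (simp add: z_def)
    show "\<exists>c<d. z (ss ! u) c \<noteq> z (ss ! u') c" if "u < length ss" "u' < length ss" "u \<noteq> u'" for u u'
      using that in_slots nth_eq_iff_index_eq[OF ss(1)] by (intro distinct_z) auto
    show "(\<Sum>u<length ss. if fst (ss ! u) = k \<and> sel s5 (ss ! u) i = l then slot_mass s5 (ss ! u) else 0) = Y b i k l"
      if "i < N" "k < len b" "l < len i" for i k l by (rule sums[OF that])
    show "plan (len i) (len j) (ms i) (ms j) (Y i j) \<and> (\<exists>p. eps_opt (len i) (len j) (sq i j) 0 p (Y i j)) \<and>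
        C i j = (\<Sum>k<len i. \<Sum>l<len j. sq i j k l * Y i j k l)" if "i < N" "j < N" for i j
      using Y[OF that] C by blast
    show "(\<Sum>j<N. wt j * C b j) \<le> (\<Sum>j<N. wt j * C i j)" if "i < N" for i
      using b(2)[OF that] ap(2) b(1) that by (simp add: C_def)
  qed
qed

end

context barycenter_input
begin

lemma pt_eq: "c < d \<Longrightarrow> pt d x c = real_of_rat (x ! c)"
  by (simp add: pt_def)

sublocale real_data: bary_data d N "\<lambda>i. real_of_rat (wt i)" len
  "\<lambda>i k. pt d (supp_pt (measures I ! i) k)" "\<lambda>i k. real_of_rat (ms i k)"
proof
  show "0 < real_of_rat (wt i)" if "i < N" for i using wt_pos[OF that] by simp
  show "(\<Sum>i<N. real_of_rat (wt i)) = 1" using wt_sum by (simp flip: of_rat_sum)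
  show "pt d (supp_pt (measures I ! i) k) \<in> space (Rd d)" for i k
    by (simp add: space_Rd pt_def)
  show "inj_on (\<lambda>k. pt d (supp_pt (measures I ! i) k)) {..<len i}" if i: "i < N" for i
  proof (rule inj_onI, rule ccontr)
    fix k l assume kl: "k \<in> {..<len i}" "l \<in> {..<len i}" "k \<noteq> l"
      and eq: "pt d (supp_pt (measures I ! i) k) = pt d (supp_pt (measures I ! i) l)"
    obtain c where "c < d" "pts i k c \<noteq> pts i l c" using pts_inj[OF i _ _ kl(3)] kl(1,2) by auto
    then show False using fun_cong[OF eq, of c] by (simp add: pt_eq pts_def)
  qed
  show "0 < real_of_rat (ms i k)" if "i < N" "k < len i" for i k using ms_pos[OF that] by simp
  show "(\<Sum>k<len i. real_of_rat (ms i k)) = 1" if "i < N" for i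
    using ms_sum[OF that] by (simp flip: of_rat_sum)
qed

lemma P_law: "i < N \<Longrightarrow> real_data.P i = law d (measures I ! i)"
  unfolding real_data.P_def fin_law_def law_def by (simp add: len_def ms_def)

lemma objective_phi: "real_data.objective Q = phi I Q"
  unfolding real_data.objective_def phi_def by (intro sum.cong refl) (simp add: P_law wt_def)

lemma edist_pts: "(edist d (pt d (supp_pt (measures I ! i) k)) (pt d (supp_pt (measures I ! j) l)))\<^sup>2 =
    real_of_rat (sq i j k l)"
  unfolding edist_sq sq_def
  by (simp add: pt_eq pts_def of_rat_sum of_rat_mult of_rat_diff power2_eq_square)

lemma plan_of_rat: "plan n m a b y \<Longrightarrow>
    plan n m (\<lambda>k. real_of_rat (a k)) (\<lambda>l. real_of_rat (b l)) (\<lambda>k l. real_of_rat (y k l))"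
  by (auto simp: plan_def simp flip: of_rat_sum)

lemma eps_opt_of_rat: "eps_opt n m c 0 p y \<Longrightarrow>
    eps_opt n m (\<lambda>k l. real_of_rat (c k l)) 0 (\<lambda>k. real_of_rat (p k)) (\<lambda>k l. real_of_rat (y k l))"
  unfolding eps_opt_def zero_less_of_rat_iff add_0_right of_rat_add[symmetric] of_rat_less_eq .

lemma pair_optimal:
  assumes Y: "plan (len i) (len j) (ms i) (ms j) Y" "eps_opt (len i) (len j) (sq i j) 0 p Y"
    and y: "plan (len i) (len j) (\<lambda>k. real_of_rat (ms i k)) (\<lambda>k. real_of_rat (ms j k)) y"
  shows "real_of_rat (\<Sum>k<len i. \<Sum>l<len j. sq i j k l * Y k l) \<le>
    (\<Sum>k<len i. \<Sum>l<len j. (edist d (pt d (supp_pt (measures I ! i) k)) (pt d (supp_pt (measures I ! j) l)))\<^sup>2 * y k l)"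
  using eps_opt_0_optimal[OF eps_opt_of_rat[OF Y(2)] plan_of_rat[OF Y(1)] y]
  by (simp add: edist_pts of_rat_sum of_rat_mult)

text \<open>The cost of the best base measure is at most the weighted average over all base
  measures, which is the double sum over pairs bounded by \<open>multi_plan_pairs\<close>.\<close>

lemma base_cost_le:
  assumes C: "\<And>i j. i < N \<Longrightarrow> j < N \<Longrightarrow> plan (len i) (len j) (ms i) (ms j) (Y i j) \<and>
      (\<exists>p. eps_opt (len i) (len j) (sq i j) 0 p (Y i j)) \<and>
      C i j = (\<Sum>k<len i. \<Sum>l<len j. sq i j k l * Y i j k l)"
    and b: "\<And>i. i < N \<Longrightarrow> (\<Sum>j<N. wt j * C b j) \<le> (\<Sum>j<N. wt j * C i j)"
    and w: "real_data.multi_plan w"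
  shows "real_of_rat (\<Sum>j<N. wt j * C b j) \<le> 2 * real_data.multi_cost w"
proof -
  have "(\<Sum>j<N. wt j * C b j) = (\<Sum>i<N. wt i * (\<Sum>j<N. wt j * C b j))"
    unfolding sum_distrib_right[symmetric] wt_sum by simp
  also have "\<dots> \<le> (\<Sum>i<N. wt i * (\<Sum>j<N. wt j * C i j))"
  proof (rule sum_mono)
    fix i assume "i \<in> {..<N}"
    then show "wt i * (\<Sum>j<N. wt j * C b j) \<le> wt i * (\<Sum>j<N. wt j * C i j)"
      using b wt_pos by (simp add: mult_left_mono less_imp_le)
  qed
  finally have "real_of_rat (\<Sum>j<N. wt j * C b j) \<le> real_of_rat (\<Sum>i<N. wt i * (\<Sum>j<N. wt j * C i j))"
    by (simp only: of_rat_less_eq)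
  also have "\<dots> = (\<Sum>i<N. \<Sum>j<N. real_of_rat (wt i) * real_of_rat (wt j) * real_of_rat (C i j))"
    by (simp add: of_rat_sum of_rat_mult sum_distrib_left mult.assoc)
  also have "\<dots> \<le> 2 * real_data.multi_cost w"
  proof (rule real_data.multi_plan_pairs[OF w])
    fix i j y assume ij: "i < N" "j < N"
      and y: "plan (len i) (len j) (\<lambda>k. real_of_rat (ms i k)) (\<lambda>k. real_of_rat (ms j k)) y"
    obtain p where "eps_opt (len i) (len j) (sq i j) 0 p (Y i j)" using C[OF ij] by blast
    from pair_optimal[OF _ this y] show "real_of_rat (C i j) \<le> (\<Sum>k<len i. \<Sum>l<len j.
        (edist d (pt d (supp_pt (measures I ! i) k)) (pt d (supp_pt (measures I ! j) l)))\<^sup>2 * y k l)"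
      using C[OF ij] by simp
  qed
  finally show ?thesis .
qed

lemma mean_of_rat:
  assumes "c < d"
  shows "real_data.mean t c = real_of_rat (\<Sum>i<N. wt i * pts i (t i) c)"
  using assms by (simp add: real_data.mean_def pt_eq pts_def of_rat_sum of_rat_mult)

lemma barycenter_prog_correct:
  defines "s \<equiv> ev barycenter_prog (init_state (encode_input I))"
  shows "\<exists>P'. holds_output (nset s 0 0 (nats s 28 0)) (encode_dmeasure P') \<and> discrete_prob d P' \<and>
    (\<exists>Pbar. barycenter I Pbar \<and> phi I (law d P') \<le> 2 * phi I Pbar \<and>
      (\<exists>y. transport I P' y \<and> non_mass_splitting I P' y \<and> transport_cost I P' y \<le> 2 * phi I Pbar))"
proof -
  obtain b n kb t m z \<sigma> Y C where b: "b < N" and n: "nats s 28 0 = n"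
    and out: "\<And>u c. u < n \<Longrightarrow> c < d \<Longrightarrow> rats s 0 (u * (d + 1) + c) = z u c"
      "\<And>u. u < n \<Longrightarrow> rats s 0 (u * (d + 1) + d) = m u"
    and tup: "\<And>u. u < n \<Longrightarrow> 0 < m u \<and> kb u < len b \<and> (\<forall>i<N. t u i < len i)"
    and \<sigma>: "0 < \<sigma>" "\<sigma> \<le> 1"
    and z: "\<And>u c. u < n \<Longrightarrow> c < d \<Longrightarrow> z u c = pts b (kb u) c + \<sigma> * tuple_shift b (kb u) (t u) c"
    and dist: "\<And>u u'. u < n \<Longrightarrow> u' < n \<Longrightarrow> u \<noteq> u' \<Longrightarrow> \<exists>c<d. z u c \<noteq> z u' c"
    and marg: "\<And>i k l. i < N \<Longrightarrow> k < len b \<Longrightarrow> l < len i \<Longrightarrow>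
      (\<Sum>u<n. if kb u = k \<and> t u i = l then m u else 0) = Y b i k l"
    and opt: "\<And>i j. i < N \<Longrightarrow> j < N \<Longrightarrow> plan (len i) (len j) (ms i) (ms j) (Y i j) \<and>
      (\<exists>p. eps_opt (len i) (len j) (sq i j) 0 p (Y i j)) \<and>
      C i j = (\<Sum>k<len i. \<Sum>l<len j. sq i j k l * Y i j k l)"
    and best: "\<And>i. i < N \<Longrightarrow> (\<Sum>j<N. wt j * C b j) \<le> (\<Sum>j<N. wt j * C i j)"
    by (rule barycenter_prog_result[folded s_def]) (rule that, assumption+)
  define P' where "P' = map (\<lambda>u. (map (z u) [0..<d], m u)) [0..<n]"
  have len_P': "length P' = n" and P'_nth: "\<And>u. u < n \<Longrightarrow> supp_pt P' u = map (z u) [0..<d]"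
    "\<And>u. u < n \<Longrightarrow> mass P' u = m u"
    by (simp_all add: P'_def supp_pt_def mass_def)
  have supp_len: "length (supp_pt P' u) = d" if "u < length P'" for u using that len_P' P'_nth by simp
  \<comment> \<open>Sorting the output points by base point and by the component for measure
    \<open>i\<close> produces the sums to which \<open>marg\<close> applies.\<close>
  have X_split: "(\<Sum>u<n. g u) = (\<Sum>k<len b. \<Sum>l<len i. \<Sum>u<n. if kb u = k \<and> t u i = l then g u else 0)"
    if i: "i < N" for i and g :: "nat \<Rightarrow> 'x::comm_monoid_add"
  proof -
    have "(\<Sum>k<len b. \<Sum>l<len i. if kb u = k \<and> t u i = l then g u else 0) = g u" if u: "u < n" for u
    proof -
      have "(\<Sum>l<len i. if kb u = k \<and> t u i = l then g u else 0) = (if k = kb u then g u else 0)" for k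
        using tup[OF u] i by (cases "k = kb u") (auto simp: sum.delta)
      then show ?thesis using tup[OF u] by simp
    qed
    then have "(\<Sum>u<n. g u) = (\<Sum>u<n. \<Sum>k<len b. \<Sum>l<len i. if kb u = k \<and> t u i = l then g u else 0)"
      by simp
    also have "\<dots> = (\<Sum>k<len b. \<Sum>u<n. \<Sum>l<len i. if kb u = k \<and> t u i = l then g u else 0)"
      by (rule sum.swap)
    also have "\<dots> = (\<Sum>k<len b. \<Sum>l<len i. \<Sum>u<n. if kb u = k \<and> t u i = l then g u else 0)"
      by (intro sum.cong refl sum.swap)
    finally show ?thesis .
  qed
  have rows: "(\<Sum>l<len i. Y b i k l) = ms b k" "(\<Sum>k<len b. Y b i k l) = ms i l"
    if "i < N" "k < len b" "l < len i" for i k l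
    using opt[OF b that(1)] that by (auto simp: plan_def)
  have holds: "holds_output (nset s 0 0 (nats s 28 0)) (encode_dmeasure P')"
    unfolding holds_output_def encode_dmeasure_def
  proof (intro conjI allI impI)
    fix i assume "i < length (fst ([length P'], flat P'))"
    then show "nats (nset s 0 0 (nats s 28 0)) 0 i = fst ([length P'], flat P') ! i"
      by (simp add: n len_P')
  next
    fix i assume "i < length (snd ([length P'], flat P'))"
    then have i: "i < n * (d + 1)" using length_flat[of P' d] supp_len len_P' by simp
    define u c where "u = i div (d + 1)" and "c = i mod (d + 1)"
    have "i = u * (d + 1) + c" unfolding u_def c_def by (rule div_mult_mod_eq[symmetric])
    moreover have "c \<le> d" using mod_less_divisor[of "d + 1" i] by (simp add: c_def less_Suc_eq_le)
    moreover have "u < n" unfolding u_def using i by (rule less_mult_imp_div_less)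
    ultimately have uc: "i = u * (d + 1) + c" "c \<le> d" "u < n" by auto
    have "flat P' ! i = (if c < d then z u c else m u)"
      using flat_nth(1)[of P' d u c] supp_len uc P'_nth len_P' by simp
    moreover have "rats s 0 i = (if c < d then z u c else m u)"
      using out uc by (cases "c < d") auto
    ultimately show "rats (nset s 0 0 (nats s 28 0)) 0 i = snd ([length P'], flat P') ! i" by simp
  qed
  have "distinct (map fst P')"
  proof -
    have "inj_on (\<lambda>u. map (z u) [0..<d]) {0..<n}"
    proof (rule inj_onI, rule ccontr)
      fix u u' assume u: "u \<in> {0..<n}" "u' \<in> {0..<n}" "map (z u) [0..<d] = map (z u') [0..<d]" "u \<noteq> u'"
      obtain c where "c < d" "z u c \<noteq> z u' c" using dist[of u u'] u(1,2,4) by auto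
      then show False using arg_cong[OF u(3), of "\<lambda>x. x ! c"] by simp
    qed
    then show ?thesis by (simp add: P'_def distinct_map o_def)
  qed
  moreover have "(\<Sum>u<length P'. mass P' u) = 1"
  proof -
    have "(\<Sum>u<length P'. mass P' u) = (\<Sum>u<n. m u)" using len_P' P'_nth by simp
    \<comment> \<open>The total mass is read off the plan from the base measure to itself, the case
      of \<open>marg\<close> where the target is \<open>b\<close>.\<close>
    also have "\<dots> = (\<Sum>k<len b. \<Sum>l<len b. Y b b k l)"
      unfolding X_split[OF b, of m] using marg[OF b] by (intro sum.cong refl) auto
    also have "\<dots> = (\<Sum>k<len b. ms b k)" using rows(1)[OF b] by (intro sum.cong refl) auto
    finally show ?thesis using ms_sum[OF b] by simp
  qed
  ultimately have disc: "discrete_prob d P'"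
    using supp_len tup P'_nth len_P' by (auto simp: discrete_prob_def)
  define y where "y i u l = (if t u i = l then real_of_rat (m u) else 0)" for i u l
  have lens: "length (measures I ! i) = len i" for i by (simp add: len_def)
  have col: "(\<Sum>u<n. if t u i = l then m u else 0) = ms i l" if il: "i < N" "l < len i" for i l
  proof -
    have "(\<Sum>u<n. if t u i = l then m u else 0) = (\<Sum>k<len b. \<Sum>l'<len i. \<Sum>u<n. if kb u = k \<and> t u i = l' then if t u i = l then m u else 0 else 0)"
      by (rule X_split[OF il(1)])
    also have "\<dots> = (\<Sum>k<len b. \<Sum>l'<len i. if l' = l then Y b i k l else 0)"
    proof (intro sum.cong refl)
      fix k l' assume kl: "k \<in> {..<len b}" "l' \<in> {..<len i}"
      show "(\<Sum>u<n. if kb u = k \<and> t u i = l' then if t u i = l then m u else 0 else 0) = (if l' = l then Y b i k l else 0)"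
        using marg[OF il(1) _ il(2), of k] kl by (cases "l' = l") (auto intro: sum.neutral cong: if_cong)
    qed
    also have "\<dots> = (\<Sum>k<len b. Y b i k l)" using il by simp
    finally show ?thesis using rows(2)[OF il(1) len_pos[OF b] il(2)] by simp
  qed
  have trans: "transport I P' y"
    unfolding transport_def lens len_P'
  proof (intro conjI allI impI)
    fix i u l assume "i < N" "u < n" "l < len i"
    then show "0 \<le> y i u l" using tup by (auto simp: y_def intro: less_imp_le)
  next
    fix i u assume "i < N" "u < n"
    then show "(\<Sum>l<len i. y i u l) = real_of_rat (mass P' u)" using tup by (simp add: y_def P'_nth)
  next
    fix i l assume il: "i < N" "l < len i"
    have "(\<Sum>u<n. y i u l) = (\<Sum>u<n. real_of_rat (if t u i = l then m u else 0))"
      by (intro sum.cong) (auto simp: y_def)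
    then show "(\<Sum>u<n. y i u l) = real_of_rat (mass (measures I ! i) l)"
      using col[OF il] by (simp add: ms_def flip: of_rat_sum)
  qed
  have nms: "non_mass_splitting I P' y"
    unfolding non_mass_splitting_def lens len_P'
  proof (intro allI impI)
    fix u i assume ui: "u < n" "i < N"
    \<comment> \<open>Uniqueness rests on the positive mass of the point: at any other index the
      transport is 0 and hence different from it.\<close>
    show "\<exists>!k. k < len i \<and> y i u k = real_of_rat (mass P' u) \<and> (\<forall>k'<len i. k' \<noteq> k \<longrightarrow> y i u k' = 0)"
      using tup[OF ui(1)] ui P'_nth by (intro ex1I[of _ "t u i"]) (auto simp: y_def split: if_splits)
  qed
  let ?X = "\<lambda>i k. pt d (supp_pt (measures I ! i) k)" and ?z = "\<lambda>u. pt d (supp_pt P' u)"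
  have slot_cost: "real_data.tuple_cost (t u) (?z u) \<le> real_data.tuple_cost (t u) (?X b (kb u))" if u: "u < n" for u
  proof -
    have "?z u = (\<lambda>c\<in>{..<d}. ?X b (kb u) c + real_of_rat \<sigma> * (real_data.mean (t u) c - ?X b (kb u) c))"
    proof (rule ext)
      fix c
      show "?z u c = (\<lambda>c\<in>{..<d}. ?X b (kb u) c + real_of_rat \<sigma> * (real_data.mean (t u) c - ?X b (kb u) c)) c"
      proof (cases "c < d")
        case True
        then have "?z u c = real_of_rat (pts b (kb u) c + \<sigma> * tuple_shift b (kb u) (t u) c)"
          using P'_nth(1)[OF u] z[OF u True] by (simp add: pt_eq)
        then show ?thesis
          using True mean_of_rat[OF True, of "t u"]
          by (simp add: tuple_shift_def pt_eq pts_def of_rat_add of_rat_mult of_rat_diff)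
      qed (simp add: pt_def)
    qed
    then show ?thesis using \<sigma> by (simp add: real_data.tuple_cost_towards_mean)
  qed
  \<comment> \<open>After dropping the move towards the means, the cost of the tuples splits into
    the costs of the pairwise plans from the base measure, because gluing preserves these
    plans.\<close>
  have cost_le: "(\<Sum>u<n. real_of_rat (m u) * real_data.tuple_cost (t u) (?z u)) \<le> real_of_rat (\<Sum>j<N. wt j * C b j)"
  proof -
    have "(\<Sum>u<n. real_of_rat (m u) * real_data.tuple_cost (t u) (?z u)) \<le>
        (\<Sum>u<n. real_of_rat (m u) * real_data.tuple_cost (t u) (?X b (kb u)))"
      using slot_cost tup by (intro sum_mono mult_left_mono) (auto intro: less_imp_le)
    also have "\<dots> = (\<Sum>i<N. real_of_rat (wt i) * (\<Sum>u<n. real_of_rat (sq b i (kb u) (t u i) * m u)))"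
      unfolding real_data.tuple_cost_def edist_pts sum_distrib_left
      by (subst sum.swap) (simp add: of_rat_mult mult_ac)
    also have "\<dots> = (\<Sum>i<N. real_of_rat (wt i) * real_of_rat (C b i))"
    proof (intro sum.cong refl arg_cong2[where f = "(*)"])
      fix i assume "i \<in> {..<N}"
      then have i: "i < N" by simp
      have "(\<Sum>u<n. sq b i (kb u) (t u i) * m u) = (\<Sum>k<len b. \<Sum>l<len i. sq b i k l * Y b i k l)"
        unfolding X_split[OF i, of "\<lambda>u. sq b i (kb u) (t u i) * m u"]
      proof (intro sum.cong refl)
        fix k l assume kl: "k \<in> {..<len b}" "l \<in> {..<len i}"
        have "(\<Sum>u<n. if kb u = k \<and> t u i = l then sq b i (kb u) (t u i) * m u else 0) =
            sq b i k l * (\<Sum>u<n. if kb u = k \<and> t u i = l then m u else 0)"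
          unfolding sum_distrib_left by (intro sum.cong) auto
        then show "(\<Sum>u<n. if kb u = k \<and> t u i = l then sq b i (kb u) (t u i) * m u else 0) = sq b i k l * Y b i k l"
          using marg[OF i] kl by simp
      qed
      then show "(\<Sum>u<n. real_of_rat (sq b i (kb u) (t u i) * m u)) = real_of_rat (C b i)"
        using opt[OF b i] by (simp flip: of_rat_sum)
    qed
    also have "\<dots> = real_of_rat (\<Sum>j<N. wt j * C b j)" by (simp add: of_rat_sum of_rat_mult)
    finally show ?thesis .
  qed
  have slot_sum: "(\<Sum>i<N. real_of_rat (wt i) * (\<Sum>u<n. real_of_rat (m u) * (edist d (?z u) (?X i (t u i)))\<^sup>2)) =
      (\<Sum>u<n. real_of_rat (m u) * real_data.tuple_cost (t u) (?z u))"
    unfolding real_data.tuple_cost_def sum_distrib_left by (subst sum.swap) (simp add: mult_ac)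
  have "transport_cost I P' y = (\<Sum>i<N. real_of_rat (wt i) * (\<Sum>u<n. real_of_rat (m u) * (edist d (?z u) (?X i (t u i)))\<^sup>2))"
    unfolding transport_cost_def lens len_P'
  proof (intro sum.cong refl arg_cong2[where f = "(*)"])
    show "real_of_rat (weights I ! i) = real_of_rat (wt i)" for i by (simp add: wt_def)
    fix i u assume "i \<in> {..<N}" "u \<in> {..<n}"
    then have iu: "i < N" "u < n" by auto
    have "(\<Sum>l<len i. (edist d (?z u) (?X i l))\<^sup>2 * y i u l) =
        (\<Sum>l<len i. if l = t u i then (edist d (?z u) (?X i l))\<^sup>2 * real_of_rat (m u) else 0)"
      by (intro sum.cong) (auto simp: y_def)
    then show "(\<Sum>l<len i. (edist d (?z u) (?X i l))\<^sup>2 * y i u l) = real_of_rat (m u) * (edist d (?z u) (?X i (t u i)))\<^sup>2"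
      using tup[OF iu(2)] iu(1) by simp
  qed
  then have tc: "transport_cost I P' y \<le> real_of_rat (\<Sum>j<N. wt j * C b j)"
    using cost_le slot_sum by simp
  have law_P': "law d P' = fin_law d {..<n} (\<lambda>u. real_of_rat (m u)) ?z"
  proof -
    have "point_measure {..<n} (\<lambda>k. ennreal (real_of_rat (mass P' k))) = point_measure {..<n} (\<lambda>k. ennreal (real_of_rat (m k)))"
      unfolding point_measure_def by (intro density_cong) (auto simp: AE_count_space P'_nth)
    then show ?thesis by (simp add: law_def fin_law_def len_P')
  qed
  \<comment> \<open>Each component of the tuples gives a coupling of the output with the
    corresponding measure, so the cost of the transport bounds the squared distances as
    well.\<close>
  have "phi I (law d P') \<le> (\<Sum>i<N. real_of_rat (wt i) * (\<Sum>u<n. real_of_rat (m u) * (edist d (?z u) (?X i (t u i)))\<^sup>2))"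
    unfolding objective_phi[symmetric] real_data.objective_def
  proof (intro sum_mono mult_left_mono)
    fix i assume "i \<in> {..<N}"
    then have i: "i < N" by simp
    have "fin_law d {..<n} (\<lambda>u. real_of_rat (m u)) (\<lambda>u. ?X i (t u i)) = real_data.P i"
      unfolding real_data.P_def
    proof (rule fin_law_push)
      show "(\<Sum>u\<in>{u \<in> {..<n}. t u i = l}. real_of_rat (m u)) = real_of_rat (ms i l)" if "l \<in> {..<len i}" for l
      proof -
        have "(\<Sum>u\<in>{u \<in> {..<n}. t u i = l}. real_of_rat (m u)) = real_of_rat (\<Sum>u<n. if t u i = l then m u else 0)"
          unfolding of_rat_sum sum.inter_filter[OF finite_lessThan] by (intro sum.cong) auto
        then show ?thesis using col[OF i] that by simp
      qed
    qed (use tup i real_data.X in \<open>auto intro: less_imp_le\<close>)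
    moreover have "(W2 d (fin_law d {..<n} (\<lambda>u. real_of_rat (m u)) ?z) (fin_law d {..<n} (\<lambda>u. real_of_rat (m u)) (\<lambda>u. ?X i (t u i))))\<^sup>2 \<le>
        (\<Sum>u<n. real_of_rat (m u) * (edist d (?z u) (?X i (t u i)))\<^sup>2)"
      by (rule W2_fin_law_le) (use tup in \<open>auto simp: space_Rd pt_def intro: less_imp_le\<close>)
    ultimately show "(W2 d (law d P') (real_data.P i))\<^sup>2 \<le> (\<Sum>u<n. real_of_rat (m u) * (edist d (?z u) (?X i (t u i)))\<^sup>2)"
      by (simp add: law_P')
  qed (use wt_pos in \<open>auto intro: less_imp_le\<close>)
  then have ph: "phi I (law d P') \<le> real_of_rat (\<Sum>j<N. wt j * C b j)"
    using cost_le slot_sum by simp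
  obtain Q w where Q: "Q \<in> P2 d" "\<And>Q'. Q' \<in> P2 d \<Longrightarrow> real_data.objective Q \<le> real_data.objective Q'"
    "real_data.multi_plan w" "real_data.multi_cost w \<le> real_data.objective Q"
    using real_data.barycenter_exists by blast
  have "barycenter I Q" using Q(1,2) by (simp add: barycenter_def objective_phi)
  moreover have "real_of_rat (\<Sum>j<N. wt j * C b j) \<le> 2 * phi I Q"
    using base_cost_le[OF opt best Q(3)] Q(4) by (simp add: objective_phi)
  ultimately show ?thesis using holds disc trans nms ph tc by (meson order_trans)
qed

end

theorem theorem4:
  shows "strongly_poly_computable valid_input encode_input encode_dmeasure
    (\<lambda>I P'. discrete_prob (space_dim I) P' \<and>
      (\<exists>Pbar. barycenter I Pbar \<and>
        phi I (law (space_dim I) P') \<le> 2 * phi I Pbar \<and>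
        (\<exists>y. transport I P' y \<and> non_mass_splitting I P' y \<and>
          transport_cost I P' y \<le> 2 * phi I Pbar)))"
  unfolding strongly_poly_computable_def
proof (intro exI[of _ barycenter_com] exI[of _ "time_poly barycenter_prog + [:4:]"] allI impI)
  fix I assume "valid_input I"
  then interpret barycenter_input I by unfold_locales
  let ?s = "ev barycenter_prog (init_state (encode_input I))"
  obtain t where t: "exec barycenter_com (init_state (encode_input I)) t (nset ?s 0 0 (nats ?s 28 0))"
    "t \<le> poly (time_poly barycenter_prog + [:4:]) (entries (encode_input I))"
    using exec_barycenter_com by blast
  obtain P' where "holds_output (nset ?s 0 0 (nats ?s 28 0)) (encode_dmeasure P')"
    "discrete_prob (space_dim I) P' \<and> (\<exists>Pbar. barycenter I Pbar \<and>
      phi I (law (space_dim I) P') \<le> 2 * phi I Pbar \<and>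
      (\<exists>y. transport I P' y \<and> non_mass_splitting I P' y \<and> transport_cost I P' y \<le> 2 * phi I Pbar))"
    using barycenter_prog_correct by blast
  with t show "\<exists>t s y. exec barycenter_com (init_state (encode_input I)) t s \<and>
      t \<le> poly (time_poly barycenter_prog + [:4:]) (entries (encode_input I)) \<and>
      holds_output s (encode_dmeasure y) \<and> discrete_prob (space_dim I) y \<and>
      (\<exists>Pbar. barycenter I Pbar \<and> phi I (law (space_dim I) y) \<le> 2 * phi I Pbar \<and>
        (\<exists>y'. transport I y y' \<and> non_mass_splitting I y y' \<and> transport_cost I y y' \<le> 2 * phi I Pbar))"
    by blast
qed

end
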